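(* Let $D$ be a domain in $\mathbb C$ and let $I\subset\partial D$ denote the (possibly empty) set of irregular boundary points with respect to the Dirichlet problem. If $D\cup I$ is an open set and the Gaussian curvature of the Bergman metric on $D$ is identically $-2$, then $D$ is biholomorphic to a disc possibly less a relatively closed polar set.
   Context: $K(z)$ denotes the Bergman kernel of $D$ on the diagonal: $K(z)=\sum_j|a_j(z)|^2$ for a complete orthonormal basis $\{a_j\}$ of the space of holomorphic functions on $D$ that are square integrable with respect to Lebesgue measure. The form $g(z)|dz|^2$ with $g:=\frac{\partial^2\log K}{\partial z\,\partial\bar z}$ is called the Bergman metric if it is positive everywhere (in particular $K>0$ everywhere); speaking of the Bergman metric on $D$ presupposes this. Its Gaussian curvature is $-2g^{-1}\frac{\partial^2\log g}{\partial z\,\partial\bar z}$. No completeness of the Bergman metric is assumed. A polar set is one that is locally contained in the $-\infty$ set of a subharmonic function not identically $-\infty$. "Biholomorphic to a disc possibly less a relatively closed polar set" means biholomorphic to $\mathbb D\setminus P$ with $\mathbb D$ the unit disc and $P\subset\mathbb D$ a (possibly empty) relatively closed polar subset. *)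

theory Defs
  imports "HOL-Analysis.Analysis"
begin

text \<open>Functions on a set \<open>D\<close> are represented by total functions on the plane; only their
  values on \<open>D\<close> matter.\<close>

subsection \<open>The Bergman kernel\<close>

definition bergman_space :: "complex set \<Rightarrow> (complex \<Rightarrow> complex) set" where
  "bergman_space D =
     {f. f holomorphic_on D \<and> set_integrable lborel D (\<lambda>z. (cmod (f z))\<^sup>2)}"

definition bergman_inner :: "complex set \<Rightarrow> (complex \<Rightarrow> complex) \<Rightarrow> (complex \<Rightarrow> complex) \<Rightarrow> complex" where
  "bergman_inner D f g = (LINT z:D|lborel. f z * cnj (g z))"

text \<open>Completeness means that the linear span is dense in the \<open>L\<^sup>2\<close> norm. Two members of
  \<open>B\<close> that agree on \<open>D\<close> are equal, as otherwise they would be orthogonal unit vectors.\<close>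

definition bergman_orthonormal_basis :: "complex set \<Rightarrow> (complex \<Rightarrow> complex) set \<Rightarrow> bool" where
  "bergman_orthonormal_basis D B \<longleftrightarrow>
     B \<subseteq> bergman_space D \<and>
     (\<forall>f\<in>B. \<forall>g\<in>B. bergman_inner D f g = (if f = g then 1 else 0)) \<and>
     (\<forall>h\<in>bergman_space D. \<forall>\<epsilon>>0. \<exists>F c. finite F \<and> F \<subseteq> B \<and>
        (LINT z:D|lborel. (cmod (h z - (\<Sum>f\<in>F. c f * f z)))\<^sup>2) < \<epsilon>)"

text \<open>As is well known, the sum does not depend on the chosen basis.\<close>

definition bergman_kernel :: "complex set \<Rightarrow> complex \<Rightarrow> real" where
  "bergman_kernel D z =
     (\<Sum>\<^sub>\<infinity>f\<in>(SOME B. bergman_orthonormal_basis D B). (cmod (f z))\<^sup>2)"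

subsection \<open>The Bergman metric and its curvature\<close>

definition partial_x :: "(complex \<Rightarrow> complex) \<Rightarrow> complex \<Rightarrow> complex" where
  "partial_x f z = vector_derivative (\<lambda>t. f (z + of_real t)) (at 0)"

definition partial_y :: "(complex \<Rightarrow> complex) \<Rightarrow> complex \<Rightarrow> complex" where
  "partial_y f z = vector_derivative (\<lambda>t. f (z + \<i> * of_real t)) (at 0)"

definition wirtinger_z :: "(complex \<Rightarrow> complex) \<Rightarrow> complex \<Rightarrow> complex" where
  "wirtinger_z f z = (partial_x f z - \<i> * partial_y f z) / 2"

definition wirtinger_zbar :: "(complex \<Rightarrow> complex) \<Rightarrow> complex \<Rightarrow> complex" where
  "wirtinger_zbar f z = (partial_x f z + \<i> * partial_y f z) / 2"

text \<open>For a real-valued function of class \<open>C\<^sup>2\<close> the mixed Wirtinger derivative is real, so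
  taking the real part only adjusts the type.\<close>

definition wirtinger_z_zbar :: "(complex \<Rightarrow> real) \<Rightarrow> complex \<Rightarrow> real" where
  "wirtinger_z_zbar u z = Re (wirtinger_z (wirtinger_zbar (\<lambda>w. of_real (u w))) z)"

definition bergman_metric :: "complex set \<Rightarrow> complex \<Rightarrow> real" where
  "bergman_metric D = wirtinger_z_zbar (\<lambda>z. ln (bergman_kernel D z))"

definition has_bergman_metric :: "complex set \<Rightarrow> bool" where
  "has_bergman_metric D \<longleftrightarrow> (\<forall>z\<in>D. bergman_kernel D z > 0 \<and> bergman_metric D z > 0)"

definition bergman_curvature :: "complex set \<Rightarrow> complex \<Rightarrow> real" where
  "bergman_curvature D z =
     - 2 * inverse (bergman_metric D z) * wirtinger_z_zbar (\<lambda>w. ln (bergman_metric D w)) z"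

subsection \<open>Subharmonic functions and polar sets\<close>

text \<open>The mean of an extended-real function over the circle of centre \<open>w\<close> and radius \<open>r\<close>:
  the integral of the positive part minus that of the negative part (\<open>e2ennreal\<close> sends
  negative values to \<open>0\<close>). For functions bounded above on the circle the first integral is
  finite, and the mean may be \<open>-\<infinity>\<close>.\<close>

definition circle_mean :: "(complex \<Rightarrow> ereal) \<Rightarrow> complex \<Rightarrow> real \<Rightarrow> ereal" where
  "circle_mean u w r =
     (enn2ereal (\<integral>\<^sup>+t\<in>{0..2*pi}. e2ennreal (u (w + of_real r * cis t)) \<partial>lborel)
      - enn2ereal (\<integral>\<^sup>+t\<in>{0..2*pi}. e2ennreal (- u (w + of_real r * cis t)) \<partial>lborel))
     / ereal (2 * pi)"

text \<open>The set \<open>U\<close> is meant to be open. The function that is identically \<open>-\<infinity>\<close> is allowed.\<close>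

definition subharmonic_on :: "(complex \<Rightarrow> ereal) \<Rightarrow> complex set \<Rightarrow> bool" where
  "subharmonic_on u U \<longleftrightarrow>
     (\<forall>z\<in>U. u z < \<infinity>) \<and>
     (\<forall>c. openin (top_of_set U) {z\<in>U. u z < c}) \<and>
     (\<forall>w\<in>U. \<exists>\<rho>>0. \<forall>r. 0 < r \<and> r < \<rho> \<longrightarrow> u w \<le> circle_mean u w r)"

text \<open>The neighbourhood must be connected: otherwise a function equal to \<open>-\<infinity>\<close> on only one
  component would count as not identically \<open>-\<infinity>\<close>.\<close>

definition polar_set :: "complex set \<Rightarrow> bool" where
  "polar_set P \<longleftrightarrow>
     (\<forall>z\<in>P. \<exists>U u. open U \<and> connected U \<and> z \<in> U \<and> subharmonic_on u U \<and>
        (\<exists>w\<in>U. u w \<noteq> -\<infinity>) \<and> P \<inter> U \<subseteq> {w. u w = -\<infinity>})"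

subsection \<open>Boundary regularity for the Dirichlet problem\<close>

text \<open>The Dirichlet problem is posed, as usual, on the boundary of \<open>D\<close> in the Riemann sphere.
  A continuous boundary function is given by a continuous \<open>\<phi>\<close> on the finite boundary
  together with a value \<open>c\<close> at the point at infinity, to which \<open>\<phi>\<close> must tend there.
  If \<open>D\<close> is bounded, the filters at infinity below are trivial and \<open>c\<close> plays no role.\<close>

definition dirichlet_data :: "complex set \<Rightarrow> (complex \<Rightarrow> real) \<Rightarrow> real \<Rightarrow> bool" where
  "dirichlet_data D \<phi> c \<longleftrightarrow>
     continuous_on (frontier D) \<phi> \<and>
     (\<phi> \<longlongrightarrow> c) (inf at_infinity (principal (frontier D)))"

definition perron_family :: "complex set \<Rightarrow> (complex \<Rightarrow> real) \<Rightarrow> real \<Rightarrow> (complex \<Rightarrow> ereal) set" where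
  "perron_family D \<phi> c =
     {u. subharmonic_on u D \<and>
         (\<forall>\<zeta>\<in>frontier D. Limsup (at \<zeta> within D) u \<le> ereal (\<phi> \<zeta>)) \<and>
         Limsup (inf at_infinity (principal D)) u \<le> ereal c}"

definition perron_solution :: "complex set \<Rightarrow> (complex \<Rightarrow> real) \<Rightarrow> real \<Rightarrow> complex \<Rightarrow> ereal" where
  "perron_solution D \<phi> c z = (SUP u\<in>perron_family D \<phi> c. u z)"

definition regular_boundary_point :: "complex set \<Rightarrow> complex \<Rightarrow> bool" where
  "regular_boundary_point D \<zeta> \<longleftrightarrow>
     \<zeta> \<in> frontier D \<and>
     (\<forall>\<phi> c. dirichlet_data D \<phi> c \<longrightarrow>
        (perron_solution D \<phi> c \<longlongrightarrow> ereal (\<phi> \<zeta>)) (at \<zeta> within D))"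

definition irregular_boundary_points :: "complex set \<Rightarrow> complex set" where
  "irregular_boundary_points D = {\<zeta>\<in>frontier D. \<not> regular_boundary_point D \<zeta>}"

subsection \<open>Biholomorphic equivalence\<close>

definition biholomorphic :: "complex set \<Rightarrow> complex set \<Rightarrow> bool" where
  "biholomorphic D E \<longleftrightarrow>
     (\<exists>f g. homeomorphism D E f g \<and> f holomorphic_on D \<and> g holomorphic_on E)"

end

theory Submission
  imports Defs "HOL-Complex_Analysis.Complex_Analysis"
begin

text \<open>Let \<open>K(z, w)\<close> be the Bergman kernel, holomorphic in \<open>z\<close> and antiholomorphic in \<open>w\<close>. The
  curvature hypothesis says that \<open>log g\<close> and \<open>log K\<close> have the same mixed Wirtinger derivative, namely
  \<open>g\<close>, on the diagonal; the equation extends to two independent variables. Solved near a point \<open>p\<close>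
  as a Goursat problem, it gives \<open>K(z, w) K(p, p) (1 - F(z) cnj(F(w)))\<^sup>2 = K(z, p) K(p, w)\<close> with a
  local holomorphic \<open>F\<close>. By analytic continuation \<open>F\<close> is meromorphic on \<open>D\<close>; the identity forces
  \<open>|F| < 1\<close> and, by the maximum principle, that \<open>K\<close> has no zeros, so \<open>F\<close> maps \<open>D\<close>
  holomorphically into the unit disc.

  By the reproducing property \<open>f / K(\<sqdot>, p)\<close> is a function of \<open>F\<close> for every square integrable
  holomorphic \<open>f\<close>. Applied to \<open>f = K(\<sqdot>, p) (F - F(b)) / (\<sqdot> - b)\<close> this shows that \<open>F\<close> is injective.
  Expanding \<open>K\<close> in powers of \<open>F\<close>, the quotient \<open>f / K(\<sqdot>, p)\<close> is even \<open>H \<circ> F\<close> with \<open>H\<close> holomorphic on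
  the whole disc; hence, with \<open>H\<^sub>1\<close> belonging to \<open>f = F'\<close>, every square integrable holomorphic \<open>h\<close> on
  the image of \<open>F\<close> is a quotient \<open>H / H\<^sub>1\<close>.

  It remains to see that a relatively closed set \<open>P\<close> that is removable in this sense is polar. If
  the Leja points of a compact part of \<open>P\<close> had bounded logarithmic energy, the normal limit of the
  Cauchy transforms of their weighted counting measures would be square integrable, and the
  integral of its product with \<open>H\<^sub>1\<close> around the compact part would be \<open>2 \<pi> \<i>\<close> instead of \<open>0\<close>. So
  averaged logarithmic potentials of points of \<open>P\<close> can be made arbitrarily large on compact parts
  of \<open>P\<close>, and a weighted sum of such potentials is \<open>\<infinity>\<close> on \<open>P\<close> but finite elsewhere.\<close>

subsection \<open>Area and mean value estimates\<close>

text \<open>The link between area and potentials is one estimate: the integral of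
  \<open>1 / (|\<zeta> - a| |\<zeta> - b|)\<close> over the disc is at most a constant plus a
  multiple of \<open>log (1 / |a - b|)\<close>. Expanding the square of an averaged Cauchy transform
  therefore bounds its norm by the logarithmic energy of its poles. The diagonal terms of the
  expansion diverge, so with \<open>n\<close> poles the discs of radius \<open>1 / n\<close> about
  them are cut out; Fatou's lemma removes the cut in the limit.

  Capacity and equilibrium measures are bypassed by a dichotomy for greedily chosen points: either
  at some stage the product of distances is exponentially small, and maximality makes the potential
  large on the whole compact set, or the energy grows at most quadratically in the number of points.
  The weights are \<open>1 / H\<^sub>1\<close> at the poles, which makes all residues against
  \<open>H\<^sub>1\<close> equal but requires that \<open>H\<^sub>1\<close> has no zero there. Its
  zeros are isolated, and each is covered by a single logarithmic pole.

  Injectivity and factorization through \<open>F\<close> have the same source: up to a constant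
  factor, \<open>K(\<sqdot>, z)\<close> depends on \<open>z\<close> only through
  \<open>F(z)\<close>.\<close>

definition complex_of_vec :: "real^2 \<Rightarrow> complex" where
  "complex_of_vec v = Complex (v$1) (v$2)"

definition vec_of_complex :: "complex \<Rightarrow> real^2" where
  "vec_of_complex z = vector [Re z, Im z]"

lemma vec_of_complex_nth [simp]: "vec_of_complex z $ 1 = Re z" "vec_of_complex z $ 2 = Im z"
  by (simp_all add: vec_of_complex_def)

lemma complex_of_vec_sel [simp]: "Re (complex_of_vec v) = v$1" "Im (complex_of_vec v) = v$2"
  by (simp_all add: complex_of_vec_def)

lemma complex_of_vec_inverse [simp]:
  "complex_of_vec (vec_of_complex z) = z" "vec_of_complex (complex_of_vec v) = v"
  by (simp_all add: complex_eq_iff vec_eq_iff forall_2)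

lemma bounded_linear_complex_of_vec: "bounded_linear complex_of_vec"
  by (rule linear_conv_bounded_linear[THEN iffD1], rule linearI)
     (simp_all add: complex_eq_iff)

lemma bounded_linear_vec_of_complex: "bounded_linear vec_of_complex"
  by (rule linear_conv_bounded_linear[THEN iffD1], rule linearI)
     (simp_all add: vec_eq_iff forall_2)

text \<open>Boxes determine Lebesgue measure, and the preimage of a box is the box with the same
  sides.\<close>

lemma distr_complex_of_vec: "distr lborel borel complex_of_vec = lborel"
proof -
  have [measurable]: "complex_of_vec \<in> borel \<rightarrow>\<^sub>M borel"
    using bounded_linear_complex_of_vec
    by (intro borel_measurable_continuous_onI linear_continuous_on)
  have "lborel = distr lborel borel complex_of_vec"
  proof (rule lborel_eqI)
    fix l u :: complex assume le: "\<And>b. b \<in> Basis \<Longrightarrow> l \<bullet> b \<le> u \<bullet> b"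
    have eq: "complex_of_vec -` box l u = box (vec_of_complex l) (vec_of_complex u)"
      by (auto simp: box_def Basis_complex_def Basis_vec_def inner_axis forall_2)
    have le': "vec_of_complex l \<bullet> b \<le> vec_of_complex u \<bullet> b" if "b \<in> Basis" for b
      using that le[of 1] le[of \<i>] by (auto simp: Basis_complex_def Basis_vec_def inner_axis UNIV_2)
    have B2: "(Basis :: (real^2) set) = {axis 1 1, axis 2 1}"
      by (auto simp: Basis_vec_def UNIV_2)
    have ax: "axis 1 1 \<noteq> (axis 2 1 :: real^2)"
      by (simp add: axis_eq_axis)
    have "emeasure lborel (box (vec_of_complex l) (vec_of_complex u)) = 
        (\<Prod>b\<in>Basis. (vec_of_complex u - vec_of_complex l) \<bullet> b)"
      by (rule emeasure_lborel_box) (rule le')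
    then show "emeasure (distr lborel borel complex_of_vec) (box l u) = (\<Prod>b\<in>Basis. (u - l) \<bullet> b)"
      using ax by (simp add: emeasure_distr eq B2 Basis_complex_def inner_diff_left inner_axis)
  qed simp
  then show ?thesis by simp
qed

lemma nn_integral_complex_of_vec:
  assumes "f \<in> borel_measurable borel"
  shows "(\<integral>\<^sup>+ z. f z \<partial>(lborel :: complex measure)) = (\<integral>\<^sup>+ v. f (complex_of_vec v) \<partial>lborel)"
proof -
  have [measurable]: "complex_of_vec \<in> borel \<rightarrow>\<^sub>M borel"
    using bounded_linear_complex_of_vec
    by (intro borel_measurable_continuous_onI linear_continuous_on)
  show ?thesis
    by (subst distr_complex_of_vec[symmetric]) (use assms in \<open>simp add: nn_integral_distr\<close>)
qed

text \<open>The library has the change of variables only for \<open>real^'n\<close>, hence the transport.\<close>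

lemma nn_integral_deriv_image:
  assumes D: "open S" and hol: "F holomorphic_on S" and inj: "inj_on F S" and bd: "bounded (F ` S)"
  shows "(\<integral>\<^sup>+ z\<in>S. ennreal ((cmod (deriv F z))\<^sup>2) \<partial>lborel) = emeasure lborel (F ` S)"
proof -
  define T where "T = complex_of_vec -` S"
  define g where "g = vec_of_complex \<circ> F \<circ> complex_of_vec"
  define g' where "g' v = vec_of_complex \<circ> (\<lambda>h. deriv F (complex_of_vec v) * h) \<circ> complex_of_vec" for v
  have contJ: "continuous_on UNIV complex_of_vec"
    using bounded_linear_complex_of_vec by (rule linear_continuous_on)
  have contJ': "continuous_on A vec_of_complex" for A
    using bounded_linear_vec_of_complex by (rule linear_continuous_on)
  have opT: "open T" unfolding T_def using D contJ by (rule open_vimage)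
  have der: "(g has_derivative g' v) (at v within T)" if "v \<in> T" for v
  proof -
    have 1: "(F has_derivative (\<lambda>h. deriv F (complex_of_vec v) * h)) (at (complex_of_vec v))"
      using that hol D unfolding T_def
      by (metis has_field_derivative_def holomorphic_derivI vimage_eq)
    have "(g has_derivative g' v) (at v)"
      unfolding g_def g'_def
      by (intro diff_chain_at bounded_linear.has_derivative[OF bounded_linear_complex_of_vec]
          bounded_linear_imp_has_derivative bounded_linear_complex_of_vec bounded_linear_vec_of_complex 1)
    then show ?thesis by (rule has_derivative_at_withinI)
  qed
  have injg: "inj_on g T"
    unfolding g_def T_def
    by (rule inj_onI) (metis (no_types, lifting) comp_apply complex_of_vec_inverse inj inj_on_eq_iff vimage_eq)
  \<comment> \<open>Multiplication by a complex number has as real Jacobian determinant its squared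
    modulus.\<close>
  have det: "\<bar>det (matrix (g' v))\<bar> = (cmod (deriv F (complex_of_vec v)))\<^sup>2" for v
    by (simp add: det_2 matrix_def g'_def axis_def cmod_power2)
       (simp add: power2_eq_square)
  have img: "g ` T = vec_of_complex ` (F ` S)"
  proof -
    have "complex_of_vec ` T = S"
      unfolding T_def using surjI[of complex_of_vec vec_of_complex] by (simp add: surj_image_vimage_eq)
    then show ?thesis unfolding g_def by (simp only: image_comp[symmetric])
  qed
  have img': "g ` T = complex_of_vec -` (F ` S)"
    unfolding img by (auto simp: image_iff) (metis complex_of_vec_inverse)+
  have opF: "open (F ` S)"
    using open_mapping_thm3[OF hol D inj] .
  have opg: "open (g ` T)"
    unfolding img' using opF contJ by (rule open_vimage)
  have bdg: "bounded (g ` T)"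
    unfolding img using bd bounded_linear_vec_of_complex by (rule bounded_linear_image)
  have lm: "g ` T \<in> lmeasurable"
    using opg bdg by (simp add: lmeasurable_open)
  then have int: "((\<lambda>v. \<bar>det (matrix (g' v))\<bar>) has_integral measure lebesgue (g ` T)) T"
    using has_measure_differentiable_image[OF _ der injg, of "measure lebesgue (g ` T)"] opT
    by (simp add: lborelD)
  have hold: "deriv F holomorphic_on S" using hol D by (rule holomorphic_deriv)
  have cont2: "continuous_on S (\<lambda>z. (cmod (deriv F z))\<^sup>2)"
    by (intro continuous_intros holomorphic_on_imp_continuous_on hold)
  have meas: "(\<lambda>z. ennreal ((cmod (deriv F z))\<^sup>2) * indicator S z) \<in> borel_measurable borel"
  proof -
    have "(\<lambda>z. indicator S z *\<^sub>R (cmod (deriv F z))\<^sup>2) \<in> borel_measurable borel"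
      using cont2 D by (intro borel_measurable_continuous_on_indicator) auto
    then have "(\<lambda>z. ennreal (indicator S z *\<^sub>R (cmod (deriv F z))\<^sup>2)) \<in> borel_measurable borel"
      by measurable
    also have "(\<lambda>z. ennreal (indicator S z *\<^sub>R (cmod (deriv F z))\<^sup>2))
        = (\<lambda>z. ennreal ((cmod (deriv F z))\<^sup>2) * indicator S z)"
      by (auto simp: indicator_def)
    finally show ?thesis .
  qed
  have "(\<integral>\<^sup>+ z\<in>S. ennreal ((cmod (deriv F z))\<^sup>2) \<partial>lborel) =
     (\<integral>\<^sup>+ v. ennreal ((cmod (deriv F (complex_of_vec v)))\<^sup>2) * indicator S (complex_of_vec v) \<partial>lborel)"
    using meas by (rule nn_integral_complex_of_vec)
  also have "\<dots> = (\<integral>\<^sup>+ v\<in>T. ennreal \<bar>det (matrix (g' v))\<bar> \<partial>lborel)"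
    by (intro nn_integral_cong) (simp add: T_def det indicator_def)
  also have "\<dots> = (\<integral>\<^sup>+ v. ennreal (indicator T v * \<bar>det (matrix (g' v))\<bar>) \<partial>lborel)"
    by (intro nn_integral_cong) (simp add: indicator_def)
  also have "\<dots> = ennreal (measure lebesgue (g ` T))"
    by (rule nn_integral_has_integral_lebesgue[OF _ int]) simp
  also have "\<dots> = emeasure lborel (g ` T)"
  proof -
    have "emeasure lborel (g ` T) \<noteq> top"
      using emeasure_bounded_finite[OF bdg] by auto
    moreover have "measure lebesgue (g ` T) = measure lborel (g ` T)"
      using opg by (intro measure_completion) auto
    ultimately show ?thesis by (simp add: emeasure_eq_ennreal_measure)
  qed
  also have "\<dots> = emeasure (distr lborel borel complex_of_vec) (F ` S)"
  proof -
    have "complex_of_vec \<in> lborel \<rightarrow>\<^sub>M borel"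
      using contJ borel_measurable_continuous_onI by auto
    then show ?thesis using opF by (subst emeasure_distr) (simp_all add: img')
  qed
  finally show ?thesis by (simp add: distr_complex_of_vec)
qed

text \<open>The preimage of a box is its image under the inverse motion, whose derivative has
  modulus one, so the area formula gives it the measure of the box.\<close>

lemma distr_lborel_rotation:
  fixes a w :: complex
  assumes "cmod w = 1"
  shows "distr lborel borel (\<lambda>z. a + w * z) = lborel"
proof -
  have w0: "w \<noteq> 0" using assms by auto
  have "lborel = distr lborel borel (\<lambda>z. a + w * z)"
  proof (rule lborel_eqI)
    fix l u :: complex assume le: "\<And>b. b \<in> Basis \<Longrightarrow> l \<bullet> b \<le> u \<bullet> b"
    have pre: "(\<lambda>z. a + w * z) -` box l u = (\<lambda>z. (z - a) / w) ` box l u"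
      using w0 by (force simp: image_iff)
    have der: "deriv (\<lambda>z. (z - a) / w) z = 1 / w" for z
      by (rule DERIV_imp_deriv) (auto intro!: derivative_eq_intros simp: w0 field_simps)
    have "emeasure lborel ((\<lambda>z. (z - a) / w) ` box l u) = 
       (\<integral>\<^sup>+ z\<in>box l u. ennreal ((cmod (deriv (\<lambda>z. (z - a) / w) z))\<^sup>2) \<partial>lborel)"
    proof (rule nn_integral_deriv_image[symmetric])
      show "inj_on (\<lambda>z. (z - a) / w) (box l u)" using w0 by (auto simp: inj_on_def)
      have "bounded ((\<lambda>z. (z - a) / w) ` cbox l u)"
        by (intro compact_imp_bounded compact_continuous_image) (auto intro!: continuous_intros simp: w0)
      then show "bounded ((\<lambda>z. (z - a) / w) ` box l u)"
        by (rule bounded_subset) (auto simp: box_subset_cbox image_mono)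
    qed (use w0 in \<open>auto intro!: holomorphic_intros\<close>)
    also have "\<dots> = emeasure lborel (box l u)"
      by (simp add: der norm_divide assms)
    also have "\<dots> = (\<Prod>b\<in>Basis. (u - l) \<bullet> b)"
      using le by (simp add: emeasure_lborel_box_eq)
    finally show "emeasure (distr lborel borel (\<lambda>z. a + w * z)) (box l u) = (\<Prod>b\<in>Basis. (u - l) \<bullet> b)"
      by (subst emeasure_distr) (auto simp: pre)
  qed simp
  then show ?thesis by simp
qed

section \<open>Mean values over circles and discs\<close>

lemma has_integral_circle_mean:
  assumes hol: "f holomorphic_on ball z R" and r: "0 \<le> r" "r < R"
  shows "((\<lambda>t. f (z + of_real r * cis t)) has_integral of_real (2 * pi) * f z) {0..2*pi}"
proof (cases "r = 0")
  case True
  then show ?thesis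
    using has_integral_const_real[of "f z" 0 "2*pi"] by (simp add: scaleR_conv_of_real)
next
  case False
  with r have r0: "0 < r" by simp
  have "((\<lambda>u. f u / (u - z)) has_contour_integral 2 * of_real pi * \<i> * f z) (circlepath z r)"
    using r r0 by (intro Cauchy_integral_circlepath_simple holomorphic_on_subset[OF hol]) auto
  then have "((\<lambda>t. f (z + r * cis t) / (z + r * cis t - z) * r * \<i> * cis t) has_integral
       2 * of_real pi * \<i> * f z) {0..2*pi}"
    unfolding circlepath_def by (subst (asm) has_contour_integral_part_circlepath_iff) auto
  then have "((\<lambda>t. \<i> * f (z + r * cis t)) has_integral 2 * of_real pi * \<i> * f z) {0..2*pi}"
    using r0 by (simp add: field_simps)
  then have "((\<lambda>t. (- \<i>) * (\<i> * f (z + r * cis t))) has_integral (- \<i>) * (2 * of_real pi * \<i> * f z)) {0..2*pi}"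
    by (rule has_integral_mult_right)
  then show ?thesis by (simp add: algebra_simps)
qed

text \<open>The mean value property is applied to the square of \<open>f\<close>, and the modulus is
  then taken inside the integral.\<close>

lemma nn_circle_submean:
  assumes hol: "f holomorphic_on ball 0 R" and R: "1 < R"
  shows "ennreal ((cmod (f 0))\<^sup>2) * ennreal (2 * pi)
      \<le> (\<integral>\<^sup>+ t\<in>{0..2*pi}. ennreal ((cmod (f (cis t)))\<^sup>2) \<partial>lborel)"
proof -
  have hol2: "(\<lambda>z. (f z)\<^sup>2) holomorphic_on ball 0 R" by (intro holomorphic_intros hol)
  have I: "((\<lambda>t. (f (cis t))\<^sup>2) has_integral of_real (2 * pi) * (f 0)\<^sup>2) {0..2*pi}"
    using has_integral_circle_mean[OF hol2, of 1] R by simp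
  have cis: "continuous_on {0..2*pi} (\<lambda>t. f (cis t))"
    using R by (intro continuous_on_compose2[OF holomorphic_on_imp_continuous_on[OF hol]])
      (auto intro!: continuous_intros)
  have cont: "continuous_on {0..2*pi} (\<lambda>t. (cmod (f (cis t)))\<^sup>2)"
    by (intro continuous_intros cis)
  then have J: "((\<lambda>t. (cmod (f (cis t)))\<^sup>2) has_integral integral {0..2*pi} (\<lambda>t. (cmod (f (cis t)))\<^sup>2)) {0..2*pi}"
    by (intro integrable_integral integrable_continuous_real)
  have "cmod (of_real (2 * pi) * (f 0)\<^sup>2) \<le> integral {0..2*pi} (\<lambda>t. (cmod (f (cis t)))\<^sup>2)"
    using integral_norm_bound_integral[of "\<lambda>t. (f (cis t))\<^sup>2" "{0..2*pi}" "\<lambda>t. (cmod (f (cis t)))\<^sup>2"] I J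
    by (auto simp: norm_power has_integral_iff)
  then have "ennreal ((cmod (f 0))\<^sup>2 * (2 * pi)) \<le> ennreal (integral {0..2*pi} (\<lambda>t. (cmod (f (cis t)))\<^sup>2))"
    by (intro ennreal_leI) (simp add: norm_mult norm_power mult.commute)
  also have "\<dots> = (\<integral>\<^sup>+ t\<in>{0..2*pi}. ennreal ((cmod (f (cis t)))\<^sup>2) \<partial>lborel)"
    by (rule nn_integral_has_integral_lebesgue'[OF _ J, symmetric]) simp
  finally show ?thesis by (simp add: ennreal_mult')
qed

text \<open>Polar coordinates are avoided: for every \<open>u\<close> in the disc the circle
  inequality bounds the value at the centre by the mean over the circle through \<open>u\<close>.
  After integration over \<open>u\<close> and an exchange of integrals, rotation invariance makes
  all inner integrals equal, and a factor \<open>2 * pi\<close> cancels.\<close>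

lemma bergman_point_estimate:
  assumes hol: "f holomorphic_on ball z R" and R: "0 < R"
  shows "ennreal ((cmod (f z))\<^sup>2) * ennreal (pi * R\<^sup>2)
     \<le> (\<integral>\<^sup>+ w\<in>ball z R. ennreal ((cmod (f w))\<^sup>2) \<partial>lborel)"
proof -
  define \<phi> where "\<phi> u = ennreal ((cmod (f (z + u)))\<^sup>2) * indicator (ball 0 R) u" for u
  define c where "c = ennreal ((cmod (f z))\<^sup>2) * ennreal (2 * pi)"
  have hol': "(\<lambda>u. f (z + u)) holomorphic_on ball 0 R"
    by (rule holomorphic_on_compose_gen[OF _ hol, unfolded o_def]) (auto intro!: holomorphic_intros simp: dist_norm)
  have [measurable]: "\<phi> \<in> borel_measurable borel"
  proof -
    have "(\<lambda>u. indicator (ball 0 R) u *\<^sub>R (cmod (f (z + u)))\<^sup>2) \<in> borel_measurable borel"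
      by (intro borel_measurable_continuous_on_indicator continuous_intros
          holomorphic_on_imp_continuous_on hol') auto
    then have "(\<lambda>u. ennreal (indicator (ball 0 R) u *\<^sub>R (cmod (f (z + u)))\<^sup>2)) \<in> borel_measurable borel"
      by measurable
    also have "(\<lambda>u. ennreal (indicator (ball 0 R) u *\<^sub>R (cmod (f (z + u)))\<^sup>2)) = \<phi>"
      by (auto simp: indicator_def \<phi>_def)
    finally show ?thesis .
  qed
  have rot: "(\<integral>\<^sup>+ u. \<phi> (cis t * u) \<partial>lborel) = (\<integral>\<^sup>+ u. \<phi> u \<partial>lborel)" for t
  proof -
    have [measurable]: "(\<lambda>u::complex. cis t * u) \<in> borel \<rightarrow>\<^sub>M borel"
      by (intro borel_measurable_continuous_onI continuous_intros)
    have "(\<integral>\<^sup>+ u. \<phi> u \<partial>lborel) = (\<integral>\<^sup>+ u. \<phi> u \<partial>(distr lborel borel (\<lambda>u. cis t * u)))"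
      using distr_lborel_rotation[of "cis t" 0] by simp
    also have "\<dots> = (\<integral>\<^sup>+ u. \<phi> (cis t * u) \<partial>lborel)"
      by (subst nn_integral_distr) auto
    finally show ?thesis by simp
  qed
  have shift: "(\<integral>\<^sup>+ u. \<phi> u \<partial>lborel) = (\<integral>\<^sup>+ w\<in>ball z R. ennreal ((cmod (f w))\<^sup>2) \<partial>lborel)"
  proof -
    have [measurable]: "(\<lambda>u::complex. - z + u) \<in> borel \<rightarrow>\<^sub>M borel"
      by (intro borel_measurable_continuous_onI continuous_intros)
    have "(\<integral>\<^sup>+ u. \<phi> u \<partial>lborel) = (\<integral>\<^sup>+ u. \<phi> u \<partial>(distr lborel borel (\<lambda>u. - z + u)))"
      using distr_lborel_rotation[of 1 "-z"] by simp
    also have "\<dots> = (\<integral>\<^sup>+ u. \<phi> (- z + u) \<partial>lborel)"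
      by (subst nn_integral_distr) auto
    also have "\<dots> = (\<integral>\<^sup>+ w\<in>ball z R. ennreal ((cmod (f w))\<^sup>2) \<partial>lborel)"
      by (intro nn_integral_cong) (auto simp: \<phi>_def indicator_def dist_norm norm_minus_commute)
    finally show ?thesis .
  qed
  have mean: "c * indicator (ball 0 R) u \<le> (\<integral>\<^sup>+ t. \<phi> (cis t * u) * indicator {0..2*pi} t \<partial>lborel)" for u
  proof (cases "u \<in> ball 0 R")
    case True
    \<comment> \<open>As a function of \<open>x\<close>, \<open>f (z + u * x)\<close> is holomorphic
      on the disc of radius \<open>R / cmod u\<close>, which exceeds one; for \<open>u = 0\<close>
      any radius above one serves.\<close>
    define \<rho> where "\<rho> = (if u = 0 then 2 else R / cmod u)"
    have \<rho>: "1 < \<rho>" using True by (simp add: \<rho>_def)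
    have *: "z + u * x \<in> ball z R" if "x \<in> ball 0 \<rho>" for x
      using that True R by (cases "u = 0") (auto simp: \<rho>_def dist_norm norm_mult field_simps)
    have "(\<lambda>x. f (z + u * x)) holomorphic_on ball 0 \<rho>"
      by (rule holomorphic_on_compose_gen[OF _ hol, unfolded o_def]) (use * in \<open>auto intro!: holomorphic_intros\<close>)
    from nn_circle_submean[OF this \<rho>]
    have "c \<le> (\<integral>\<^sup>+ t\<in>{0..2*pi}. ennreal ((cmod (f (z + u * cis t)))\<^sup>2) \<partial>lborel)"
      by (simp add: c_def)
    also have "\<dots> = (\<integral>\<^sup>+ t. \<phi> (cis t * u) * indicator {0..2*pi} t \<partial>lborel)"
      using True by (intro nn_integral_cong) (auto simp: \<phi>_def norm_mult mult.commute indicator_def)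
    finally show ?thesis using True by simp
  qed simp
  have "c * emeasure lborel (ball (0::complex) R) = (\<integral>\<^sup>+ u. c * indicator (ball (0::complex) R) u \<partial>lborel)"
    by (simp add: nn_integral_cmult_indicator)
  also have "\<dots> \<le> (\<integral>\<^sup>+ u. \<integral>\<^sup>+ t. \<phi> (cis t * u) * indicator {0..2*pi} t \<partial>lborel \<partial>lborel)"
    by (rule nn_integral_mono) (rule mean)
  also have "\<dots> = (\<integral>\<^sup>+ t. \<integral>\<^sup>+ u. \<phi> (cis t * u) * indicator {0..2*pi} t \<partial>lborel \<partial>lborel)"
  proof (rule lborel_pair.Fubini')
    have [measurable]: "(\<lambda>t. cis t) \<in> borel \<rightarrow>\<^sub>M borel"
      by (intro borel_measurable_continuous_onI continuous_intros)
    show "(\<lambda>(t, u). \<phi> (cis t * u) * indicator {0..2*pi} t) \<in> borel_measurable (lborel \<Otimes>\<^sub>M lborel)"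
      by measurable
  qed
  also have "\<dots> = (\<integral>\<^sup>+ t. (\<integral>\<^sup>+ u. \<phi> u \<partial>lborel) * indicator {0..2*pi} t \<partial>lborel)"
  proof (intro nn_integral_cong)
    fix t :: real
    have [measurable]: "(\<lambda>u::complex. cis t * u) \<in> borel \<rightarrow>\<^sub>M borel"
      by (intro borel_measurable_continuous_onI continuous_intros)
    have "(\<integral>\<^sup>+ u. \<phi> (cis t * u) * indicator {0..2*pi} t \<partial>lborel)
        = (\<integral>\<^sup>+ u. \<phi> (cis t * u) \<partial>lborel) * indicator {0..2*pi} t"
      by (subst nn_integral_multc) auto
    then show "(\<integral>\<^sup>+ u. \<phi> (cis t * u) * indicator {0..2*pi} t \<partial>lborel) =
       (\<integral>\<^sup>+ u. \<phi> u \<partial>lborel) * indicator {0..2*pi} t" by (simp add: rot)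
  qed
  also have "\<dots> = (\<integral>\<^sup>+ u. \<phi> u \<partial>lborel) * ennreal (2 * pi)"
    by (subst nn_integral_cmult_indicator) auto
  finally have "c * ennreal (pi * R\<^sup>2) \<le> (\<integral>\<^sup>+ u. \<phi> u \<partial>lborel) * ennreal (2 * pi)"
    using R by (simp add: emeasure_ball unit_ball_vol_2)
  then have "ennreal (2 * pi) * (ennreal ((cmod (f z))\<^sup>2) * ennreal (pi * R\<^sup>2))
      \<le> ennreal (2 * pi) * (\<integral>\<^sup>+ u. \<phi> u \<partial>lborel)"
    by (simp add: c_def mult_ac)
  then have "ennreal ((cmod (f z))\<^sup>2) * ennreal (pi * R\<^sup>2) \<le> (\<integral>\<^sup>+ u. \<phi> u \<partial>lborel)"
    by (subst (asm) ennreal_mult_le_mult_iff) auto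
  then show ?thesis by (simp add: shift)
qed

section \<open>Integrals of singular kernels against measures with the growth of area\<close>

lemma le_suminf_ennreal: "f k \<le> (\<Sum>k. f k)" for f :: "nat \<Rightarrow> ennreal"
  using sum_le_suminf[of f "{k}"] by simp

text \<open>Dyadic shells about \<open>a\<close>: on the shell between \<open>r (Suc k)\<close> and
  \<open>r k\<close> the kernel is at most \<open>c k\<close>, and the ball of radius
  \<open>r k\<close> has mass at most \<open>pi * (r k)\<^sup>2\<close>. Above the scale
  \<open>s\<close> each of about \<open>log 2 (2 / s)\<close> shells contributes
  \<open>4 * pi\<close>; below it the kernel is only of order \<open>1 / (s * r k)\<close> and the
  contributions form a geometric series. Only the mass of balls is assumed, because the bound is
  meant for the image of area under a map.\<close>

lemma nn_integral_truncated_inverse_square: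
  fixes \<mu> :: "complex measure"
  assumes sets [measurable_cong, simp]: "sets \<mu> = sets borel"
    and ball: "\<And>c r. 0 < r \<Longrightarrow> emeasure \<mu> (ball c r) \<le> ennreal (pi * r\<^sup>2)"
    and a: "a \<in> ball 0 1" and s: "0 < s" "s \<le> 2"
  shows "(\<integral>\<^sup>+ \<zeta>\<in>ball 0 1. ennreal (1 / (cmod (\<zeta> - a) * max (cmod (\<zeta> - a)) s)) \<partial>\<mu>)
     \<le> ennreal (8 * pi * ln (2 / s) + 8 * pi)"
proof -
  define N where "N = nat \<lceil>log 2 (2 / s)\<rceil>"
  define r :: "nat \<Rightarrow> real" where "r k = 2 / 2 ^ k" for k
  define c where "c k = (if k < N then 4 / (r k)\<^sup>2 else 2 / (s * r k))" for k
  have r0: "0 < r k" for k by (simp add: r_def)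
  have rS: "r (Suc k) = r k / 2" for k by (simp add: r_def)
  have c0: "0 \<le> c k" for k using s r0[of k] by (simp add: c_def)
  have log0: "0 \<le> log 2 (2 / s)" using s by simp
  have N1: "log 2 (2 / s) \<le> real N" unfolding N_def by linarith
  have N2: "real N \<le> log 2 (2 / s) + 1" unfolding N_def using log0 by linarith
  have rN: "r N \<le> s"
  proof -
    have "2 / s \<le> 2 powr real N"
      using N1 s by (subst (asm) log_le_iff) auto
    then show ?thesis using s by (simp add: r_def powr_realpow field_simps)
  qed
  have pt: "ennreal (1 / (cmod (\<zeta> - a) * max (cmod (\<zeta> - a)) s)) * indicator (ball 0 1) \<zeta>
     \<le> (\<Sum>k. ennreal (c k) * indicator (ball a (r k)) \<zeta>)" for \<zeta>
  proof (cases "\<zeta> \<in> ball 0 1 \<and> \<zeta> \<noteq> a")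
    case True
    define \<rho> where "\<rho> = cmod (\<zeta> - a)"
    have \<rho>: "0 < \<rho>" using True by (simp add: \<rho>_def)
    have "\<rho> < 2" unfolding \<rho>_def using True a norm_triangle_ineq4[of \<zeta> a] by auto
    then have "\<rho> < r 0" by (simp add: r_def)
    have "\<exists>k. r k \<le> \<rho>"
    proof -
      obtain k where "2 / \<rho> < 2 ^ k" using real_arch_pow[of 2 "2/\<rho>"] by auto
      then show ?thesis using \<rho> by (intro exI[of _ k]) (simp add: r_def field_simps)
    qed
    then obtain k where k: "r (Suc k) \<le> \<rho>" "\<rho> < r k"
      using \<open>\<rho> < r 0\<close> ex_least_nat_less[of "\<lambda>k. r k \<le> \<rho>"] by (metis leD le_eq_less_or_eq not_le_imp_less)
    have "1 / (\<rho> * max \<rho> s) \<le> c k"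
    proof (cases "k < N")
      case True
      have "1 / (\<rho> * max \<rho> s) \<le> 1 / (\<rho> * \<rho>)"
        using \<rho> by (intro divide_left_mono mult_left_mono) auto
      also have "\<dots> \<le> 1 / ((r k / 2) * (r k / 2))"
        using k r0[of k] \<rho> unfolding rS by (intro divide_left_mono mult_mono) auto
      also have "\<dots> = c k" using True by (simp add: c_def power2_eq_square)
      finally show ?thesis .
    next
      case False
      have "1 / (\<rho> * max \<rho> s) \<le> 1 / (\<rho> * s)"
        using \<rho> s by (intro divide_left_mono mult_left_mono) auto
      also have "\<dots> \<le> 1 / ((r k / 2) * s)"
        using k r0[of k] \<rho> s unfolding rS by (intro divide_left_mono mult_right_mono) auto
      also have "\<dots> = c k" using False by (simp add: c_def)
      finally show ?thesis .
    qed
    then have "ennreal (1 / (\<rho> * max \<rho> s)) \<le> ennreal (c k) * indicator (ball a (r k)) \<zeta>"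
      using k by (simp add: \<rho>_def dist_norm norm_minus_commute ennreal_leI)
    also have "\<dots> \<le> (\<Sum>k. ennreal (c k) * indicator (ball a (r k)) \<zeta>)"
      by (rule le_suminf_ennreal)
    finally show ?thesis using True by (simp add: \<rho>_def)
  qed auto
  have "(\<integral>\<^sup>+ \<zeta>\<in>ball 0 1. ennreal (1 / (cmod (\<zeta> - a) * max (cmod (\<zeta> - a)) s)) \<partial>\<mu>)
     \<le> (\<integral>\<^sup>+ \<zeta>. (\<Sum>k. ennreal (c k) * indicator (ball a (r k)) \<zeta>) \<partial>\<mu>)"
    by (rule nn_integral_mono) (rule pt)
  also have "\<dots> = (\<Sum>k. ennreal (c k) * emeasure \<mu> (ball a (r k)))"
    by (subst nn_integral_suminf)
      (auto simp: nn_integral_cmult_indicator intro!: borel_measurable_times_ennreal borel_measurable_indicator)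
  also have "\<dots> \<le> (\<Sum>k. ennreal (if k < N then 4 * pi else 2 * pi * r k / s))"
  proof (rule suminf_le)
    fix k
    have "ennreal (c k) * emeasure \<mu> (ball a (r k)) \<le> ennreal (c k) * ennreal (pi * (r k)\<^sup>2)"
      using ball[OF r0[of k], of a] by (rule mult_left_mono) simp
    also have "\<dots> = ennreal (c k * (pi * (r k)\<^sup>2))" using c0 by (simp add: ennreal_mult')
    also have "c k * (pi * (r k)\<^sup>2) = (if k < N then 4 * pi else 2 * pi * r k / s)"
      using r0[of k] s by (auto simp: c_def field_simps power2_eq_square)
    finally show "ennreal (c k) * emeasure \<mu> (ball a (r k)) \<le> ennreal (if k < N then 4 * pi else 2 * pi * r k / s)" .
  qed auto
  also have "\<dots> = ennreal (4 * pi * N + 4 * pi * r N / s)"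
  proof -
    have "(\<lambda>k. r (k + N)) sums (2 * r N)"
      using sums_mult[OF geometric_sums[of "1/2::real"], of "r N"] by (simp add: r_def power_add field_simps)
    then have "(\<lambda>k. 2 * pi / s * r (k + N)) sums (2 * pi / s * (2 * r N))"
      by (rule sums_mult)
    then have "(\<lambda>k. if k + N < N then 4 * pi else 2 * pi * r (k + N) / s) sums (4 * pi * r N / s)"
      by (simp add: field_simps)
    then have "(\<lambda>k. if k < N then 4 * pi else 2 * pi * r k / s) sums
       (4 * pi * r N / s + (\<Sum>k<N. if k < N then 4 * pi else 2 * pi * r k / s))"
      by (subst (asm) sums_iff_shift)
    then have "(\<lambda>k. if k < N then 4 * pi else 2 * pi * r k / s) sums (4 * pi * N + 4 * pi * r N / s)"
      by (simp add: algebra_simps)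
    then show ?thesis using r0 s by (intro suminf_ennreal_eq) (auto intro: less_imp_le)
  qed
  also have "\<dots> \<le> ennreal (8 * pi * ln (2 / s) + 8 * pi)"
  proof (rule ennreal_leI)
    have "r N / s \<le> 1" using rN s by simp
    then have "4 * pi * (r N / s) \<le> 4 * pi * 1" by (rule mult_left_mono) simp
    moreover have "real N \<le> 2 * ln (2 / s) + 1"
    proof -
      have l: "0 \<le> ln (2 / s)" using s by simp
      have "1 / ln 2 \<le> (2::real)" using ln2_ge_two_thirds by (simp add: field_simps)
      then have "ln (2 / s) * (1 / ln 2) \<le> ln (2 / s) * 2" using l by (rule mult_left_mono)
      then have "log 2 (2 / s) \<le> 2 * ln (2 / s)"  by (simp add: log_def)
      then show ?thesis using N2 by linarith
    qed
    then have "4 * pi * real N \<le> 4 * pi * (2 * ln (2 / s) + 1)" by (intro mult_left_mono) auto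
    ultimately show "4 * pi * real N + 4 * pi * r N / s \<le> 8 * pi * ln (2 / s) + 8 * pi"
      by (simp add: algebra_simps)
  qed
  finally show ?thesis .
qed

text \<open>With \<open>s\<close> half the distance of \<open>a\<close> and \<open>b\<close>, the
  farther of the two points is at distance at least \<open>s\<close> from \<open>\<zeta>\<close>,
  and at least as far as the nearer one. The product kernel is thus dominated by the truncated
  kernel at the nearer point.\<close>

lemma nn_integral_inverse_product:
  fixes \<mu> :: "complex measure"
  assumes sets [measurable_cong, simp]: "sets \<mu> = sets borel"
    and ball: "\<And>c r. 0 < r \<Longrightarrow> emeasure \<mu> (ball c r) \<le> ennreal (pi * r\<^sup>2)"
    and a: "a \<in> ball 0 1" and b: "b \<in> ball 0 1" and "a \<noteq> b"
  shows "(\<integral>\<^sup>+ \<zeta>\<in>ball 0 1. ennreal (1 / (cmod (\<zeta> - a) * cmod (\<zeta> - b))) \<partial>\<mu>)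
     \<le> ennreal (16 * pi * ln (4 / cmod (a - b)) + 16 * pi)"
proof -
  define s where "s = cmod (a - b) / 2"
  have s: "0 < s" "s \<le> 2" using assms norm_triangle_ineq4[of a b] by (auto simp: s_def)
  have tri: "2 * s \<le> cmod (\<zeta> - a) + cmod (\<zeta> - b)" for \<zeta>
    using norm_triangle_ineq4[of "\<zeta> - b" "\<zeta> - a"] by (simp add: s_def)
  let ?\<psi> = "\<lambda>c \<zeta>. ennreal (1 / (cmod (\<zeta> - c) * max (cmod (\<zeta> - c)) s))"
  have half: "1 / (x * y) \<le> 1 / (x * max x s)" if "0 \<le> x" "x \<le> y" "2 * s \<le> x + y" for x y :: real
  proof (cases "x = 0")
    case False
    then show ?thesis using that s by (intro divide_left_mono mult_left_mono mult_pos_pos) auto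
  qed simp
  have "ennreal (1 / (cmod (\<zeta> - a) * cmod (\<zeta> - b))) \<le> ?\<psi> a \<zeta> + ?\<psi> b \<zeta>" for \<zeta>
  proof (cases "cmod (\<zeta> - a) \<le> cmod (\<zeta> - b)")
    case True
    then have "ennreal (1 / (cmod (\<zeta> - a) * cmod (\<zeta> - b))) \<le> ?\<psi> a \<zeta>"
      using half tri[of \<zeta>] by (intro ennreal_leI) auto
    also have "\<dots> \<le> ?\<psi> a \<zeta> + ?\<psi> b \<zeta>" by simp
    finally show ?thesis .
  next
    case False
    then have "ennreal (1 / (cmod (\<zeta> - b) * cmod (\<zeta> - a))) \<le> ?\<psi> b \<zeta>"
      using half tri[of \<zeta>] by (intro ennreal_leI) auto
    also have "\<dots> \<le> ?\<psi> a \<zeta> + ?\<psi> b \<zeta>" by simp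
    finally show ?thesis by (simp add: mult.commute)
  qed
  then have "(\<integral>\<^sup>+ \<zeta>\<in>ball 0 1. ennreal (1 / (cmod (\<zeta> - a) * cmod (\<zeta> - b))) \<partial>\<mu>)
     \<le> (\<integral>\<^sup>+ \<zeta>. ?\<psi> a \<zeta> * indicator (ball 0 1) \<zeta> + ?\<psi> b \<zeta> * indicator (ball 0 1) \<zeta> \<partial>\<mu>)"
    by (intro nn_integral_mono) (simp add: indicator_def)
  also have "\<dots> = (\<integral>\<^sup>+ \<zeta>\<in>ball 0 1. ?\<psi> a \<zeta> \<partial>\<mu>) + (\<integral>\<^sup>+ \<zeta>\<in>ball 0 1. ?\<psi> b \<zeta> \<partial>\<mu>)"
  proof (rule nn_integral_add)
    have "(\<lambda>\<zeta>. ?\<psi> c \<zeta> * indicator (ball 0 1) \<zeta>) \<in> borel_measurable borel" for c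
      by (intro borel_measurable_times_ennreal borel_measurable_indicator borel_open open_ball) measurable
    then show "(\<lambda>\<zeta>. ?\<psi> a \<zeta> * indicator (ball 0 1) \<zeta>) \<in> borel_measurable \<mu>"
      "(\<lambda>\<zeta>. ?\<psi> b \<zeta> * indicator (ball 0 1) \<zeta>) \<in> borel_measurable \<mu>"
      by (simp_all add: measurable_cong_sets[OF sets refl])
  qed
  also have "\<dots> \<le> ennreal (8 * pi * ln (2 / s) + 8 * pi) + ennreal (8 * pi * ln (2 / s) + 8 * pi)"
    using nn_integral_truncated_inverse_square[OF sets ball a s]
      nn_integral_truncated_inverse_square[OF sets ball b s] by (intro add_mono) auto
  also have "\<dots> = ennreal (16 * pi * ln (2 / s) + 16 * pi)"
    using s by (subst ennreal_plus[symmetric]) auto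
  finally show ?thesis by (simp add: s_def)
qed

subsection \<open>Sesquiholomorphic functions\<close>

text \<open>\<open>dz\<close> is the derivative in the first variable and \<open>dwb\<close> the one in the conjugate of the second.\<close>

definition adj :: "(complex \<Rightarrow> complex \<Rightarrow> complex) \<Rightarrow> complex \<Rightarrow> complex \<Rightarrow> complex" where
  "adj \<Phi> z w = cnj (\<Phi> w z)"

definition dz :: "(complex \<Rightarrow> complex \<Rightarrow> complex) \<Rightarrow> complex \<Rightarrow> complex \<Rightarrow> complex" where
  "dz \<Phi> z w = deriv (\<lambda>x. \<Phi> x w) z"

definition dwb :: "(complex \<Rightarrow> complex \<Rightarrow> complex) \<Rightarrow> complex \<Rightarrow> complex \<Rightarrow> complex" where
  "dwb \<Phi> = adj (dz (adj \<Phi>))"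

text \<open>Joint continuity is part of the definition: it supplies the bounds on compact products
  that make difference quotients converge uniformly in both variables. Antiholomorphy in the second
  variable is expressed through \<open>adj\<close>, so facts about one variable carry over to the
  other.\<close>

definition sesquiholomorphic_on :: "(complex \<Rightarrow> complex \<Rightarrow> complex) \<Rightarrow> complex set \<Rightarrow> bool" where
  "sesquiholomorphic_on \<Phi> U \<longleftrightarrow>
     (\<forall>w\<in>U. (\<lambda>z. \<Phi> z w) holomorphic_on U) \<and> (\<forall>w\<in>U. (\<lambda>z. adj \<Phi> z w) holomorphic_on U) \<and>
     continuous_on (U \<times> U) (\<lambda>(z, w). \<Phi> z w)"

lemma adj_adj [simp]: "adj (adj \<Phi>) = \<Phi>"
  by (intro ext) (simp add: adj_def)

lemma adj_dwb: "adj (dwb \<Phi>) = dz (adj \<Phi>)"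
  by (simp add: dwb_def)

lemma adj_dz: "adj (dz \<Phi>) = dwb (adj \<Phi>)"
  by (simp add: dwb_def)

lemma dwb_eq: "dwb \<Phi> z w = cnj (deriv (\<lambda>x. cnj (\<Phi> z x)) w)"
  by (simp add: dwb_def dz_def adj_def)

lemma continuous_on_pair_swap:
  assumes "continuous_on (U \<times> U) (\<lambda>(z, w). \<Phi> z w)"
  shows "continuous_on (U \<times> U) (\<lambda>(z, w). \<Phi> w z)"
proof -
  have "continuous_on (U \<times> U) (\<lambda>x. (\<lambda>(z, w). \<Phi> z w) (prod.swap x))"
    by (rule continuous_on_compose2[OF assms]) (auto intro!: continuous_intros simp: prod.swap_def)
  then show ?thesis by (simp add: case_prod_unfold prod.swap_def)
qed

lemma sesqui_adj: "sesquiholomorphic_on \<Phi> U \<Longrightarrow> sesquiholomorphic_on (adj \<Phi>) U"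
  unfolding sesquiholomorphic_on_def adj_adj
  using continuous_on_pair_swap[of U \<Phi>]
  by (auto simp: adj_def case_prod_unfold intro!: continuous_intros)

lemma sesqui_subset: "sesquiholomorphic_on \<Phi> U \<Longrightarrow> V \<subseteq> U \<Longrightarrow> sesquiholomorphic_on \<Phi> V"
  unfolding sesquiholomorphic_on_def
  by (meson holomorphic_on_subset continuous_on_subset Sigma_mono subsetD)

lemma sesqui_left: "f holomorphic_on U \<Longrightarrow> sesquiholomorphic_on (\<lambda>z w. f z) U"
proof -
  assume f: "f holomorphic_on U"
  have "continuous_on (U \<times> U) (\<lambda>x. f (fst x))"
    by (rule continuous_on_compose2[OF holomorphic_on_imp_continuous_on[OF f]]) (auto intro: continuous_intros)
  then show ?thesis
    using f unfolding sesquiholomorphic_on_def adj_def case_prod_unfold by (simp add: holomorphic_on_const)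
qed

lemma sesqui_right: "f holomorphic_on U \<Longrightarrow> sesquiholomorphic_on (\<lambda>z w. cnj (f w)) U"
  using sesqui_adj[OF sesqui_left[of f U]] by (simp add: adj_def[abs_def])

lemma sesqui_const: "sesquiholomorphic_on (\<lambda>z w. c) U"
  by (rule sesqui_left) (rule holomorphic_on_const)

lemma sesqui_add:
  "sesquiholomorphic_on \<Phi> U \<Longrightarrow> sesquiholomorphic_on \<Psi> U \<Longrightarrow> sesquiholomorphic_on (\<lambda>z w. \<Phi> z w + \<Psi> z w) U"
  unfolding sesquiholomorphic_on_def adj_def case_prod_unfold
  by (auto intro!: continuous_intros holomorphic_intros)

lemma sesqui_diff:
  "sesquiholomorphic_on \<Phi> U \<Longrightarrow> sesquiholomorphic_on \<Psi> U \<Longrightarrow> sesquiholomorphic_on (\<lambda>z w. \<Phi> z w - \<Psi> z w) U"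
  unfolding sesquiholomorphic_on_def adj_def case_prod_unfold
  by (auto intro!: continuous_intros holomorphic_intros)

lemma sesqui_mult:
  "sesquiholomorphic_on \<Phi> U \<Longrightarrow> sesquiholomorphic_on \<Psi> U \<Longrightarrow> sesquiholomorphic_on (\<lambda>z w. \<Phi> z w * \<Psi> z w) U"
  unfolding sesquiholomorphic_on_def adj_def case_prod_unfold
  by (auto intro!: continuous_intros holomorphic_intros)

lemma sesqui_compose:
  assumes g: "g holomorphic_on V" "open V" and \<Phi>: "sesquiholomorphic_on \<Phi> U"
    and im: "\<And>z w. z \<in> U \<Longrightarrow> w \<in> U \<Longrightarrow> \<Phi> z w \<in> V"
  shows "sesquiholomorphic_on (\<lambda>z w. g (\<Phi> z w)) U"
  unfolding sesquiholomorphic_on_def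
proof (intro conjI ballI)
  fix w assume w: "w \<in> U"
  show "(\<lambda>z. g (\<Phi> z w)) holomorphic_on U"
    using \<Phi> w im unfolding sesquiholomorphic_on_def
    by (intro holomorphic_on_compose_gen[OF _ g(1), unfolded o_def]) auto
  \<comment> \<open>For the second variable, composing with \<open>g\<close> amounts to composing
    the adjoint with \<open>cnj \<circ> g \<circ> cnj\<close>, which is holomorphic on the mirror
    image of \<open>V\<close>.\<close>
  have "cnj ` V = cnj -` V" by (force simp: image_iff)
  then have ocV: "open (cnj ` V)" using g(2) by (simp add: open_vimage continuous_on_cnj)
  have "(cnj \<circ> g \<circ> cnj) holomorphic_on (cnj ` V)"
    using g by (intro holomorphic_on_compose_cnj_cnj) (auto simp: image_image ocV)
  then have "((cnj \<circ> g \<circ> cnj) \<circ> (\<lambda>z. adj \<Phi> z w)) holomorphic_on U"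
    by (rule holomorphic_on_compose_gen[rotated])
      (use \<Phi> w im in \<open>auto simp: sesquiholomorphic_on_def adj_def\<close>)
  then show "(\<lambda>z. adj (\<lambda>z w. g (\<Phi> z w)) z w) holomorphic_on U"
    by (simp add: adj_def o_def)
next
  show "continuous_on (U \<times> U) (\<lambda>(z, w). g (\<Phi> z w))"
    using \<Phi> im unfolding sesquiholomorphic_on_def case_prod_unfold
    by (auto intro!: continuous_on_compose2[OF holomorphic_on_imp_continuous_on[OF g(1)]])
qed

lemma sesqui_inverse:
  assumes "sesquiholomorphic_on \<Phi> U" "\<And>z w. z \<in> U \<Longrightarrow> w \<in> U \<Longrightarrow> \<Phi> z w \<noteq> 0"
  shows "sesquiholomorphic_on (\<lambda>z w. inverse (\<Phi> z w)) U"
  by (rule sesqui_compose[of inverse "-{0}", OF _ _ assms(1)])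
    (auto intro!: holomorphic_intros simp: assms(2))

lemma sesqui_exp: "sesquiholomorphic_on \<Phi> U \<Longrightarrow> sesquiholomorphic_on (\<lambda>z w. exp (\<Phi> z w)) U"
  by (rule sesqui_compose[of exp UNIV]) (auto intro!: holomorphic_intros)

lemma sesqui_Ln:
  assumes "sesquiholomorphic_on \<Phi> U" "\<And>z w. z \<in> U \<Longrightarrow> w \<in> U \<Longrightarrow> 0 < Re (\<Phi> z w)"
  shows "sesquiholomorphic_on (\<lambda>z w. Ln (\<Phi> z w)) U"
  by (rule sesqui_compose[of Ln "{z. 0 < Re z}", OF _ _ assms(1)])
    (auto intro!: holomorphic_intros simp: assms(2) complex_nonpos_Reals_iff open_halfspace_Re_gt)

section \<open>Derivatives of sesquiholomorphic functions\<close>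

lemma sesqui_has_dz:
  assumes "sesquiholomorphic_on \<Phi> U" "open U" "z \<in> U" "w \<in> U"
  shows "((\<lambda>x. \<Phi> x w) has_field_derivative dz \<Phi> z w) (at z)"
  unfolding dz_def using assms unfolding sesquiholomorphic_on_def
  by (intro holomorphic_derivI) auto

lemma sesqui_has_dwb:
  assumes "sesquiholomorphic_on \<Phi> U" "open U" "z \<in> U" "w \<in> U"
  shows "((\<lambda>x. cnj (\<Phi> z x)) has_field_derivative cnj (dwb \<Phi> z w)) (at w)"
  using sesqui_has_dz[OF sesqui_adj[OF assms(1)] assms(2,4,3)]
  by (simp add: adj_def[of \<Phi>] adj_def dwb_def)

text \<open>Taylor's remainder with Cauchy's estimate for the second derivative. The radius
  \<open>3 * r\<close> leaves room for a disc of radius \<open>r\<close> about every point of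
  \<open>cball z r\<close>. The bound depends on \<open>M\<close>, \<open>r\<close> and
  \<open>h\<close> alone, hence is uniform in any parameters.\<close>

lemma diff_quotient_bound:
  assumes hol: "f holomorphic_on ball z (3 * r)" and r: "0 < r"
    and M: "\<And>x. x \<in> ball z (3 * r) \<Longrightarrow> cmod (f x) < M" and h: "h \<noteq> 0" "cmod h \<le> r"
  shows "cmod ((f (z + h) - f z) / h - deriv f z) \<le> 2 * M / r\<^sup>2 * cmod h"
proof -
  have d: "cmod ((deriv ^^ 2) f x) \<le> 2 * M / r\<^sup>2" if x: "x \<in> cball z r" for x
  proof -
    have sub: "cball x r \<subseteq> ball z (3 * r)"
    proof
      fix y assume "y \<in> cball x r"
      then show "y \<in> ball z (3 * r)"
        using x r dist_triangle[of z y x] by auto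
    qed
    have "cmod ((deriv ^^ 2) f x) \<le> fact 2 * M / r ^ 2"
      using sub r ball_subset_cball[of x r]
      by (intro Cauchy_higher_deriv_bound[where y = 0])
        (auto intro!: holomorphic_on_subset[OF hol] holomorphic_on_imp_continuous_on[OF holomorphic_on_subset[OF hol]] M)
    then show ?thesis by (simp add: fact_2)
  qed
  have "cmod ((deriv ^^ 0) f (z + h) - (\<Sum>i\<le>1. (deriv ^^ i) f z * (z + h - z) ^ i / fact i))
      \<le> 2 * M / r\<^sup>2 * cmod (z + h - z) ^ Suc 1 / fact 1"
  proof (rule complex_Taylor[of "cball z r" 1 "\<lambda>i. (deriv ^^ i) f"])
    fix i x assume "x \<in> cball z r" "i \<le> (1::nat)"
    then have x: "x \<in> ball z (3 * r)" using r by auto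
    have "(deriv ^^ i) f holomorphic_on ball z (3 * r)"
      using hol by (intro holomorphic_higher_deriv) auto
    then have "((deriv ^^ i) f has_field_derivative deriv ((deriv ^^ i) f) x) (at x)"
      using x by (intro holomorphic_derivI) auto
    then show "((deriv ^^ i) f has_field_derivative (deriv ^^ Suc i) f x) (at x within cball z r)"
      by (simp add: has_field_derivative_at_within)
  qed (use d h r in \<open>auto simp: numeral_2_eq_2 dist_norm\<close>)
  then have "cmod (f (z + h) - f z - deriv f z * h) \<le> 2 * M / r\<^sup>2 * (cmod h)\<^sup>2"
    by (simp add: power2_eq_square algebra_simps)
  then have "cmod (f (z + h) - f z - deriv f z * h) / cmod h \<le> 2 * M / r\<^sup>2 * (cmod h)\<^sup>2 / cmod h"
    by (rule divide_right_mono) simp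
  moreover have "(f (z + h) - f z) / h - deriv f z = (f (z + h) - f z - deriv f z * h) / h"
    using h by (simp add: field_simps)
  ultimately show ?thesis using h by (simp add: norm_divide power2_eq_square)
qed

text \<open>Positive real increments suffice, since the derivative is known to exist. Joint
  continuity bounds \<open>\<Phi>\<close> on a compact product, so the Taylor estimate is uniform in
  both variables; through this limit \<open>dz \<Phi>\<close> inherits regularity in
  \<open>w\<close>.\<close>

lemma sesqui_diff_quotient:
  assumes \<Phi>: "sesquiholomorphic_on \<Phi> U" and U: "open U" and "z0 \<in> U" "w0 \<in> U"
  obtains r h where "0 < r" "cball z0 r \<subseteq> U" "cball w0 r \<subseteq> U" "h \<longlonglongrightarrow> 0" "\<And>n. (0::real) < h n"
    "\<And>z n. z \<in> cball z0 r \<Longrightarrow> z + of_real (h n) \<in> U"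
    "uniform_limit (cball z0 r \<times> cball w0 r)
       (\<lambda>n (z, w). (\<Phi> (z + of_real (h n)) w - \<Phi> z w) / of_real (h n)) (\<lambda>(z, w). dz \<Phi> z w) sequentially"
proof -
  obtain e1 where e1: "0 < e1" "cball z0 e1 \<subseteq> U" using U assms open_contains_cball by blast
  obtain e2 where e2: "0 < e2" "cball w0 e2 \<subseteq> U" using U assms open_contains_cball by blast
  define r where "r = min e1 e2 / 4"
  define h where "h n = r / real (Suc n)" for n
  have r: "0 < r" using e1 e2 by (simp add: r_def)
  have z4: "cball z0 (4 * r) \<subseteq> U" using e1 unfolding r_def by auto
  have w4: "cball w0 (4 * r) \<subseteq> U" using e2 unfolding r_def by auto
  have w1: "cball w0 r \<subseteq> U" using w4 r by auto
  have z1: "cball z0 r \<subseteq> U" using z4 r by auto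
  have h0: "h \<longlonglongrightarrow> 0"
    unfolding h_def using tendsto_mult_right_zero[OF LIMSEQ_inverse_real_of_nat, of r] by (simp add: field_simps)
  have hpos: "0 < h n" and hr: "h n \<le> r" for n using r by (auto simp: h_def field_simps)
  have "bounded ((\<lambda>(z, w). \<Phi> z w) ` (cball z0 (4 * r) \<times> cball w0 r))"
    using \<Phi> z4 w1 unfolding sesquiholomorphic_on_def
    by (intro compact_imp_bounded compact_continuous_image compact_Times) (auto elim: continuous_on_subset)
  then obtain M where "0 < M"
    and M': "\<forall>x\<in>(\<lambda>(z, w). \<Phi> z w) ` (cball z0 (4 * r) \<times> cball w0 r). cmod x < M"
    unfolding bounded_pos_less by blast
  then have M: "0 < M" "\<And>z w. z \<in> cball z0 (4 * r) \<Longrightarrow> w \<in> cball w0 r \<Longrightarrow> cmod (\<Phi> z w) < M"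
    by - (assumption, rule bspec[OF M'], rule image_eqI[where f="\<lambda>(z, w). \<Phi> z w" and x="(_, _)"], auto)
  have ball3: "ball z (3 * r) \<subseteq> cball z0 (4 * r)" if "z \<in> cball z0 r" for z
  proof
    fix x assume "x \<in> ball z (3 * r)"
    then show "x \<in> cball z0 (4 * r)" using that dist_triangle[of z0 x z] by auto
  qed
  have zh: "z + of_real (h n) \<in> U" if "z \<in> cball z0 r" for z n
    using ball3[OF that] z4 hr[of n] hpos[of n] r by (auto simp: subset_iff dist_norm)
  have bd: "cmod ((\<Phi> (z + of_real (h n)) w - \<Phi> z w) / of_real (h n) - dz \<Phi> z w) \<le> 2 * M / r\<^sup>2 * h n"
    if "z \<in> cball z0 r" "w \<in> cball w0 r" for z w n
  proof -
    have "(\<lambda>x. \<Phi> x w) holomorphic_on ball z (3 * r)"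
      using \<Phi> that(2) w1 ball3[OF that(1)] z4 unfolding sesquiholomorphic_on_def
      by (meson holomorphic_on_subset subsetD subset_trans)
    then show ?thesis
      using diff_quotient_bound[of "\<lambda>x. \<Phi> x w" z r M "of_real (h n)"] r M(2) ball3[OF that(1)] that(2) hpos[of n] hr[of n]
      by (auto simp: dz_def subset_iff)
  qed
  have "uniform_limit (cball z0 r \<times> cball w0 r)
       (\<lambda>n (z, w). (\<Phi> (z + of_real (h n)) w - \<Phi> z w) / of_real (h n)) (\<lambda>(z, w). dz \<Phi> z w) sequentially"
  proof (rule uniform_limitI)
    fix e :: real assume e: "0 < e"
    have "(\<lambda>n. 2 * M / r\<^sup>2 * h n) \<longlonglongrightarrow> 0" using h0 by (rule tendsto_mult_right_zero)
    then have "\<forall>\<^sub>F n in sequentially. 2 * M / r\<^sup>2 * h n < e"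
      using e by (auto dest: order_tendstoD(2))
    then show "\<forall>\<^sub>F n in sequentially. \<forall>x\<in>cball z0 r \<times> cball w0 r.
        dist (case x of (z, w) \<Rightarrow> (\<Phi> (z + of_real (h n)) w - \<Phi> z w) / of_real (h n)) (case x of (z, w) \<Rightarrow> dz \<Phi> z w) < e"
    proof eventually_elim
      case (elim n)
      show ?case
      proof clarify
        fix z w assume "z \<in> cball z0 r" "w \<in> cball w0 r"
        from bd[OF this, of n] elim
        show "dist ((\<Phi> (z + of_real (h n)) w - \<Phi> z w) / of_real (h n)) (dz \<Phi> z w) < e"
          unfolding dist_norm by linarith
      qed
    qed
  qed
  with r z1 w1 h0 hpos zh show thesis by (intro that) auto
qed

text \<open>In the second variable \<open>dz \<Phi>\<close> is a locally uniform limit of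
  antiholomorphic difference quotients, so Weierstrass' theorem applies; the same limit is uniform
  on products and gives joint continuity.\<close>

lemma sesqui_dz:
  assumes \<Phi>: "sesquiholomorphic_on \<Phi> U" and U: "open U"
  shows "sesquiholomorphic_on (dz \<Phi>) U"
  unfolding sesquiholomorphic_on_def
proof (intro conjI ballI)
  fix w assume w: "w \<in> U"
  show "(\<lambda>z. dz \<Phi> z w) holomorphic_on U"
    unfolding dz_def using \<Phi> U w unfolding sesquiholomorphic_on_def by (auto intro!: holomorphic_deriv)
next
  fix z0 assume z0: "z0 \<in> U"
  show "(\<lambda>z. adj (dz \<Phi>) z z0) holomorphic_on U"
    unfolding holomorphic_on_open[OF U]
  proof
    fix w0 assume w0: "w0 \<in> U"
    obtain r h where r: "0 < r" "cball z0 r \<subseteq> U" "cball w0 r \<subseteq> U" and h0: "h \<longlonglongrightarrow> 0"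
      and h: "\<And>n. (0::real) < h n"
      and zh: "\<And>z n. z \<in> cball z0 r \<Longrightarrow> z + of_real (h n) \<in> U"
      and lim: "uniform_limit (cball z0 r \<times> cball w0 r)
       (\<lambda>n (z, w). (\<Phi> (z + of_real (h n)) w - \<Phi> z w) / of_real (h n)) (\<lambda>(z, w). dz \<Phi> z w) sequentially"
      by (rule sesqui_diff_quotient[OF \<Phi> U z0 w0], rule that)
    have "(\<lambda>w. adj (dz \<Phi>) w z0) holomorphic_on ball w0 r"
    proof (rule holomorphic_uniform_sequence[of _ "\<lambda>n w. (adj \<Phi> w (z0 + of_real (h n)) - adj \<Phi> w z0) / of_real (h n)"])
      show "(\<lambda>w. (adj \<Phi> w (z0 + of_real (h n)) - adj \<Phi> w z0) / of_real (h n)) holomorphic_on ball w0 r" for n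
      proof -
        have "ball w0 r \<subseteq> U" using r(3) ball_subset_cball by blast
        then have "(\<lambda>w. adj \<Phi> w x) holomorphic_on ball w0 r" if "x \<in> U" for x
          using \<Phi> that unfolding sesquiholomorphic_on_def by (meson holomorphic_on_subset)
        then show ?thesis
          using zh[of z0 n] z0 r(1) h[of n] by (auto intro!: holomorphic_intros)
      qed
      fix x assume "x \<in> ball w0 r"
      then obtain d where d: "0 < d" "cball x d \<subseteq> ball w0 r"
        by (meson open_ball open_contains_cball)
      have "uniform_limit (cball x d)
         (\<lambda>n w. (adj \<Phi> w (z0 + of_real (h n)) - adj \<Phi> w z0) / of_real (h n)) (\<lambda>w. adj (dz \<Phi>) w z0) sequentially"
      proof (rule uniform_limitI)
        fix e :: real assume e: "0 < e"
        show "\<forall>\<^sub>F n in sequentially. \<forall>w\<in>cball x d.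
          dist ((adj \<Phi> w (z0 + of_real (h n)) - adj \<Phi> w z0) / of_real (h n)) (adj (dz \<Phi>) w z0) < e"
          using uniform_limitD[OF lim e]
        proof eventually_elim
          case (elim n)
          show ?case
          proof
            fix w assume "w \<in> cball x d"
            then have "w \<in> cball w0 r" using d by auto
            then have "dist ((\<Phi> (z0 + of_real (h n)) w - \<Phi> z0 w) / of_real (h n)) (dz \<Phi> z0 w) < e"
              using elim r by force
            moreover have "(adj \<Phi> w (z0 + of_real (h n)) - adj \<Phi> w z0) / of_real (h n) - adj (dz \<Phi>) w z0
                = cnj ((\<Phi> (z0 + of_real (h n)) w - \<Phi> z0 w) / of_real (h n) - dz \<Phi> z0 w)"
              by (simp add: adj_def)
            ultimately show "dist ((adj \<Phi> w (z0 + of_real (h n)) - adj \<Phi> w z0) / of_real (h n)) (adj (dz \<Phi>) w z0) < e"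
              by (metis complex_mod_cnj dist_norm)
          qed
        qed
      qed
      then show "\<exists>d>0. cball x d \<subseteq> ball w0 r \<and> uniform_limit (cball x d)
         (\<lambda>n w. (adj \<Phi> w (z0 + of_real (h n)) - adj \<Phi> w z0) / of_real (h n)) (\<lambda>w. adj (dz \<Phi>) w z0) sequentially"
        using d by blast
    qed auto
    then show "\<exists>f'. ((\<lambda>z. adj (dz \<Phi>) z z0) has_field_derivative f') (at w0)"
      using r by (simp add: holomorphic_on_open)
  qed
next
  show "continuous_on (U \<times> U) (\<lambda>(z, w). dz \<Phi> z w)"
  proof (rule continuous_at_imp_continuous_on, clarify)
    fix z0 w0 assume z0: "z0 \<in> U" and w0: "w0 \<in> U"
    obtain r h where r: "0 < r" "cball z0 r \<subseteq> U" "cball w0 r \<subseteq> U" and h0: "h \<longlonglongrightarrow> 0"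
      and h: "\<And>n. (0::real) < h n"
      and zh: "\<And>z n. z \<in> cball z0 r \<Longrightarrow> z + of_real (h n) \<in> U"
      and lim: "uniform_limit (cball z0 r \<times> cball w0 r)
       (\<lambda>n (z, w). (\<Phi> (z + of_real (h n)) w - \<Phi> z w) / of_real (h n)) (\<lambda>(z, w). dz \<Phi> z w) sequentially"
      by (rule sesqui_diff_quotient[OF \<Phi> U z0 w0], rule that)
    have c: "continuous_on (cball z0 r \<times> cball w0 r) (\<lambda>x. \<Phi> (fst x + of_real (h n)) (snd x))" for n
    proof -
      have "continuous_on (cball z0 r \<times> cball w0 r) (\<lambda>x. (\<lambda>(z, w). \<Phi> z w) (fst x + of_real (h n), snd x))"
      proof (rule continuous_on_compose2[of "U \<times> U" "\<lambda>(z, w). \<Phi> z w"])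
        show "continuous_on (U \<times> U) (\<lambda>(z, w). \<Phi> z w)"
          using \<Phi> by (simp add: sesquiholomorphic_on_def)
        show "continuous_on (cball z0 r \<times> cball w0 r) (\<lambda>x. (fst x + complex_of_real (h n), snd x))"
          by (intro continuous_intros)
        show "(\<lambda>x. (fst x + complex_of_real (h n), snd x)) ` (cball z0 r \<times> cball w0 r) \<subseteq> U \<times> U"
          using zh r(3) by (auto simp del: mem_cball)
      qed
      then show ?thesis by simp
    qed
    have c0: "continuous_on (cball z0 r \<times> cball w0 r) (\<lambda>x. \<Phi> (fst x) (snd x))"
      using \<Phi> r unfolding sesquiholomorphic_on_def case_prod_unfold
      by (elim conjE continuous_on_subset) auto
    have "continuous_on (cball z0 r \<times> cball w0 r) (\<lambda>(z, w). dz \<Phi> z w)"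
      by (rule uniform_limit_theorem[OF _ lim])
        (auto simp: case_prod_unfold intro!: continuous_intros c c0 always_eventually simp: h less_imp_neq[OF h, symmetric])
    then have "continuous_on (ball z0 r \<times> ball w0 r) (\<lambda>(z, w). dz \<Phi> z w)"
      by (rule continuous_on_subset) (auto simp: less_imp_le)
    then show "isCont (\<lambda>(z, w). dz \<Phi> z w) (z0, w0)"
      using r by (simp add: continuous_on_eq_continuous_at open_Times)
  qed
qed

lemma sesqui_dwb:
  assumes "sesquiholomorphic_on \<Phi> U" "open U"
  shows "sesquiholomorphic_on (dwb \<Phi>) U"
  unfolding dwb_def using assms by (intro sesqui_adj sesqui_dz)

text \<open>The difference quotients in \<open>z\<close>, differentiated in the conjugate of
  \<open>w\<close>, have two descriptions of their limit: \<open>dwb (dz \<Phi>)\<close>, because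
  derivatives pass to locally uniform limits, and \<open>dz (dwb \<Phi>)\<close>, because they are
  difference quotients of \<open>dwb \<Phi>\<close>.\<close>

lemma dz_dwb_commute:
  assumes \<Phi>: "sesquiholomorphic_on \<Phi> U" and U: "open U" and z0: "z0 \<in> U" and w0: "w0 \<in> U"
  shows "dz (dwb \<Phi>) z0 w0 = dwb (dz \<Phi>) z0 w0"
proof -
  obtain r h where r: "0 < r" "cball z0 r \<subseteq> U" "cball w0 r \<subseteq> U" and h0: "h \<longlonglongrightarrow> 0"
      and h: "\<And>n. (0::real) < h n"
    and zh: "\<And>z n. z \<in> cball z0 r \<Longrightarrow> z + of_real (h n) \<in> U"
    and lim: "uniform_limit (cball z0 r \<times> cball w0 r)
       (\<lambda>n (z, w). (\<Phi> (z + of_real (h n)) w - \<Phi> z w) / of_real (h n)) (\<lambda>(z, w). dz \<Phi> z w) sequentially"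
    by (rule sesqui_diff_quotient[OF \<Phi> U z0 w0], rule that)
  let ?f = "\<lambda>n w. cnj ((\<Phi> (z0 + of_real (h n)) w - \<Phi> z0 w) / of_real (h n))"
  let ?f' = "\<lambda>n w. cnj ((dwb \<Phi> (z0 + of_real (h n)) w - dwb \<Phi> z0 w) / of_real (h n))"
  have "\<exists>g'. \<forall>x\<in>ball w0 r. ((\<lambda>w. cnj (dz \<Phi> z0 w)) has_field_derivative g' x) (at x) \<and>
       ((\<lambda>n. ?f' n x) \<longlongrightarrow> g' x) sequentially"
  proof (rule has_complex_derivative_uniform_sequence[of _ ?f])
    fix n x assume x: "x \<in> ball w0 r"
    then have xU: "x \<in> U" using r by auto
    have d: "((\<lambda>w. (cnj (\<Phi> (z0 + of_real (h n)) w) - cnj (\<Phi> z0 w)) / of_real (h n))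
      has_field_derivative (cnj (dwb \<Phi> (z0 + of_real (h n)) x) - cnj (dwb \<Phi> z0 x)) / of_real (h n)) (at x)"
      using zh[of z0 n] z0 r h[of n] xU
      by (intro DERIV_cdivide DERIV_diff sesqui_has_dwb[OF \<Phi> U]) auto
    then show "(?f n has_field_derivative ?f' n x) (at x)" by simp
  next
    fix x assume "x \<in> ball w0 r"
    then obtain d where d: "0 < d" "cball x d \<subseteq> ball w0 r"
      by (meson open_ball open_contains_cball)
    have "uniform_limit (cball x d) ?f (\<lambda>w. cnj (dz \<Phi> z0 w)) sequentially"
    proof (rule uniform_limitI)
      fix e :: real assume e: "0 < e"
      show "\<forall>\<^sub>F n in sequentially. \<forall>w\<in>cball x d. dist (?f n w) (cnj (dz \<Phi> z0 w)) < e"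
        using uniform_limitD[OF lim e]
      proof eventually_elim
        case (elim n)
        show ?case
        proof
          fix w assume "w \<in> cball x d"
          then have "w \<in> cball w0 r" using d by auto
          then have "dist ((\<Phi> (z0 + of_real (h n)) w - \<Phi> z0 w) / of_real (h n)) (dz \<Phi> z0 w) < e"
            using elim r by force
          then show "dist (?f n w) (cnj (dz \<Phi> z0 w)) < e"
            by (metis complex_cnj_diff complex_mod_cnj dist_norm)
        qed
      qed
    qed
    then show "\<exists>d>0. cball x d \<subseteq> ball w0 r \<and> uniform_limit (cball x d) ?f (\<lambda>w. cnj (dz \<Phi> z0 w)) sequentially"
      using d by blast
  qed auto
  then obtain g' where g': "((\<lambda>w. cnj (dz \<Phi> z0 w)) has_field_derivative g') (at w0)"
    "(\<lambda>n. ?f' n w0) \<longlonglongrightarrow> g'" using r(1) by (meson centre_in_ball)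
  have 1: "g' = cnj (dwb (dz \<Phi>) z0 w0)"
    using DERIV_unique[OF g'(1) sesqui_has_dwb[OF sesqui_dz[OF \<Phi> U] U z0 w0]] .
  have "((\<lambda>x. dwb \<Phi> x w0) has_field_derivative dz (dwb \<Phi>) z0 w0) (at z0)"
    by (rule sesqui_has_dz[OF sesqui_dwb[OF \<Phi> U] U z0 w0])
  then have "((\<lambda>x. (dwb \<Phi> (z0 + x) w0 - dwb \<Phi> z0 w0) / x) \<longlongrightarrow> dz (dwb \<Phi>) z0 w0) (at 0)"
    by (simp add: DERIV_def)
  moreover have "filterlim (\<lambda>n. complex_of_real (h n)) (at 0) sequentially"
    using h h0 by (auto simp: filterlim_at intro!: tendsto_eq_intros always_eventually simp: less_imp_neq[OF h, symmetric])
  ultimately have "(\<lambda>n. (dwb \<Phi> (z0 + of_real (h n)) w0 - dwb \<Phi> z0 w0) / of_real (h n)) \<longlonglongrightarrow> dz (dwb \<Phi>) z0 w0"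
    by (rule filterlim_compose)
  then have "(\<lambda>n. ?f' n w0) \<longlonglongrightarrow> cnj (dz (dwb \<Phi>) z0 w0)" by (rule tendsto_cnj)
  then show ?thesis using g'(2) 1 LIMSEQ_unique by fastforce
qed

text \<open>Joint real differentiability follows from one partial derivative at the point and
  continuity of the other; the chain rule is then applied along the diagonal.\<close>

lemma sesqui_diagonal_has_vector_derivative:
  assumes \<Phi>: "sesquiholomorphic_on \<Phi> U" and U: "open U" and z: "z \<in> U"
  shows "((\<lambda>t. \<Phi> (z + of_real t * e) (z + of_real t * e)) has_vector_derivative
      e * dz \<Phi> z z + cnj e * dwb \<Phi> z z) (at 0)"
proof -
  obtain r where r: "0 < r" "ball z r \<subseteq> U" using U z open_contains_ball by blast
  let ?B = "ball z r"
  \<comment> \<open>The derivative in \<open>w\<close> is antilinear, so it is encoded as the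
    real-linear operator sending \<open>h\<close> to \<open>c * cnj h\<close>; it depends linearly,
    hence continuously, on \<open>c\<close>.\<close>
  define L where "L c = blinfun_mult_right c o\<^sub>L Blinfun cnj" for c :: complex
  have bl: "bounded_linear cnj" by (rule bounded_linear_cnj)
  have L: "blinfun_apply (L c) h = c * cnj h" for c h
    by (simp add: L_def bounded_linear_Blinfun_apply[OF bl])
  have Lbl: "bounded_linear L"
    unfolding L_def
    by (intro bounded_linear_compose[OF bounded_bilinear.bounded_linear_left[OF bounded_bilinear_blinfun_compose]]
        bounded_linear_blinfun_mult_right)
  have "((\<lambda>(x, y). \<Phi> x y) has_derivative (\<lambda>(tx, ty). dz \<Phi> z z * tx + blinfun_apply (L (dwb \<Phi> z z)) ty))
     (at (z, z) within ?B \<times> ?B)"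
  proof (rule has_derivative_partialsI[where fx = "(*) (dz \<Phi> z z)" and fy = "\<lambda>x y. L (dwb \<Phi> x y)"])
    show "((\<lambda>x. \<Phi> x z) has_derivative (*) (dz \<Phi> z z)) (at z within ?B)"
      using sesqui_has_dz[OF \<Phi> U z z] has_field_derivative_def has_derivative_at_withinI by blast
    fix x y assume "x \<in> ?B" "y \<in> ?B"
    then have xy: "x \<in> U" "y \<in> U" using r by auto
    have "((\<lambda>y. cnj (\<Phi> x y)) has_derivative (*) (cnj (dwb \<Phi> x y))) (at y)"
      using sesqui_has_dwb[OF \<Phi> U xy] by (simp add: has_field_derivative_def)
    then have "((\<lambda>y. cnj (cnj (\<Phi> x y))) has_derivative (\<lambda>h. cnj (cnj (dwb \<Phi> x y) * h))) (at y)"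
      by (rule has_derivative_cnj)
    moreover have "blinfun_apply (L (dwb \<Phi> x y)) = (\<lambda>h. cnj (cnj (dwb \<Phi> x y) * h))"
      by (simp add: fun_eq_iff L)
    ultimately show "(\<Phi> x has_derivative blinfun_apply (L (dwb \<Phi> x y))) (at y within ?B)"
      by (simp add: has_derivative_at_withinI)
  next
    have "continuous_on (U \<times> U) (\<lambda>(z, w). dwb \<Phi> z w)"
      using sesqui_dwb[OF \<Phi> U] by (simp add: sesquiholomorphic_on_def)
    then have "isCont (\<lambda>(z, w). dwb \<Phi> z w) (z, z)"
      using U z by (auto simp: continuous_on_eq_continuous_at open_Times)
    then have "isCont (\<lambda>x. L ((\<lambda>(z, w). dwb \<Phi> z w) x)) (z, z)"
      by (rule bounded_linear.isCont[OF Lbl])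
    then show "continuous (at (z, z) within ?B \<times> ?B) (\<lambda>(x, y). L (dwb \<Phi> x y))"
      by (simp add: case_prod_unfold continuous_at_imp_continuous_at_within)
  qed (use r in auto)
  then have D: "((\<lambda>(x, y). \<Phi> x y) has_derivative (\<lambda>(tx, ty). dz \<Phi> z z * tx + dwb \<Phi> z z * cnj ty)) (at (z, z))"
    using r by (subst (asm) at_within_open) (auto simp: open_Times L)
  have g: "((\<lambda>t. (z + of_real t * e, z + of_real t * e)) has_derivative (\<lambda>t. (of_real t * e, of_real t * e))) (at 0)"
    by (auto intro!: derivative_eq_intros)
  have "((\<lambda>t. (\<lambda>(x, y). \<Phi> x y) (z + of_real t * e, z + of_real t * e)) has_derivative
     (\<lambda>t. (\<lambda>(tx, ty). dz \<Phi> z z * tx + dwb \<Phi> z z * cnj ty) (of_real t * e, of_real t * e))) (at 0)"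
    by (rule has_derivative_compose[OF g]) (use D in simp)
  then show ?thesis
    unfolding has_vector_derivative_def by (simp add: algebra_simps scaleR_conv_of_real)
qed

text \<open>Derivatives along the directions \<open>1\<close> and \<open>\<i>\<close> both vanish;
  they give the sum and the difference of \<open>dz \<Phi>\<close> and
  \<open>dwb \<Phi>\<close>.\<close>

lemma sesqui_diagonal_zero:
  assumes \<Phi>: "sesquiholomorphic_on \<Phi> U" and U: "open U" and z: "z \<in> U"
    and 0: "\<And>x. x \<in> U \<Longrightarrow> \<Phi> x x = 0"
  shows "dz \<Phi> z z = 0"
proof -
  have *: "e * dz \<Phi> z z + cnj e * dwb \<Phi> z z = 0" for e
  proof -
    have "((\<lambda>t::real. 0::complex) has_vector_derivative e * dz \<Phi> z z + cnj e * dwb \<Phi> z z) (at 0)"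
      by (rule has_vector_derivative_transform_within_open[OF sesqui_diagonal_has_vector_derivative[OF \<Phi> U z, of e],
         of "(\<lambda>t. z + of_real t * e) -` U"])
        (use z U 0 in \<open>auto intro!: open_vimage continuous_intros\<close>)
    then show ?thesis
      using has_vector_derivative_const vector_derivative_unique_at by blast
  qed
  have "dz \<Phi> z z + dwb \<Phi> z z = 0" "\<i> * (dz \<Phi> z z - dwb \<Phi> z z) = 0"
    using *[of 1] *[of \<i>] by (simp_all add: algebra_simps)
  then show ?thesis by simp
qed

text \<open>Polarization: differentiating the identity on the diagonal kills the whole Taylor series.\<close>

lemma sesqui_polarization:
  assumes \<Phi>: "sesquiholomorphic_on \<Phi> U" and U: "open U" "connected U"
    and 0: "\<And>x. x \<in> U \<Longrightarrow> \<Phi> x x = 0" and z: "z \<in> U" and w: "w \<in> U"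
  shows "\<Phi> z w = 0"
proof -
  have *: "sesquiholomorphic_on ((dz ^^ n) \<Phi>) U \<and> (\<forall>x\<in>U. (dz ^^ n) \<Phi> x x = 0)" for n
    by (induction n) (auto simp: \<Phi> 0 sesqui_dz[OF _ U(1)] intro: sesqui_diagonal_zero[OF _ U(1)])
  have eq: "(dz ^^ n) \<Phi> x y = (deriv ^^ n) (\<lambda>x. \<Phi> x y) x" for n x y
    by (induction n arbitrary: x) (auto simp: dz_def)
  \<comment> \<open>The Taylor series in the first variable is centred at \<open>w\<close>, where
    that variable meets the diagonal.\<close>
  have "(\<lambda>x. \<Phi> x w) z = 0"
  proof (rule holomorphic_fun_eq_0_on_connected[OF _ U _ w z])
    show "(\<lambda>x. \<Phi> x w) holomorphic_on U" using \<Phi> w by (simp add: sesquiholomorphic_on_def)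
    show "(deriv ^^ n) (\<lambda>x. \<Phi> x w) w = 0" for n using *[of n] w by (simp add: eq)
  qed
  then show ?thesis by simp
qed

text \<open>The bridge from the definitions by real partial derivatives to the calculus of two
  independent variables: the partial derivatives are the diagonal derivatives in the directions
  \<open>1\<close> and \<open>\<i>\<close>.\<close>

lemma wirtinger_diagonal:
  assumes \<Phi>: "sesquiholomorphic_on \<Phi> U" and U: "open U" and z: "z \<in> U"
    and f: "\<And>x. x \<in> U \<Longrightarrow> f x = \<Phi> x x"
  shows "wirtinger_z f z = dz \<Phi> z z" "wirtinger_zbar f z = dwb \<Phi> z z"
proof -
  have *: "vector_derivative (\<lambda>t. f (z + e * of_real t)) (at 0) = e * dz \<Phi> z z + cnj e * dwb \<Phi> z z" for e
  proof (rule vector_derivative_at, rule has_vector_derivative_transform_within_open[OF sesqui_diagonal_has_vector_derivative[OF \<Phi> U z, of e],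
         of "(\<lambda>t. z + of_real t * e) -` U"])
    show "open ((\<lambda>t. z + complex_of_real t * e) -` U)" using U by (intro open_vimage continuous_intros)
  qed (use z f in \<open>auto simp: mult.commute\<close>)
  have x: "partial_x f z = dz \<Phi> z z + dwb \<Phi> z z" and "partial_y f z = \<i> * dz \<Phi> z z + cnj \<i> * dwb \<Phi> z z"
    using *[of 1] *[of \<i>] by (simp_all add: partial_x_def partial_y_def)
  then have y: "partial_y f z = \<i> * (dz \<Phi> z z - dwb \<Phi> z z)" by (simp add: right_diff_distrib)
  have "\<i> * partial_y f z = dwb \<Phi> z z - dz \<Phi> z z"
    by (simp add: y mult.assoc[symmetric])
  with x show "wirtinger_z f z = dz \<Phi> z z" "wirtinger_zbar f z = dwb \<Phi> z z"
    by (simp_all add: wirtinger_z_def wirtinger_zbar_def)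
qed

lemma wirtinger_z_zbar_diagonal:
  assumes \<Phi>: "sesquiholomorphic_on \<Phi> U" and U: "open U" and z: "z \<in> U"
    and u: "\<And>x. x \<in> U \<Longrightarrow> of_real (u x) = \<Phi> x x"
  shows "wirtinger_z_zbar u z = Re (dz (dwb \<Phi>) z z)"
  unfolding wirtinger_z_zbar_def
  using wirtinger_diagonal(1)[OF sesqui_dwb[OF \<Phi> U] U z] wirtinger_diagonal(2)[OF \<Phi> U _ u] by simp

subsection \<open>The Bergman space\<close>

definition bergman_nsq :: "complex set \<Rightarrow> (complex \<Rightarrow> complex) \<Rightarrow> real" where
  "bergman_nsq D f = (LINT z:D|lborel. (cmod (f z))\<^sup>2)"

locale planar_domain =
  fixes D :: "complex set"
  assumes open_D: "open D" and connected_D: "connected D" and nonempty_D: "D \<noteq> {}"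
begin

abbreviation "\<A> \<equiv> bergman_space D"
abbreviation "ip \<equiv> bergman_inner D"
abbreviation "nsq \<equiv> bergman_nsq D"

lemma A_hol: "f \<in> \<A> \<Longrightarrow> f holomorphic_on D"
  by (simp add: bergman_space_def)

lemma A_cont: "f \<in> \<A> \<Longrightarrow> continuous_on D f"
  by (intro holomorphic_on_imp_continuous_on A_hol)

lemma indicator_measurable:
  fixes f :: "complex \<Rightarrow> 'b::real_normed_vector"
  assumes "continuous_on D f"
  shows "(\<lambda>z. indicator D z *\<^sub>R f z) \<in> borel_measurable lborel"
  using borel_measurable_continuous_on_indicator[OF _ assms] open_D by simp

lemma A_set_integrable: "f \<in> \<A> \<Longrightarrow> set_integrable lborel D (\<lambda>z. (cmod (f z))\<^sup>2)"
  by (simp add: bergman_space_def)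

lemma A_I:
  assumes hol: "f holomorphic_on D" and "set_integrable lborel D g"
    and bound: "\<And>z. z \<in> D \<Longrightarrow> (cmod (f z))\<^sup>2 \<le> g z"
  shows "f \<in> \<A>"
proof -
  have "set_integrable lborel D (\<lambda>z. (cmod (f z))\<^sup>2)"
    using assms(2) unfolding set_integrable_def
  proof (rule Bochner_Integration.integrable_bound)
    show "(\<lambda>z. indicator D z *\<^sub>R (cmod (f z))\<^sup>2) \<in> borel_measurable lborel"
      by (intro indicator_measurable continuous_intros holomorphic_on_imp_continuous_on hol)
    show "AE z in lborel. norm (indicat_real D z *\<^sub>R (cmod (f z))\<^sup>2) \<le> norm (indicat_real D z *\<^sub>R g z)"
      using bound by (intro AE_I2) (auto simp: indicator_def intro: order_trans[OF _ abs_ge_self])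
  qed
  then show ?thesis using hol by (simp add: bergman_space_def)
qed

lemma A_prod_integrable:
  assumes f: "f \<in> \<A>" and g: "g \<in> \<A>"
  shows "set_integrable lborel D (\<lambda>z. f z * cnj (g z))"
proof -
  have "set_integrable lborel D (\<lambda>z. (cmod (f z))\<^sup>2 + (cmod (g z))\<^sup>2)"
    using A_set_integrable[OF f] A_set_integrable[OF g] by (rule set_integral_add)
  then show ?thesis
    unfolding set_integrable_def
  proof (rule Bochner_Integration.integrable_bound)
    show "(\<lambda>z. indicator D z *\<^sub>R (f z * cnj (g z))) \<in> borel_measurable lborel"
      by (intro indicator_measurable continuous_intros A_cont f g)
    have "cmod (f z) * cmod (g z) \<le> (cmod (f z))\<^sup>2 + (cmod (g z))\<^sup>2" for z
    proof -
      have "0 \<le> cmod (f z) * cmod (g z)" by simp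
      then show ?thesis using sum_squares_bound[of "cmod (f z)" "cmod (g z)"] by linarith
    qed
    then show "AE z in lborel. norm (indicator D z *\<^sub>R (f z * cnj (g z))) \<le>
        norm (indicat_real D z *\<^sub>R ((cmod (f z))\<^sup>2 + (cmod (g z))\<^sup>2))"
      by (intro AE_I2) (auto simp: indicator_def norm_mult)
  qed
qed

lemma A_lin:
  assumes f: "f \<in> \<A>" and g: "g \<in> \<A>"
  shows "(\<lambda>z. a * f z + b * g z) \<in> \<A>"
proof (rule A_I)
  show "(\<lambda>z. a * f z + b * g z) holomorphic_on D"
    by (intro holomorphic_intros A_hol f g)
  show "set_integrable lborel D (\<lambda>z. 2 * (cmod a)\<^sup>2 * (cmod (f z))\<^sup>2 + 2 * (cmod b)\<^sup>2 * (cmod (g z))\<^sup>2)"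
    by (intro set_integral_add(1) set_integrable_mult_right A_set_integrable f g)
  fix z
  have "(cmod (a * f z + b * g z))\<^sup>2 \<le> (cmod a * cmod (f z) + cmod b * cmod (g z))\<^sup>2"
    by (intro power_mono) (metis norm_mult norm_triangle_ineq, simp)
  also have "\<dots> \<le> 2 * (cmod a * cmod (f z))\<^sup>2 + 2 * (cmod b * cmod (g z))\<^sup>2"
    using sum_squares_bound[of "cmod a * cmod (f z)" "cmod b * cmod (g z)"] by (simp add: power2_sum)
  finally show "(cmod (a * f z + b * g z))\<^sup>2 \<le> 2 * (cmod a)\<^sup>2 * (cmod (f z))\<^sup>2 + 2 * (cmod b)\<^sup>2 * (cmod (g z))\<^sup>2"
    by (simp add: power_mult_distrib)
qed

lemma A_cmult: "f \<in> \<A> \<Longrightarrow> (\<lambda>z. c * f z) \<in> \<A>"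
  using A_lin[of f f c 0] by simp

lemma A_diff_cmult: "f \<in> \<A> \<Longrightarrow> g \<in> \<A> \<Longrightarrow> (\<lambda>z. f z - c * g z) \<in> \<A>"
  using A_lin[of f g 1 "-c"] by simp

lemma A_diff: "f \<in> \<A> \<Longrightarrow> g \<in> \<A> \<Longrightarrow> (\<lambda>z. f z - g z) \<in> \<A>"
  using A_lin[of f g 1 "-1"] by simp

lemma A_zero: "(\<lambda>z. 0) \<in> \<A>"
  by (rule A_I[where g = "\<lambda>z. 0"]) (auto simp: set_integrable_def)

lemma A_sum: "finite F \<Longrightarrow> (\<And>i. i \<in> F \<Longrightarrow> f i \<in> \<A>) \<Longrightarrow> (\<lambda>z. \<Sum>i\<in>F. c i * f i z) \<in> \<A>"
proof (induction F rule: finite_induct)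
  case (insert i F)
  then show ?case using A_lin[of "f i" "\<lambda>z. \<Sum>i\<in>F. c i * f i z" "c i" 1] by simp
qed (simp add: A_zero)

lemma ip_cnj: "ip g f = cnj (ip f g)"
proof -
  have "cnj (ip f g) = (\<integral>z. cnj (indicator D z *\<^sub>R (f z * cnj (g z))) \<partial>lborel)"
    unfolding bergman_inner_def set_lebesgue_integral_def
    by (rule Bochner_Integration.integral_cnj[symmetric])
  also have "\<dots> = ip g f"
    unfolding bergman_inner_def set_lebesgue_integral_def
    by (intro Bochner_Integration.integral_cong) (auto simp: mult.commute)
  finally show ?thesis by simp
qed

lemma ip_lin:
  assumes f: "f \<in> \<A>" and g: "g \<in> \<A>" and h: "h \<in> \<A>"
  shows "ip (\<lambda>z. a * f z + b * g z) h = a * ip f h + b * ip g h"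
proof -
  have "ip (\<lambda>z. a * f z + b * g z) h = (LINT z:D|lborel. a * (f z * cnj (h z)) + b * (g z * cnj (h z)))"
    unfolding bergman_inner_def by (simp add: algebra_simps)
  also have "\<dots> = (LINT z:D|lborel. a * (f z * cnj (h z))) + (LINT z:D|lborel. b * (g z * cnj (h z)))"
    by (intro set_integral_add(2) set_integrable_mult_right A_prod_integrable f g h)
  finally show ?thesis by (simp add: bergman_inner_def)
qed

lemma ip_diff_cmult:
  assumes "f \<in> \<A>" "g \<in> \<A>" "h \<in> \<A>"
  shows "ip (\<lambda>z. f z - c * g z) h = ip f h - c * ip g h"
  using ip_lin[OF assms, of 1 "-c"] by simp

lemma ip_zero: "ip (\<lambda>z. 0) h = 0"
  by (simp add: bergman_inner_def set_lebesgue_integral_def)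

lemma ip_sum:
  assumes "finite F" "\<And>i. i \<in> F \<Longrightarrow> f i \<in> \<A>" "h \<in> \<A>"
  shows "ip (\<lambda>z. \<Sum>i\<in>F. c i * f i z) h = (\<Sum>i\<in>F. c i * ip (f i) h)"
  using assms(1,2)
proof (induction F rule: finite_induct)
  case (insert i F)
  then show ?case
    using ip_lin[of "f i" "\<lambda>z. \<Sum>i\<in>F. c i * f i z" h "c i" 1] A_sum[of F f c] assms(3) by simp
qed (simp add: ip_zero)

lemma ip_self: "ip f f = of_real (nsq f)"
proof -
  have "ip f f = (\<integral>z. of_real (indicator D z *\<^sub>R (cmod (f z))\<^sup>2) \<partial>lborel)"
    unfolding bergman_inner_def set_lebesgue_integral_def
    by (intro Bochner_Integration.integral_cong)
      (auto simp: complex_norm_square[symmetric] scaleR_conv_of_real)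
  also have "\<dots> = of_real (nsq f)"
    unfolding bergman_nsq_def set_lebesgue_integral_def by (rule integral_complex_of_real)
  finally show ?thesis .
qed

lemma nsq_nonneg: "0 \<le> nsq f"
  unfolding bergman_nsq_def set_lebesgue_integral_def by (intro integral_nonneg_AE) auto

lemma ip_cong: "(\<And>z. z \<in> D \<Longrightarrow> f z = f' z) \<Longrightarrow> (\<And>z. z \<in> D \<Longrightarrow> g z = g' z) \<Longrightarrow> ip f g = ip f' g'"
  unfolding bergman_inner_def using open_D by (intro set_lebesgue_integral_cong) auto

lemma nsq_cong: "(\<And>z. z \<in> D \<Longrightarrow> f z = f' z) \<Longrightarrow> nsq f = nsq f'"
  unfolding bergman_nsq_def using open_D by (intro set_lebesgue_integral_cong) auto

lemma nsq_diff_cmult: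
  assumes f: "f \<in> \<A>" and g: "g \<in> \<A>"
  shows "nsq (\<lambda>z. f z - c * g z) = nsq f - 2 * Re (cnj c * ip f g) + (cmod c)\<^sup>2 * nsq g"
proof -
  have "of_real (nsq (\<lambda>z. f z - c * g z)) = ip (\<lambda>z. f z - c * g z) (\<lambda>z. f z - c * g z)"
    by (simp add: ip_self)
  also have "\<dots> = ip f (\<lambda>z. f z - c * g z) - c * ip g (\<lambda>z. f z - c * g z)"
    by (intro ip_diff_cmult f g A_diff_cmult)
  also have "ip f (\<lambda>z. f z - c * g z) = ip f f - cnj c * ip f g"
    by (subst ip_cnj) (simp add: ip_diff_cmult f g, metis ip_cnj)
  also have "ip g (\<lambda>z. f z - c * g z) = cnj (ip f g) - cnj c * ip g g"
    by (subst ip_cnj) (simp add: ip_diff_cmult f g, metis ip_cnj complex_cnj_cnj)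
  also have "ip f f - cnj c * ip f g - c * (cnj (ip f g) - cnj c * ip g g)
      = of_real (nsq f) - (cnj c * ip f g + cnj (cnj c * ip f g)) + c * cnj c * of_real (nsq g)"
    by (simp add: ip_self algebra_simps)
  also have "\<dots> = of_real (nsq f - 2 * Re (cnj c * ip f g) + (cmod c)\<^sup>2 * nsq g)"
    by (simp only: complex_add_cnj complex_norm_square of_real_add of_real_diff of_real_mult)
  finally show ?thesis by (simp only: of_real_eq_iff)
qed

lemma nn_nsq:
  assumes f: "f \<in> \<A>"
  shows "(\<integral>\<^sup>+ z\<in>D. ennreal ((cmod (f z))\<^sup>2) \<partial>lborel) = ennreal (nsq f)"
proof -
  have "(\<integral>\<^sup>+ z\<in>D. ennreal ((cmod (f z))\<^sup>2) \<partial>lborel) = (\<integral>\<^sup>+ z. ennreal (indicator D z *\<^sub>R (cmod (f z))\<^sup>2) \<partial>lborel)"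
    by (intro nn_integral_cong) (auto simp: indicator_def)
  also have "\<dots> = ennreal (nsq f)"
    unfolding bergman_nsq_def set_lebesgue_integral_def
    using A_set_integrable[OF f] unfolding set_integrable_def by (intro nn_integral_eq_integral) auto
  finally show ?thesis .
qed

lemma A_nnI:
  assumes hol: "f holomorphic_on D" and le: "(\<integral>\<^sup>+ z\<in>D. ennreal ((cmod (f z))\<^sup>2) \<partial>lborel) \<le> ennreal c"
    and c: "0 \<le> c"
  shows "f \<in> \<A>" "nsq f \<le> c"
proof -
  have eq: "(\<integral>\<^sup>+ z\<in>D. ennreal ((cmod (f z))\<^sup>2) \<partial>lborel) = (\<integral>\<^sup>+ z. ennreal (indicator D z *\<^sub>R (cmod (f z))\<^sup>2) \<partial>lborel)"
    by (intro nn_integral_cong) (auto simp: indicator_def)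
  have "integrable lborel (\<lambda>z. indicator D z *\<^sub>R (cmod (f z))\<^sup>2)"
  proof (rule integrableI_nonneg)
    show "(\<lambda>z. indicator D z *\<^sub>R (cmod (f z))\<^sup>2) \<in> borel_measurable lborel"
      by (intro indicator_measurable continuous_intros holomorphic_on_imp_continuous_on hol)
    show "(\<integral>\<^sup>+ z. ennreal (indicator D z *\<^sub>R (cmod (f z))\<^sup>2) \<partial>lborel) < \<infinity>"
      using le_less_trans[OF le] by (simp only: eq ennreal_less_top infinity_ennreal_def)
  qed auto
  then show f: "f \<in> \<A>" using hol by (simp add: bergman_space_def set_integrable_def)
  show "nsq f \<le> c" using le c nn_nsq[OF f] by simp
qed

section \<open>Point evaluations and normal families in the Bergman space\<close>

lemma A_point:
  assumes f: "f \<in> \<A>" and r: "0 < r" "ball z r \<subseteq> D"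
  shows "(cmod (f z))\<^sup>2 \<le> nsq f / (pi * r\<^sup>2)"
proof -
  have "ennreal ((cmod (f z))\<^sup>2 * (pi * r\<^sup>2)) = ennreal ((cmod (f z))\<^sup>2) * ennreal (pi * r\<^sup>2)"
    by (simp add: ennreal_mult')
  also have "\<dots> \<le> (\<integral>\<^sup>+ w\<in>ball z r. ennreal ((cmod (f w))\<^sup>2) \<partial>lborel)"
    using holomorphic_on_subset[OF A_hol[OF f] r(2)] r(1) by (rule bergman_point_estimate)
  also have "\<dots> \<le> (\<integral>\<^sup>+ w\<in>D. ennreal ((cmod (f w))\<^sup>2) \<partial>lborel)"
    using r(2) by (intro nn_integral_mono) (auto simp: indicator_def)
  finally have "(cmod (f z))\<^sup>2 * (pi * r\<^sup>2) \<le> nsq f"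
    using nsq_nonneg by (simp add: nn_nsq[OF f])
  then show ?thesis using r by (simp add: field_simps)
qed

lemma A_compact_bound:
  assumes "compact K" "K \<subseteq> D"
  obtains C where "0 < C" "\<And>f z. f \<in> \<A> \<Longrightarrow> z \<in> K \<Longrightarrow> (cmod (f z))\<^sup>2 \<le> C * nsq f"
proof -
  obtain r where r: "r > 0" "(\<Union>x\<in>K. ball x r) \<subseteq> D"
    using compact_subset_open_imp_ball_epsilon_subset[OF assms(1) open_D assms(2)] by blast
  show thesis
  proof (rule that[of "1 / (pi * r\<^sup>2)"])
    show "0 < 1 / (pi * r\<^sup>2)" using r by simp
    fix f z assume "f \<in> \<A>" "z \<in> K"
    then show "(cmod (f z))\<^sup>2 \<le> 1 / (pi * r\<^sup>2) * nsq f"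
      using A_point[of f r z] r by auto
  qed
qed

lemma nsq_zero:
  assumes "f \<in> \<A>" "nsq f = 0" "z \<in> D"
  shows "f z = 0"
proof -
  obtain C where "\<And>f w. f \<in> \<A> \<Longrightarrow> w \<in> {z} \<Longrightarrow> (cmod (f w))\<^sup>2 \<le> C * nsq f"
    by (rule A_compact_bound[of "{z}"]) (use assms in auto)
  from this[OF assms(1), of z] assms show ?thesis by simp
qed

text \<open>The bound is required only from index \<open>N\<close> on, so that sharper bounds on
  late terms of a sequence pass to the limit.\<close>

lemma A_Fatou:
  assumes u: "\<And>n. u n \<in> \<A>" and hol: "g holomorphic_on D" and lim: "\<And>z. z \<in> D \<Longrightarrow> (\<lambda>n. u n z) \<longlonglongrightarrow> g z"
    and c: "\<And>n. N \<le> n \<Longrightarrow> nsq (u n) \<le> c"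
  shows "g \<in> \<A>" "nsq g \<le> c"
proof -
  have c0: "0 \<le> c" using c[of N] nsq_nonneg[of "u N"] by simp
  let ?I = "\<lambda>f z. ennreal ((cmod (f z))\<^sup>2) * indicator D z"
  have meas: "?I f \<in> borel_measurable lborel" if "f holomorphic_on D" for f
  proof -
    have "(\<lambda>z. ennreal (indicator D z *\<^sub>R (cmod (f z))\<^sup>2)) \<in> borel_measurable lborel"
      by (intro measurable_compose[OF _ measurable_ennreal] indicator_measurable continuous_intros
          holomorphic_on_imp_continuous_on that)
    also have "(\<lambda>z. ennreal (indicator D z *\<^sub>R (cmod (f z))\<^sup>2)) = ?I f" by (auto simp: indicator_def)
    finally show ?thesis .
  qed
  have "(\<integral>\<^sup>+ z. ?I g z \<partial>lborel) = (\<integral>\<^sup>+ z. liminf (\<lambda>n. ?I (u n) z) \<partial>lborel)"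
  proof (intro nn_integral_cong)
    fix z
    have "(\<lambda>n. ?I (u n) z) \<longlonglongrightarrow> ?I g z"
      using lim[of z] by (cases "z \<in> D") (auto intro!: tendsto_intros)
    then show "?I g z = liminf (\<lambda>n. ?I (u n) z)"
      by (rule lim_imp_Liminf[symmetric, rotated]) simp
  qed
  also have "\<dots> \<le> liminf (\<lambda>n. \<integral>\<^sup>+ z. ?I (u n) z \<partial>lborel)"
    by (rule nn_integral_liminf) (rule meas[OF A_hol[OF u]])
  also have "\<dots> = liminf (\<lambda>n. ennreal (nsq (u n)))"
    by (simp add: nn_nsq[OF u])
  also have "\<dots> \<le> liminf (\<lambda>n. ennreal c)"
    by (rule Liminf_mono) (use c in \<open>auto intro!: ennreal_leI eventually_sequentiallyI[of N]\<close>)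
  also have "\<dots> = ennreal c" by (simp add: Liminf_const)
  finally show "g \<in> \<A>" "nsq g \<le> c" using A_nnI[OF hol _ c0] by auto
qed

text \<open>Norm bounds are local uniform bounds by point evaluation, so Montel's theorem applies,
  and Fatou's lemma keeps the limit in the space. This takes the place of weak compactness in a
  Hilbert space.\<close>

lemma A_Montel:
  assumes u: "\<And>n. u n \<in> \<A>" and c: "\<And>n. nsq (u n) \<le> c"
  obtains g r where "g \<in> \<A>" "strict_mono (r::nat \<Rightarrow> nat)" "\<And>z. z \<in> D \<Longrightarrow> (\<lambda>n. u (r n) z) \<longlonglongrightarrow> g z"
    "\<And>K. compact K \<Longrightarrow> K \<subseteq> D \<Longrightarrow> uniform_limit K (\<lambda>n. u (r n)) g sequentially"
proof -
  have "\<exists>B. \<forall>h\<in>range u. \<forall>z\<in>K. cmod (h z) \<le> B" if K: "compact K" "K \<subseteq> D" for K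
  proof -
    obtain C where C: "0 < C" "\<And>f z. f \<in> \<A> \<Longrightarrow> z \<in> K \<Longrightarrow> (cmod (f z))\<^sup>2 \<le> C * nsq f"
      using A_compact_bound[OF K] by blast
    have "cmod (u n z) \<le> sqrt (C * c)" if "z \<in> K" for n z
    proof (rule real_le_rsqrt)
      have "(cmod (u n z))\<^sup>2 \<le> C * nsq (u n)" using C(2)[OF u that] .
      also have "\<dots> \<le> C * c" using C(1) c by (intro mult_left_mono) auto
      finally show "(cmod (u n z))\<^sup>2 \<le> C * c" .
    qed
    then show ?thesis by blast
  qed
  then obtain g r where g: "g holomorphic_on D" and r: "strict_mono (r :: nat \<Rightarrow> nat)"
    and lim: "\<And>x. x \<in> D \<Longrightarrow> ((\<lambda>n. u (r n) x) \<longlongrightarrow> g x) sequentially"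
    and ulim: "\<And>K. compact K \<Longrightarrow> K \<subseteq> D \<Longrightarrow> uniform_limit K (u \<circ> r) g sequentially"
  proof -
    assume *: "\<And>K. \<lbrakk>compact K; K \<subseteq> D\<rbrakk> \<Longrightarrow> \<exists>B. \<forall>h\<in>range u. \<forall>z\<in>K. cmod (h z) \<le> B"
    show thesis
      by (rule Montel[OF open_D _ *, where \<F> = u]) (use A_hol[OF u] that in auto)
  qed
  have "g \<in> \<A>"
    by (rule A_Fatou(1)[of "\<lambda>n. u (r n)" g 0 c]) (use u g lim c in auto)
  then show thesis using that r lim ulim by (simp add: o_def)
qed

section \<open>Extremal functions and an orthonormal basis\<close>

lemma higher_deriv_diff_cmult:
  assumes "f \<in> \<A>" "g \<in> \<A>" "p \<in> D"
  shows "(deriv ^^ k) (\<lambda>z. f z - c * g z) p = (deriv ^^ k) f p - c * (deriv ^^ k) g p"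
proof -
  have "(\<lambda>z. c * g z) holomorphic_on D" using assms A_hol by (intro holomorphic_intros) auto
  then show ?thesis
    using higher_deriv_diff[of f D "\<lambda>z. c * g z" p k] higher_deriv_cmult[of g D p k c] assms A_hol open_D
    by simp
qed

lemma A_deriv_limit:
  assumes u: "\<And>n. u n \<in> \<A>" and p: "p \<in> D"
    and ulim: "\<And>K. compact K \<Longrightarrow> K \<subseteq> D \<Longrightarrow> uniform_limit K u g sequentially"
  shows "(\<lambda>i. (deriv ^^ k) (u i) p) \<longlonglongrightarrow> (deriv ^^ k) g p"
proof -
  obtain \<rho> where \<rho>: "0 < \<rho>" "cball p \<rho> \<subseteq> D" using open_D p open_contains_cball by blast
  show ?thesis
  proof (rule higher_deriv_complex_uniform_limit)
    show "uniform_limit (ball p \<rho>) u g sequentially"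
      using ulim[of "cball p \<rho>"] \<rho> by (auto intro: uniform_limit_on_subset)
    show "\<forall>\<^sub>F i in sequentially. u i holomorphic_on ball p \<rho>"
      using \<rho> ball_subset_cball[of p \<rho>] by (auto intro!: always_eventually holomorphic_on_subset[OF A_hol[OF u]])
  qed (use \<rho> in auto)
qed

text \<open>\<open>e\<close> has the least norm among the functions in \<open>V\<close> with
  \<open>n\<close>-th derivative one at \<open>p\<close>; a minimizing sequence converges by
  normality, and minimality is orthogonality to the kernel of the functional. The case
  \<open>n = 0\<close> also yields the reproducing kernel.\<close>

lemma A_extremal:
  fixes p :: complex and n :: nat
  defines "V \<equiv> {f \<in> \<A>. \<forall>k<n. (deriv ^^ k) f p = 0}"
  assumes p: "p \<in> D" and f0: "f0 \<in> V" "(deriv ^^ n) f0 p \<noteq> 0"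
  obtains e where "e \<in> V" "(deriv ^^ n) e p = 1" "\<And>g. g \<in> V \<Longrightarrow> (deriv ^^ n) g p = 0 \<Longrightarrow> ip g e = 0"
proof -
  define L where "L f = (deriv ^^ n) f p" for f
  define S where "S = nsq ` {f \<in> V. L f = 1}"
  have VA: "f \<in> \<A>" if "f \<in> V" for f using that by (simp add: V_def)
  have V_diff: "(\<lambda>z. f z - c * g z) \<in> V" and L_diff: "L (\<lambda>z. f z - c * g z) = L f - c * L g"
    if "f \<in> V" "g \<in> V" for f g c
    using that p unfolding V_def L_def by (auto simp: higher_deriv_diff_cmult A_diff_cmult)
  have V0: "(\<lambda>z. 0) \<in> V" using V_diff[OF f0(1) f0(1), of 1] by simp
  have L0: "L (\<lambda>z. 0) = 0" using L_diff[OF f0(1) f0(1), of 1] by simp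
  \<comment> \<open>This is \<open>f0 / L f0\<close>, written as a difference so that closure of
    \<open>V\<close> under differences applies.\<close>
  have "(\<lambda>z. 0 - (- 1 / L f0) * f0 z) \<in> V" by (rule V_diff[OF V0 f0(1)])
  moreover have "L (\<lambda>z. 0 - (- 1 / L f0) * f0 z) = 1"
    using L_diff[OF V0 f0(1), of "- 1 / L f0"] f0(2) L0 by (simp add: L_def)
  ultimately have ne: "S \<noteq> {}" unfolding S_def by blast
  have bdd: "bdd_below S" unfolding S_def by (rule bdd_belowI[of _ 0]) (auto simp: nsq_nonneg)
  define m where "m = Inf S"
  have "\<exists>f. f \<in> V \<and> L f = 1 \<and> nsq f < m + 1 / real (Suc k)" for k
  proof -
    have "Inf S < m + 1 / real (Suc k)" by (simp add: m_def)
    then show ?thesis using cInf_less_iff[OF ne bdd] by (auto simp: S_def)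
  qed
  then obtain u where u: "\<And>k. u k \<in> V" "\<And>k. L (u k) = 1" "\<And>k. nsq (u k) < m + 1 / real (Suc k)"
    by metis
  have "nsq (u k) \<le> m + 1" for k
  proof -
    have "1 / real (Suc k) \<le> 1" by simp
    then show ?thesis using u(3)[of k] by linarith
  qed
  then obtain e r where e: "e \<in> \<A>" and r: "strict_mono (r::nat \<Rightarrow> nat)"
    and lim: "\<And>z. z \<in> D \<Longrightarrow> (\<lambda>k. u (r k) z) \<longlonglongrightarrow> e z"
    and ulim: "\<And>K. compact K \<Longrightarrow> K \<subseteq> D \<Longrightarrow> uniform_limit K (\<lambda>k. u (r k)) e sequentially"
    using A_Montel[of u "m + 1"] VA u(1) by blast
  have dl: "(\<lambda>i. (deriv ^^ k) (u (r i)) p) \<longlonglongrightarrow> (deriv ^^ k) e p" for k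
    by (rule A_deriv_limit) (use VA u(1) ulim p in auto)
  have "(deriv ^^ k) e p = 0" if "k < n" for k
    using dl[of k] u(1) that unfolding V_def by (simp add: LIMSEQ_const_iff)
  then have eV: "e \<in> V" using e by (simp add: V_def)
  have Le: "L e = 1"
    using dl[of n] u(2) unfolding L_def by (simp add: LIMSEQ_const_iff)
  have "nsq e \<le> m + 1 / real (Suc k)" for k
  proof (rule A_Fatou(2)[of "\<lambda>i. u (r i)" e k])
    fix i assume "k \<le> i"
    then have "k \<le> r i" using seq_suble[OF r, of i] by simp
    then have "1 / real (Suc (r i)) \<le> 1 / real (Suc k)" by (intro divide_left_mono) auto
    then show "nsq (u (r i)) \<le> m + 1 / real (Suc k)" using u(3)[of "r i"] by linarith
  qed (use VA u(1) e A_hol lim in auto)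
  then have "nsq e \<le> m + \<epsilon>" if "0 < \<epsilon>" for \<epsilon>
    using that nat_approx_posE[of \<epsilon>] by (metis add_left_mono dual_order.trans less_imp_le)
  then have "nsq e \<le> m" by (rule field_le_epsilon)
  then have min: "nsq e \<le> nsq f" if "f \<in> V" "L f = 1" for f
    using that cInf_lower[OF _ bdd, of "nsq f"] by (auto simp: S_def m_def[unfolded S_def])
  have "ip g e = 0" if g: "g \<in> V" "L g = 0" for g
  proof (cases "nsq g = 0")
    case True
    have "ip g e = ip (\<lambda>z. 0) e"
      by (rule ip_cong) (use nsq_zero[OF VA[OF g(1)] True] in auto)
    then show ?thesis by (simp add: ip_zero)
  next
    case False
    \<comment> \<open>The coefficient of the projection of \<open>e\<close> on \<open>g\<close>.
      Subtracting the projection keeps \<open>L e = 1\<close> and lowers the norm unless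
      \<open>c\<close> is zero.\<close>
    define c where "c = ip e g / of_real (nsq g)"
    have "L (\<lambda>z. e z - c * g z) = 1" using L_diff[OF eV g(1)] Le g(2) by simp
    then have "nsq e \<le> nsq (\<lambda>z. e z - c * g z)" using V_diff[OF eV g(1)] min by blast
    also have "\<dots> = nsq e - 2 * Re (cnj c * ip e g) + (cmod c)\<^sup>2 * nsq g"
      using nsq_diff_cmult VA eV g by blast
    also have "ip e g = c * of_real (nsq g)" using False by (simp add: c_def)
    also have "Re (cnj c * (c * of_real (nsq g))) = (cmod c)\<^sup>2 * nsq g"
      by (simp add: cmod_power2) (simp add: power2_eq_square algebra_simps)
    finally have "(cmod c)\<^sup>2 * nsq g \<le> 0" by (simp add: mult.commute)
    then have "c = 0" using False nsq_nonneg[of g] by (simp add: mult_le_0_iff)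
    then have "ip e g = 0" using False by (simp add: c_def)
    then show ?thesis using ip_cnj[of g e] by simp
  qed
  then show thesis using that eV Le by (auto simp: L_def)
qed

lemma ip_cmult:
  assumes "f \<in> \<A>" "g \<in> \<A>"
  shows "ip (\<lambda>z. c * f z) (\<lambda>z. d * g z) = c * cnj d * ip f g"
proof -
  have l: "ip (\<lambda>z. c * f z) h = c * ip f h" if "f \<in> \<A>" "h \<in> \<A>" for f h c
    using ip_lin[OF that(1) that(1) that(2), of c 0] by simp
  have "ip (\<lambda>z. c * f z) (\<lambda>z. d * g z) = c * cnj (ip (\<lambda>z. d * g z) f)"
    using assms l A_cmult ip_cnj by metis
  also have "ip (\<lambda>z. d * g z) f = d * cnj (ip f g)"
    using assms l ip_cnj by metis
  finally show ?thesis by simp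
qed

text \<open>Gram--Schmidt along the Taylor coefficients at a point: the subspaces of functions vanishing
  to order \<open>n\<close> decrease to \<open>0\<close> by the identity theorem.\<close>

lemma orthonormal_basis_exists: "\<exists>B. bergman_orthonormal_basis D B"
proof -
  obtain p where p: "p \<in> D" using nonempty_D by blast
  define L where "L n f = (deriv ^^ n) f p" for n and f :: "complex \<Rightarrow> complex"
  define V where "V n = {f \<in> \<A>. \<forall>k<n. L k f = 0}" for n
  have VA: "f \<in> \<A>" if "f \<in> V n" for f n using that by (simp add: V_def)
  have L_diff: "L k (\<lambda>z. f z - c * g z) = L k f - c * L k g" if "f \<in> \<A>" "g \<in> \<A>" for f g c k
    using that p by (simp add: L_def higher_deriv_diff_cmult)
  have V_diff: "(\<lambda>z. f z - c * g z) \<in> V n" if "f \<in> V n" "g \<in> V n" for f g c n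
    using that by (auto simp: V_def L_diff A_diff_cmult)
  have L0: "L k (\<lambda>z. 0) = 0" for k using L_diff[OF A_zero A_zero, of k 1] by simp
  have V_Suc: "f \<in> V (Suc n)" if "f \<in> V n" "L n f = 0" for f n
    using that by (auto simp: V_def less_Suc_eq)
  have V_mono: "V n \<subseteq> V m" if "m \<le> n" for m n using that by (auto simp: V_def)
  \<comment> \<open>If no function in \<open>V n\<close> has a nonzero \<open>n\<close>-th
    derivative at \<open>p\<close>, the zero function serves as default.\<close>
  have "\<exists>e. e \<in> V n \<and> (\<forall>g\<in>V n. L n g = 0 \<longrightarrow> ip g e = 0) \<and> (\<forall>g\<in>V n. L n g \<noteq> 0 \<longrightarrow> L n e = 1)" for n
  proof (cases "\<exists>f\<in>V n. L n f \<noteq> 0")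
    case True
    then obtain f where f: "f \<in> V n" "L n f \<noteq> 0" by blast
    show ?thesis
      by (rule A_extremal[OF p, of f n]) (use f in \<open>auto simp: V_def L_def\<close>)
  next
    case False
    have "ip g (\<lambda>z. 0) = 0" for g using ip_cnj[of g "\<lambda>z. 0"] by (simp add: ip_zero)
    with False show ?thesis by (intro exI[of _ "\<lambda>z. 0"]) (auto simp: V_def A_zero L0)
  qed
  then obtain e where e: "\<And>n. e n \<in> V n" "\<And>n g. g \<in> V n \<Longrightarrow> L n g = 0 \<Longrightarrow> ip g (e n) = 0"
      "\<And>n g. g \<in> V n \<Longrightarrow> L n g \<noteq> 0 \<Longrightarrow> L n (e n) = 1"
    by metis
  have eA: "e n \<in> \<A>" for n using VA e(1) by blast
  have later: "ip g (e m) = 0" if "g \<in> V n" "m < n" for g m n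
    using that V_mono[of m n] by (intro e(2)) (auto simp: V_def)
  have orth: "ip (e m) (e n) = 0" if "m \<noteq> n" for m n
  proof (cases "m < n")
    case True
    then show ?thesis using later[OF e(1) True] ip_cnj[of "e m" "e n"] by simp
  next
    case False
    then show ?thesis using that by (intro later[OF e(1)]) auto
  qed
  \<comment> \<open>At an order that no function of the space attains, \<open>e n\<close> is
    orthogonal to itself; such indices must not enter the basis.\<close>
  define G where "G = {n. nsq (e n) \<noteq> 0}"
  define E where "E n = (\<lambda>z. of_real (1 / sqrt (nsq (e n))) * e n z)" for n
  have EA: "E n \<in> \<A>" for n unfolding E_def using eA by (rule A_cmult)
  have ipE: "ip (E m) (E n) = (if m = n then 1 else 0)" if "m \<in> G" for m n
  proof (cases "m = n")
    case True
    have "0 < nsq (e m)" using that nsq_nonneg[of "e m"] by (simp add: G_def)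
    then have "(1 / sqrt (nsq (e m))) * (1 / sqrt (nsq (e m))) * nsq (e m) = 1"
      by simp
    then have "of_real (1 / sqrt (nsq (e m))) * cnj (of_real (1 / sqrt (nsq (e m)))) * complex_of_real (nsq (e m)) = 1"
      by (simp only: complex_cnj_complex_of_real flip: of_real_mult) simp
    moreover have "ip (E m) (E m) = of_real (1 / sqrt (nsq (e m))) * cnj (of_real (1 / sqrt (nsq (e m)))) * of_real (nsq (e m))"
      unfolding E_def by (simp only: ip_cmult[OF eA eA] ip_self)
    ultimately show ?thesis using True by simp
  next
    case False
    then show ?thesis unfolding E_def by (simp only: ip_cmult[OF eA eA] orth[OF False]) simp
  qed
  have injE: "inj_on E G"
    by (rule inj_onI) (metis ipE zero_neq_one)
  have dense: "\<exists>F c. finite F \<and> F \<subseteq> E ` G \<and> (LINT z:D|lborel. (cmod (h z - (\<Sum>f\<in>F. c f * f z)))\<^sup>2) < \<epsilon>"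
    if h: "h \<in> \<A>" and \<epsilon>: "0 < \<epsilon>" for h \<epsilon>
  proof -
    \<comment> \<open>\<open>R n\<close> is \<open>h\<close> after \<open>n\<close> leading Taylor
      coefficients at \<open>p\<close> have been removed one by one; the differences of these
      remainders are combinations of the \<open>e j\<close>.\<close>
    define R where "R = rec_nat h (\<lambda>n f z. f z - L n f * e n z)"
    have R0: "R 0 = h" and RS: "R (Suc n) = (\<lambda>z. R n z - L n (R n) * e n z)" for n
      by (simp_all add: R_def)
    have RV: "R n \<in> V n" for n
    proof (induction n)
      case (Suc n)
      have "L n (R (Suc n)) = 0"
        using L_diff[OF VA[OF Suc] eA, of n "L n (R n)" n] e(3)[OF Suc] unfolding RS by force
      then show ?case
        using V_diff[OF Suc e(1)] unfolding RS by (intro V_Suc) auto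
    qed (simp add: R0 V_def h)
    have RA: "R n \<in> \<A>" for n using VA RV by blast
    define c where "c n = L n (R n)" for n
    have diff: "R m z - R k z = (\<Sum>j\<in>{m..<k}. c j * e j z)" if "m \<le> k" for m k z
      using that by (induction k rule: dec_induct) (auto simp: RS c_def algebra_simps)
    have ns: "nsq (\<lambda>z. R m z - R k z) = nsq (R m) - nsq (R k)" if "m \<le> k" for m k
    proof -
      have "ip (\<lambda>z. \<Sum>j\<in>{m..<k}. c j * e j z) (R k) = (\<Sum>j\<in>{m..<k}. c j * ip (e j) (R k))"
        by (intro ip_sum) (auto simp: eA RA)
      also have "\<dots> = 0"
        using later[OF RV[of k]] ip_cnj[of _ "R k"] by (intro sum.neutral) (metis atLeastLessThan_iff complex_cnj_zero mult_zero_right)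
      finally have "ip (\<lambda>z. R m z - 1 * R k z) (R k) = 0" by (simp add: diff[OF that])
      then have "ip (R m) (R k) = ip (R k) (R k)" using ip_diff_cmult[of "R m" "R k" "R k" 1] by (simp add: RA)
      then show ?thesis using nsq_diff_cmult[of "R m" "R k" 1] RA by (simp add: ip_self)
    qed
    have dec: "nsq (R k) \<le> nsq (R m)" if "m \<le> k" for m k
      using ns[OF that] nsq_nonneg[of "\<lambda>z. R m z - R k z"] by simp
    obtain l where l: "(\<lambda>n. nsq (R n)) \<longlonglongrightarrow> l" "\<And>n. l \<le> nsq (R n)"
      using decseq_convergent[of "\<lambda>n. nsq (R n)" 0] dec nsq_nonneg by (auto simp: decseq_def)
    obtain m where m: "nsq (R m) < l + \<epsilon> / 2"
      using order_tendstoD(2)[OF l(1), of "l + \<epsilon> / 2"] \<epsilon> by (auto simp: eventually_sequentially)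
    obtain g r where g: "g \<in> \<A>" and r: "strict_mono (r::nat \<Rightarrow> nat)"
      and lim: "\<And>z. z \<in> D \<Longrightarrow> (\<lambda>n. R (r n) z) \<longlonglongrightarrow> g z"
      and ulim: "\<And>K. compact K \<Longrightarrow> K \<subseteq> D \<Longrightarrow> uniform_limit K (\<lambda>n. R (r n)) g sequentially"
      using A_Montel[of R "nsq h"] RA dec[of 0] by (auto simp: R0)
    \<comment> \<open>A limit of the remainders vanishes to every order at \<open>p\<close>, hence
      identically: this is the source of completeness.\<close>
    have "(deriv ^^ k) g p = 0" for k
    proof -
      have "(\<lambda>i. L k (R (r i))) \<longlonglongrightarrow> (deriv ^^ k) g p"
        unfolding L_def by (rule A_deriv_limit) (use RA p ulim in auto)
      moreover have "L k (R (r i)) = 0" if "Suc k \<le> i" for i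
        using RV[of "r i"] seq_suble[OF r, of i] that by (auto simp: V_def)
      then have "(\<lambda>i. L k (R (r i))) \<longlonglongrightarrow> 0"
        by (intro tendsto_eventually eventually_sequentiallyI[of "Suc k"])
      ultimately show ?thesis using LIMSEQ_unique by blast
    qed
    then have g0: "g z = 0" if "z \<in> D" for z
      using holomorphic_fun_eq_0_on_connected[OF A_hol[OF g] open_D connected_D _ p that] by blast
    \<comment> \<open>Since the limit is zero, \<open>R m\<close> is the pointwise limit of
      \<open>R m - R (r i)\<close>. These differences are small in norm because the decreasing
      sequence \<open>nsq (R n)\<close> is within \<open>\<epsilon> / 2\<close> of its limit from
      \<open>m\<close> on.\<close>
    have "nsq (R m) \<le> \<epsilon> / 2"
    proof (rule A_Fatou(2)[of "\<lambda>i z. R m z - R (r i) z" "R m" m])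
      fix i assume "m \<le> i"
      then have "m \<le> r i" using seq_suble[OF r, of i] by simp
      then have "nsq (\<lambda>z. R m z - R (r i) z) = nsq (R m) - nsq (R (r i))" by (rule ns)
      then show "nsq (\<lambda>z. R m z - R (r i) z) \<le> \<epsilon> / 2" using m l(2)[of "r i"] by linarith
    next
      fix z assume "z \<in> D"
      then show "(\<lambda>i. R m z - R (r i) z) \<longlonglongrightarrow> R m z"
        using tendsto_diff[OF tendsto_const lim, of z "R m z"] g0 by simp
    qed (auto intro!: A_diff RA A_hol)
    \<comment> \<open>The basis is a set of functions, so a coefficient recovers the index from the
      function; the square root undoes the normalization.\<close>
    moreover define c' where "c' f = (let j = inv_into G E f in c j * of_real (sqrt (nsq (e j))))" for f
    define F where "F = E ` (G \<inter> {..<m})"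
    have "h z - (\<Sum>f\<in>F. c' f * f z) = R m z" if z: "z \<in> D" for z
    proof -
      have "(\<Sum>f\<in>F. c' f * f z) = (\<Sum>j\<in>G \<inter> {..<m}. c' (E j) * E j z)"
        unfolding F_def by (subst sum.reindex) (auto intro: inj_on_subset[OF injE])
      also have "\<dots> = (\<Sum>j\<in>G \<inter> {..<m}. c j * e j z)"
      proof (rule sum.cong)
        fix j assume "j \<in> G \<inter> {..<m}"
        then have j: "j \<in> G" by simp
        then have "0 < nsq (e j)" using nsq_nonneg[of "e j"] by (simp add: G_def)
        then show "c' (E j) * E j z = c j * e j z"
          using inv_into_f_f[OF injE j] by (simp add: c'_def Let_def E_def[of j] del: of_real_divide)
            (simp add: E_def)
      qed simp
      also have "\<dots> = (\<Sum>j\<in>{0..<m}. c j * e j z)"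
        by (rule sum.mono_neutral_left) (use nsq_zero[OF eA _ z] in \<open>auto simp: G_def\<close>)
      also have "\<dots> = h z - R m z" using diff[of 0 m z] by (simp add: R0)
      finally show ?thesis by simp
    qed
    then have "nsq (\<lambda>z. h z - (\<Sum>f\<in>F. c' f * f z)) = nsq (R m)" by (rule nsq_cong)
    ultimately have "nsq (\<lambda>z. h z - (\<Sum>f\<in>F. c' f * f z)) < \<epsilon>" using \<epsilon> by simp
    moreover have "finite F" "F \<subseteq> E ` G" by (auto simp: F_def)
    ultimately show ?thesis unfolding bergman_nsq_def by blast
  qed
  have "bergman_orthonormal_basis D (E ` G)"
    unfolding bergman_orthonormal_basis_def
  proof (intro conjI ballI allI impI)
    show "E ` G \<subseteq> \<A>" using EA by blast
    fix f g assume "f \<in> E ` G" "g \<in> E ` G"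
    then obtain m n where mn: "m \<in> G" "n \<in> G" "f = E m" "g = E n" by blast
    then show "ip f g = (if f = g then 1 else 0)"
      using ipE[of m n] inj_on_eq_iff[OF injE, of m n] by simp
  qed (rule dense)
  then show ?thesis by blast
qed

subsection \<open>The reproducing kernel\<close>

text \<open>The Riesz representative of evaluation at \<open>w\<close>. Only its values on
  \<open>D\<close> are determined, as members of the Bergman space are total functions.\<close>

definition rep :: "complex \<Rightarrow> complex \<Rightarrow> complex" where
  "rep w = (SOME k. k \<in> \<A> \<and> (\<forall>f\<in>\<A>. f w = ip f k))"

definition ker :: "complex \<Rightarrow> complex \<Rightarrow> complex" where
  "ker z w = rep w z"

text \<open>The representative is the extremal function \<open>e\<close> with value one at
  \<open>w\<close>, divided by its squared norm: \<open>f - f w * e\<close> vanishes at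
  \<open>w\<close> and is therefore orthogonal to \<open>e\<close>.\<close>

lemma rep_exists:
  assumes w: "w \<in> D"
  shows "\<exists>k. k \<in> \<A> \<and> (\<forall>f\<in>\<A>. f w = ip f k)"
proof (cases "\<exists>f\<in>\<A>. f w \<noteq> 0")
  case False
  have "ip f (\<lambda>z. 0) = 0" for f using ip_cnj[of f "\<lambda>z. 0"] by (simp add: ip_zero)
  then show ?thesis using False by (intro exI[of _ "\<lambda>z. 0"]) (auto simp: A_zero)
next
  case True
  then obtain f0 where f0: "f0 \<in> \<A>" "f0 w \<noteq> 0" by blast
  obtain e where e: "e \<in> \<A>" "e w = 1" "\<And>g. g \<in> \<A> \<Longrightarrow> g w = 0 \<Longrightarrow> ip g e = 0"
    using A_extremal[OF w, of f0 0] f0 by auto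
  have ne: "nsq e \<noteq> 0" using nsq_zero[OF e(1) _ w] e(2) by auto
  define k where "k = (\<lambda>z. of_real (1 / nsq e) * e z)"
  have "f w = ip f k" if f: "f \<in> \<A>" for f
  proof -
    have "ip (\<lambda>z. f z - f w * e z) e = 0"
      using f e by (intro e(3) A_diff_cmult) auto
    then have "ip f e = f w * of_real (nsq e)" by (simp add: ip_diff_cmult f e(1) ip_self)
    moreover have "ip f k = cnj (of_real (1 / nsq e)) * ip f e"
      using ip_cmult[OF f e(1), of 1 "of_real (1 / nsq e)"] by (simp add: k_def)
    ultimately show ?thesis using ne by simp
  qed
  moreover have "k \<in> \<A>" unfolding k_def by (rule A_cmult) (rule e(1))
  ultimately show ?thesis by blast
qed

lemma rep_A: "w \<in> D \<Longrightarrow> rep w \<in> \<A>"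
  and reproducing: "w \<in> D \<Longrightarrow> f \<in> \<A> \<Longrightarrow> f w = ip f (rep w)"
  using someI_ex[OF rep_exists] unfolding rep_def by blast+

lemma ker_ip: "z \<in> D \<Longrightarrow> w \<in> D \<Longrightarrow> ker z w = ip (rep w) (rep z)"
  unfolding ker_def by (intro reproducing rep_A)

lemma ker_cnj: "z \<in> D \<Longrightarrow> w \<in> D \<Longrightarrow> cnj (ker w z) = ker z w"
  using ip_cnj[of "rep w" "rep z"] by (simp add: ker_ip)

lemma ker_diag: "w \<in> D \<Longrightarrow> ker w w = of_real (nsq (rep w))"
  by (simp add: ker_ip ip_self)

lemma ker_Cauchy_Schwarz:
  assumes z: "z \<in> D" and w: "w \<in> D"
  shows "(cmod (ker z w))\<^sup>2 \<le> nsq (rep z) * nsq (rep w)"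
proof (cases "nsq (rep z) = 0")
  case True
  have "ker z w = ip (rep w) (\<lambda>x. 0)"
    unfolding ker_ip[OF z w] by (rule ip_cong) (use nsq_zero[OF rep_A[OF z] True] in auto)
  then show ?thesis using ip_cnj[of "rep w" "\<lambda>x. 0"] True by (simp add: ip_zero)
next
  case False
  \<comment> \<open>The projection coefficient of \<open>rep w\<close> on \<open>rep z\<close>; the
    inequality is nonnegativity of the squared norm of the remainder.\<close>
  define c where "c = ker z w / of_real (nsq (rep z))"
  have "0 \<le> nsq (\<lambda>x. rep w x - c * rep z x)" by (rule nsq_nonneg)
  also have "\<dots> = nsq (rep w) - 2 * Re (cnj c * ker z w) + (cmod c)\<^sup>2 * nsq (rep z)"
    using nsq_diff_cmult[OF rep_A[OF w] rep_A[OF z]] by (simp add: ker_ip z w)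
  also have "ker z w = c * of_real (nsq (rep z))" using False by (simp add: c_def)
  also have "Re (cnj c * (c * of_real (nsq (rep z)))) = (cmod c)\<^sup>2 * nsq (rep z)"
    by (simp add: cmod_power2) (simp add: power2_eq_square algebra_simps)
  finally have "(cmod c)\<^sup>2 * nsq (rep z) \<le> nsq (rep w)" by (simp add: mult.commute)
  then have "(cmod c)\<^sup>2 * nsq (rep z) * nsq (rep z) \<le> nsq (rep w) * nsq (rep z)"
    by (rule mult_right_mono) (rule nsq_nonneg)
  moreover have "(cmod c)\<^sup>2 * nsq (rep z) * nsq (rep z) = (cmod (ker z w))\<^sup>2"
    using False nsq_nonneg[of "rep z"] by (simp add: c_def norm_divide power_divide power2_eq_square)
  ultimately show ?thesis by (simp add: mult.commute)
qed

text \<open>Completing the square separates the error of the best approximation from the error of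
  the coefficients. The choice \<open>c = ip h\<close> gives Bessel's inequality, and an arbitrary
  \<open>c\<close> turns density of the span into convergence.\<close>

lemma orthonormal_expansion:
  assumes B: "bergman_orthonormal_basis D B" and F: "finite F" "F \<subseteq> B" and h: "h \<in> \<A>"
  shows "nsq (\<lambda>z. h z - (\<Sum>f\<in>F. c f * f z)) =
    nsq h - (\<Sum>f\<in>F. (cmod (ip h f))\<^sup>2) + (\<Sum>f\<in>F. (cmod (ip h f - c f))\<^sup>2)"
proof -
  have BA: "B \<subseteq> \<A>" and on: "\<And>f g. f \<in> B \<Longrightarrow> g \<in> B \<Longrightarrow> ip f g = (if f = g then 1 else 0)"
    using B by (auto simp: bergman_orthonormal_basis_def)
  define S where "S = (\<lambda>z. \<Sum>f\<in>F. c f * f z)"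
  have FA: "f \<in> \<A>" if "f \<in> F" for f using that F BA by blast
  have SA: "S \<in> \<A>" unfolding S_def using F FA by (intro A_sum) auto
  have ipS: "ip S g = (\<Sum>f\<in>F. c f * ip f g)" if "g \<in> \<A>" for g
    unfolding S_def using F FA that by (intro ip_sum) auto
  have Sf: "ip S f = c f" if "f \<in> F" for f
  proof -
    have "ip S f = (\<Sum>g\<in>F. if g = f then c g else 0)"
      unfolding ipS[OF FA[OF that]] using F that by (intro sum.cong) (auto simp: on subset_iff)
    then show ?thesis using F that by simp
  qed
  have 1: "ip h S = (\<Sum>f\<in>F. cnj (c f) * ip h f)"
    by (subst ip_cnj, subst ipS[OF h]) (simp add: cnj_sum, metis (no_types) ip_cnj)
  have 2: "complex_of_real (nsq S) = of_real (\<Sum>f\<in>F. (cmod (c f))\<^sup>2)"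
  proof -
    have "ip S S = (\<Sum>f\<in>F. c f * cnj (c f))"
      unfolding ipS[OF SA] using Sf ip_cnj by (intro sum.cong) metis+
    also have "\<dots> = of_real (\<Sum>f\<in>F. (cmod (c f))\<^sup>2)"
      by (simp only: complex_norm_square[symmetric] of_real_sum)
    finally show ?thesis by (simp only: ip_self)
  qed
  have "nsq (\<lambda>z. h z - 1 * S z) = nsq h - 2 * Re (ip h S) + nsq S"
    using nsq_diff_cmult[OF h SA, of 1] by simp
  also have "nsq S = (\<Sum>f\<in>F. (cmod (c f))\<^sup>2)" using 2 by (simp only: of_real_eq_iff)
  also have "nsq h - 2 * Re (ip h S) + (\<Sum>f\<in>F. (cmod (c f))\<^sup>2)
      = nsq h + (\<Sum>f\<in>F. (cmod (c f))\<^sup>2 - 2 * Re (cnj (c f) * ip h f))"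
    unfolding 1 by (simp add: sum_subtractf Re_sum sum_distrib_left)
  also have "(\<Sum>f\<in>F. (cmod (c f))\<^sup>2 - 2 * Re (cnj (c f) * ip h f))
      = (\<Sum>f\<in>F. (cmod (ip h f - c f))\<^sup>2 - (cmod (ip h f))\<^sup>2)"
    by (intro sum.cong refl) (simp only: cmod_power2, simp add: power2_eq_square algebra_simps)
  finally show ?thesis by (simp add: S_def sum_subtractf)
qed

text \<open>Parseval's identity for \<open>rep w\<close>, whose coefficients have the moduli of the
  values \<open>f w\<close>. The argument works for any basis, hence for the chosen one.\<close>

lemma bergman_kernel_eq:
  assumes w: "w \<in> D"
  shows "bergman_kernel D w = nsq (rep w)"
proof -
  define B where "B = (SOME B. bergman_orthonormal_basis D B)"
  have B: "bergman_orthonormal_basis D B"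
    unfolding B_def by (rule someI_ex) (rule orthonormal_basis_exists)
  have BA: "B \<subseteq> \<A>" using B by (auto simp: bergman_orthonormal_basis_def)
  have val: "(cmod (ip (rep w) f))\<^sup>2 = (cmod (f w))\<^sup>2" if "f \<in> B" for f
    using reproducing[OF w, of f] ip_cnj[of "rep w" f] that BA by (metis complex_mod_cnj subsetD)
  have up: "(\<Sum>f\<in>F. (cmod (f w))\<^sup>2) \<le> nsq (rep w)" if F: "finite F" "F \<subseteq> B" for F
  proof -
    have "0 \<le> nsq (\<lambda>z. rep w z - (\<Sum>f\<in>F. ip (rep w) f * f z))" by (rule nsq_nonneg)
    also have "\<dots> = nsq (rep w) - (\<Sum>f\<in>F. (cmod (f w))\<^sup>2)"
      using orthonormal_expansion[OF B F rep_A[OF w], of "ip (rep w)"] F val by (simp add: subset_iff)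
    finally show ?thesis by simp
  qed
  have "((\<lambda>f. (cmod (f w))\<^sup>2) has_sum nsq (rep w)) B"
    unfolding has_sum_def
  proof (rule tendstoI)
    fix \<epsilon> :: real assume \<epsilon>: "0 < \<epsilon>"
    obtain F c where F: "finite F" "F \<subseteq> B" and "nsq (\<lambda>z. rep w z - (\<Sum>f\<in>F. c f * f z)) < \<epsilon>"
      using B rep_A[OF w] \<epsilon> unfolding bergman_orthonormal_basis_def bergman_nsq_def by meson
    then have "nsq (rep w) - (\<Sum>f\<in>F. (cmod (ip (rep w) f))\<^sup>2) + (\<Sum>f\<in>F. (cmod (ip (rep w) f - c f))\<^sup>2) < \<epsilon>"
      using orthonormal_expansion[OF B F rep_A[OF w], of c] by simp
    moreover have "0 \<le> (\<Sum>f\<in>F. (cmod (ip (rep w) f - c f))\<^sup>2)" by (intro sum_nonneg) auto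
    moreover have "(\<Sum>f\<in>F. (cmod (ip (rep w) f))\<^sup>2) = (\<Sum>f\<in>F. (cmod (f w))\<^sup>2)"
      using F val by (intro sum.cong) auto
    ultimately have lo: "nsq (rep w) - (\<Sum>f\<in>F. (cmod (f w))\<^sup>2) < \<epsilon>" by simp
    show "\<forall>\<^sub>F Y in finite_subsets_at_top B. dist (\<Sum>f\<in>Y. (cmod (f w))\<^sup>2) (nsq (rep w)) < \<epsilon>"
      unfolding eventually_finite_subsets_at_top
    proof (intro exI[of _ F] conjI allI impI F)
      fix Y assume Y: "finite Y \<and> F \<subseteq> Y \<and> Y \<subseteq> B"
      then have "(\<Sum>f\<in>F. (cmod (f w))\<^sup>2) \<le> (\<Sum>f\<in>Y. (cmod (f w))\<^sup>2)"
        by (intro sum_mono2) auto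
      with lo up[of Y] Y show "dist (\<Sum>f\<in>Y. (cmod (f w))\<^sup>2) (nsq (rep w)) < \<epsilon>"
        by (simp add: dist_real_def)
    qed
  qed
  then show ?thesis unfolding bergman_kernel_def B_def[symmetric] by (rule infsumI)
qed

text \<open>The value of \<open>rep w\<close> at \<open>w\<close> is its own squared norm, so the
  bound for point evaluations reads \<open>x\<^sup>2 \<le> C * x\<close>.\<close>

lemma rep_locally_bounded:
  assumes K: "compact K" "K \<subseteq> D"
  obtains C where "0 < C" "\<And>w. w \<in> K \<Longrightarrow> nsq (rep w) \<le> C"
proof -
  obtain C where C: "0 < C" "\<And>f z. f \<in> \<A> \<Longrightarrow> z \<in> K \<Longrightarrow> (cmod (f z))\<^sup>2 \<le> C * nsq f"
    using A_compact_bound[OF K] by blast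
  have "nsq (rep w) \<le> C" if w: "w \<in> K" for w
  proof -
    have wD: "w \<in> D" using w K by blast
    have "(nsq (rep w))\<^sup>2 = (cmod (rep w w))\<^sup>2"
      using ker_diag[OF wD] by (simp add: ker_def)
    also have "\<dots> \<le> C * nsq (rep w)" by (rule C(2)[OF rep_A[OF wD] w])
    finally show ?thesis using C(1) nsq_nonneg[of "rep w"]
      by (cases "nsq (rep w) = 0") (auto simp: power2_eq_square)
  qed
  with C(1) show thesis by (rule that)
qed

end

section \<open>Joint regularity of the reproducing kernel\<close>

lemma holomorphic_bounded_Lipschitz:
  assumes hol: "f holomorphic_on ball z (2 * r)" and r: "0 < r"
    and M: "\<And>x. x \<in> ball z (2 * r) \<Longrightarrow> cmod (f x) < M" and x: "x \<in> ball z r"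
  shows "cmod (f x - f z) \<le> M / r * cmod (x - z)"
proof (rule field_differentiable_bound[of "ball z r"])
  fix y assume y: "y \<in> ball z r"
  have sub: "cball y r \<subseteq> ball z (2 * r)"
  proof
    fix u assume "u \<in> cball y r"
    then show "u \<in> ball z (2 * r)" using y dist_triangle[of z u y] by auto
  qed
  have "y \<in> ball z (2 * r)" using y r by auto
  then show "(f has_field_derivative deriv f y) (at y within ball z r)"
    by (rule holomorphic_derivI[OF hol open_ball])
  have "cmod ((deriv ^^ 1) f y) \<le> fact 1 * M / r ^ 1"
    using sub r ball_subset_cball[of y r]
    by (intro Cauchy_higher_deriv_bound[where y = 0])
      (auto intro!: holomorphic_on_subset[OF hol] holomorphic_on_imp_continuous_on[OF holomorphic_on_subset[OF hol]] M)
  then show "cmod (deriv f y) \<le> M / r" by simp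
qed (use x r in auto)

text \<open>By Cauchy's estimate a locally bounded function is Lipschitz in each variable, with a
  constant uniform in the other one; the two bounds add up to joint continuity.\<close>

lemma sesqui_locally_boundedI:
  assumes U: "open U"
    and hol: "\<And>w. w \<in> U \<Longrightarrow> (\<lambda>z. \<Phi> z w) holomorphic_on U" "\<And>w. w \<in> U \<Longrightarrow> (\<lambda>z. adj \<Phi> z w) holomorphic_on U"
    and bd: "\<And>K. compact K \<Longrightarrow> K \<subseteq> U \<Longrightarrow> \<exists>M. \<forall>z\<in>K. \<forall>w\<in>K. cmod (\<Phi> z w) < M"
  shows "sesquiholomorphic_on \<Phi> U"
  unfolding sesquiholomorphic_on_def
proof (intro conjI ballI hol)
  show "continuous_on (U \<times> U) (\<lambda>(z, w). \<Phi> z w)"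
  proof (rule continuous_at_imp_continuous_on, clarify)
    fix z0 w0 assume z0: "z0 \<in> U" and w0: "w0 \<in> U"
    obtain e1 where e1: "0 < e1" "cball z0 e1 \<subseteq> U" using U z0 open_contains_cball by blast
    obtain e2 where e2: "0 < e2" "cball w0 e2 \<subseteq> U" using U w0 open_contains_cball by blast
    define r where "r = min e1 e2 / 2"
    have r: "0 < r" "cball z0 (2 * r) \<subseteq> U" "cball w0 (2 * r) \<subseteq> U" using e1 e2 by (auto simp: r_def)
    obtain M where M: "\<And>z w. z \<in> cball z0 (2 * r) \<union> cball w0 (2 * r) \<Longrightarrow> w \<in> cball z0 (2 * r) \<union> cball w0 (2 * r)
         \<Longrightarrow> cmod (\<Phi> z w) < M"
      using bd[of "cball z0 (2 * r) \<union> cball w0 (2 * r)"] r by (metis Un_subset_iff compact_Un compact_cball)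
    have est: "cmod (\<Phi> z w - \<Phi> z0 w0) \<le> M / r * cmod (z - z0) + M / r * cmod (w - w0)"
      if z: "z \<in> ball z0 r" and w: "w \<in> ball w0 r" for z w
    proof -
      have wU: "w \<in> U" "w \<in> cball w0 (2 * r)" using w r by (auto simp: subset_iff)
      have "cmod (\<Phi> z w - \<Phi> z0 w) \<le> M / r * cmod (z - z0)"
        using holomorphic_bounded_Lipschitz[of "\<lambda>z. \<Phi> z w" z0 r M z] r z wU M
          holomorphic_on_subset[OF hol(1)[OF wU(1)], of "ball z0 (2 * r)"] ball_subset_cball[of z0 "2 * r"]
        by auto
      moreover have "cmod (adj \<Phi> w z0 - adj \<Phi> w0 z0) \<le> M / r * cmod (w - w0)"
      proof (rule holomorphic_bounded_Lipschitz)
        have "ball w0 (2 * r) \<subseteq> U" using r ball_subset_cball[of w0 "2 * r"] by blast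
        then show "(\<lambda>w. adj \<Phi> w z0) holomorphic_on ball w0 (2 * r)"
          by (rule holomorphic_on_subset[OF hol(2)[OF z0]])
      qed (use r w M in \<open>auto simp: adj_def\<close>)
      then have "cmod (\<Phi> z0 w - \<Phi> z0 w0) \<le> M / r * cmod (w - w0)"
        unfolding adj_def by (metis complex_cnj_diff complex_mod_cnj)
      ultimately show ?thesis
        using norm_triangle_ineq[of "\<Phi> z w - \<Phi> z0 w" "\<Phi> z0 w - \<Phi> z0 w0"] by simp
    qed
    have "((\<lambda>x. M / r * cmod (fst x - z0) + M / r * cmod (snd x - w0)) \<longlongrightarrow> 
        M / r * cmod (fst (z0, w0) - z0) + M / r * cmod (snd (z0, w0) - w0)) (at (z0, w0))"
      by (intro tendsto_intros)
    then have lim: "((\<lambda>x. M / r * cmod (fst x - z0) + M / r * cmod (snd x - w0)) \<longlongrightarrow> 0) (at (z0, w0))"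
      by simp
    have "\<forall>\<^sub>F x in at (z0, w0). x \<in> ball z0 r \<times> ball w0 r"
      using r by (intro eventually_at_in_open') (auto simp: open_Times)
    then have "\<forall>\<^sub>F x in at (z0, w0). norm ((\<lambda>(z, w). \<Phi> z w) x - \<Phi> z0 w0) \<le> M / r * cmod (fst x - z0) + M / r * cmod (snd x - w0)"
      by eventually_elim (use est in auto)
    then have "((\<lambda>x. (\<lambda>(z, w). \<Phi> z w) x - \<Phi> z0 w0) \<longlongrightarrow> 0) (at (z0, w0))"
      by (rule Lim_null_comparison[OF _ lim])
    then show "isCont (\<lambda>(z, w). \<Phi> z w) (z0, w0)"
      unfolding isCont_def by (subst Lim_null) simp
  qed
qed

context planar_domain
begin

lemma adj_ker: "z \<in> D \<Longrightarrow> w \<in> D \<Longrightarrow> adj ker z w = ker z w"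
  by (simp add: adj_def ker_cnj)

lemma sesqui_ker: "sesquiholomorphic_on ker D"
proof (rule sesqui_locally_boundedI[OF open_D])
  show 1: "(\<lambda>z. ker z w) holomorphic_on D" if "w \<in> D" for w
    using A_hol[OF rep_A[OF that]] by (simp add: ker_def)
  show "(\<lambda>z. adj ker z w) holomorphic_on D" if "w \<in> D" for w
    by (rule holomorphic_transform[OF 1[OF that]]) (simp add: adj_ker that)
  fix K assume K: "compact K" "K \<subseteq> D"
  obtain C where C: "0 < C" "\<And>w. w \<in> K \<Longrightarrow> nsq (rep w) \<le> C" using rep_locally_bounded[OF K] by blast
  have "cmod (ker z w) < C + 1" if "z \<in> K" "w \<in> K" for z w
  proof -
    have "(cmod (ker z w))\<^sup>2 \<le> nsq (rep z) * nsq (rep w)"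
      using that K by (intro ker_Cauchy_Schwarz) auto
    also have "\<dots> \<le> C * C" using C that nsq_nonneg by (intro mult_mono) auto
    finally have "cmod (ker z w) \<le> C" using C(1) by (simp add: power2_eq_square abs_le_square_iff flip: power2_eq_square)
    then show ?thesis by simp
  qed
  then show "\<exists>M. \<forall>z\<in>K. \<forall>w\<in>K. cmod (ker z w) < M" by blast
qed

end

subsection \<open>The Liouville equation\<close>

lemma dz_eqI: "((\<lambda>x. \<Phi> x w) has_field_derivative d) (at z) \<Longrightarrow> dz \<Phi> z w = d"
  by (simp add: dz_def DERIV_imp_deriv)

lemma dwb_eqI: "((\<lambda>x. cnj (\<Phi> z x)) has_field_derivative cnj d) (at w) \<Longrightarrow> dwb \<Phi> z w = d"
  by (simp add: dwb_eq DERIV_imp_deriv)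

lemma dz_cong:
  assumes "open U" "z \<in> U" "w \<in> U" "\<And>x. x \<in> U \<Longrightarrow> \<Phi> x w = \<Psi> x w"
  shows "dz \<Phi> z w = dz \<Psi> z w"
  unfolding dz_def
  using eventually_nhds_in_open[OF assms(1,2)] by (intro deriv_cong_ev) (auto elim!: eventually_mono simp: assms(4))

lemma dwb_cong:
  assumes "open U" "z \<in> U" "w \<in> U" "\<And>x. x \<in> U \<Longrightarrow> \<Phi> z x = \<Psi> z x"
  shows "dwb \<Phi> z w = dwb \<Psi> z w"
  using dz_cong[of U w z "adj \<Phi>" "adj \<Psi>"] assms by (simp add: dwb_def adj_def[abs_def])

lemma dwb_left: "dwb (\<lambda>z w. f z) z w = 0"
  by (simp add: dwb_eq)

lemma dz_right: "dz (\<lambda>z w. g w) z w = 0"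
  by (simp add: dz_def)

context
  fixes U :: "complex set"
  assumes U: "open U"
begin

lemma dz_diff:
  assumes "sesquiholomorphic_on \<Phi> U" "sesquiholomorphic_on \<Psi> U" "z \<in> U" "w \<in> U"
  shows "dz (\<lambda>z w. \<Phi> z w - \<Psi> z w) z w = dz \<Phi> z w - dz \<Psi> z w"
  by (intro dz_eqI derivative_intros sesqui_has_dz[OF _ U] assms)

lemma dz_mult:
  assumes "sesquiholomorphic_on \<Phi> U" "sesquiholomorphic_on \<Psi> U" "z \<in> U" "w \<in> U"
  shows "dz (\<lambda>z w. \<Phi> z w * \<Psi> z w) z w = dz \<Phi> z w * \<Psi> z w + \<Phi> z w * dz \<Psi> z w"
  by (rule dz_eqI) (auto intro!: derivative_eq_intros sesqui_has_dz[OF _ U] assms)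

lemma dwb_diff:
  assumes "sesquiholomorphic_on \<Phi> U" "sesquiholomorphic_on \<Psi> U" "z \<in> U" "w \<in> U"
  shows "dwb (\<lambda>z w. \<Phi> z w - \<Psi> z w) z w = dwb \<Phi> z w - dwb \<Psi> z w"
proof (rule dwb_eqI)
  have "((\<lambda>x. cnj (\<Phi> z x) - cnj (\<Psi> z x)) has_field_derivative cnj (dwb \<Phi> z w) - cnj (dwb \<Psi> z w)) (at w)"
    by (intro derivative_intros sesqui_has_dwb[OF _ U] assms)
  then show "((\<lambda>x. cnj (\<Phi> z x - \<Psi> z x)) has_field_derivative cnj (dwb \<Phi> z w - dwb \<Psi> z w)) (at w)"
    by simp
qed

lemma dwb_mult:
  assumes "sesquiholomorphic_on \<Phi> U" "sesquiholomorphic_on \<Psi> U" "z \<in> U" "w \<in> U"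
  shows "dwb (\<lambda>z w. \<Phi> z w * \<Psi> z w) z w = dwb \<Phi> z w * \<Psi> z w + \<Phi> z w * dwb \<Psi> z w"
proof (rule dwb_eqI)
  have "((\<lambda>x. cnj (\<Phi> z x) * cnj (\<Psi> z x)) has_field_derivative
     cnj (dwb \<Phi> z w) * cnj (\<Psi> z w) + cnj (\<Phi> z w) * cnj (dwb \<Psi> z w)) (at w)"
    by (auto intro!: derivative_eq_intros sesqui_has_dwb[OF _ U] assms)
  then show "((\<lambda>x. cnj (\<Phi> z x * \<Psi> z x)) has_field_derivative
     cnj (dwb \<Phi> z w * \<Psi> z w + \<Phi> z w * dwb \<Psi> z w)) (at w)"
    by simp
qed

lemma dz_exp:
  assumes "sesquiholomorphic_on \<Phi> U" "z \<in> U" "w \<in> U"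
  shows "dz (\<lambda>z w. exp (\<Phi> z w)) z w = exp (\<Phi> z w) * dz \<Phi> z w"
  by (rule dz_eqI) (auto intro!: derivative_eq_intros sesqui_has_dz[OF _ U] assms)

text \<open>Conjugation exchanges the two derivatives, and they commute. On the diagonal the
  symmetry says that the mixed derivative is real, so the real part taken in
  \<open>wirtinger_z_zbar\<close> loses nothing.\<close>

lemma adj_mixed:
  assumes \<Phi>: "sesquiholomorphic_on \<Phi> U" and herm: "\<And>z w. z \<in> U \<Longrightarrow> w \<in> U \<Longrightarrow> adj \<Phi> z w = \<Phi> z w"
    and z: "z \<in> U" "w \<in> U"
  shows "adj (dz (dwb \<Phi>)) z w = dz (dwb \<Phi>) z w"
proof -
  have "adj (dz (dwb \<Phi>)) z w = dwb (dz (adj \<Phi>)) z w" by (simp add: adj_dz adj_dwb)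
  also have "\<dots> = dwb (dz \<Phi>) z w"
    by (rule dwb_cong[OF U z]) (rule dz_cong[OF U z(1)], auto simp: herm)
  also have "\<dots> = dz (dwb \<Phi>) z w" by (rule dz_dwb_commute[OF \<Phi> U z, symmetric])
  finally show ?thesis .
qed

lemma dz_zero_constant:
  assumes \<Phi>: "sesquiholomorphic_on \<Phi> U" "convex U" and 0: "\<And>z. z \<in> U \<Longrightarrow> dz \<Phi> z w = 0"
    and z: "z \<in> U" "z' \<in> U" "w \<in> U"
  shows "\<Phi> z w = \<Phi> z' w"
proof -
  have "\<exists>c. \<forall>x\<in>U. \<Phi> x w = c"
    by (rule has_field_derivative_zero_constant[OF \<Phi>(2)])
      (use sesqui_has_dz[OF \<Phi>(1) U _ z(3)] 0 in \<open>auto intro: has_field_derivative_at_within\<close>)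
  then show ?thesis using z by metis
qed

lemma dwb_zero_constant:
  assumes \<Phi>: "sesquiholomorphic_on \<Phi> U" "convex U" and 0: "\<And>w. w \<in> U \<Longrightarrow> dwb \<Phi> z w = 0"
    and z: "z \<in> U" "w \<in> U" "w' \<in> U"
  shows "\<Phi> z w = \<Phi> z w'"
  using dz_zero_constant[OF sesqui_adj[OF \<Phi>(1)] \<Phi>(2), of z w w'] 0 z
  by (simp add: adj_def[of \<Phi>] adj_dwb[symmetric]) (simp add: adj_def)

text \<open>\<open>dwb Y\<close> does not depend on the first variable, so
  \<open>Y z w - Y p w\<close> does not depend on \<open>w\<close>.\<close>

lemma mixed_zero_split:
  assumes Y: "sesquiholomorphic_on Y U" "convex U" and 0: "\<And>z w. z \<in> U \<Longrightarrow> w \<in> U \<Longrightarrow> dz (dwb Y) z w = 0"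
    and z: "z \<in> U" "w \<in> U" "p \<in> U"
  shows "Y z w = Y z p + Y p w - Y p p"
proof -
  have c: "dwb Y x v = dwb Y p v" if "x \<in> U" "v \<in> U" for x v
    by (rule dz_zero_constant[OF sesqui_dwb[OF Y(1) U] Y(2)]) (use 0 that z in auto)
  have s: "sesquiholomorphic_on (\<lambda>x v. Y p v) U"
    using Y(1) z(3) sesqui_right[of "\<lambda>v. cnj (Y p v)" U] by (simp add: sesquiholomorphic_on_def adj_def)
  have "dwb (\<lambda>x v. Y x v - Y p v) x v = 0" if "x \<in> U" "v \<in> U" for x v
    using dwb_diff[OF Y(1) s that] c[OF that] by (simp add: dwb_eq)
  then have "Y z w - Y p w = Y z p - Y p p"
    using dwb_zero_constant[OF sesqui_diff[OF Y(1) s] Y(2), of z w p] z by simp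
  then show ?thesis by (simp add: algebra_simps)
qed

text \<open>With \<open>q = exp (- L / 2)\<close> the Liouville equation says that the Wronskian of \<open>q\<close> and
  \<open>m = q\<^sub>z / \<alpha>\<close> in the second variable depends on that variable only. Differentiating once more,
  \<open>m\<^sub>z / q\<close> is independent of the second variable, and it vanishes at \<open>p\<close>.\<close>

lemma Liouville_Goursat:
  assumes cU: "convex U" and p: "p \<in> U" and L: "sesquiholomorphic_on L U"
    and Lp: "\<And>z. z \<in> U \<Longrightarrow> L z p = 0" "\<And>w. w \<in> U \<Longrightarrow> L p w = 0"
    and \<alpha>: "\<alpha> holomorphic_on U" "\<And>z. z \<in> U \<Longrightarrow> \<alpha> z \<noteq> 0"
    and eq: "\<And>z w. z \<in> U \<Longrightarrow> w \<in> U \<Longrightarrow> dz (dwb L) z w = exp (L z w) * \<alpha> z * \<beta> w"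
  obtains A c where "A holomorphic_on U" "A p = 0" "\<And>z. z \<in> U \<Longrightarrow> deriv A z = \<alpha> z"
    "\<And>z w. z \<in> U \<Longrightarrow> w \<in> U \<Longrightarrow> exp (- L z w / 2) = 1 + c w * A z"
proof -
  define q where "q z w = exp (- (1/2) * L z w)" for z w
  have L2: "sesquiholomorphic_on (\<lambda>z w. - (1/2) * L z w) U"
    by (intro sesqui_mult L sesqui_const)
  have sq: "sesquiholomorphic_on q U"
    unfolding q_def by (rule sesqui_exp[OF L2])
  have q0: "q z w \<noteq> 0" for z w by (simp add: q_def)
  have qp: "q z p = 1" "q p z = 1" if "z \<in> U" for z using Lp that by (simp_all add: q_def)
  have cL2: "dz (\<lambda>z w. - (1/2) * L z w) z w = - (1/2) * dz L z w"
     "dwb (\<lambda>z w. - (1/2) * L z w) z w = - (1/2) * dwb L z w" if "z \<in> U" "w \<in> U" for z w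
    using dz_mult[OF sesqui_const L that, of "- (1/2)"] dwb_mult[OF sesqui_const L that, of "- (1/2)"]
    by (simp_all add: dz_right dwb_left)
  have qz: "dz q z w = - (1/2) * dz L z w * q z w" if "z \<in> U" "w \<in> U" for z w
    using dz_exp[OF L2 that] cL2[OF that] by (simp add: q_def[abs_def])
  have sdL: "sesquiholomorphic_on (dz L) U" and sdq: "sesquiholomorphic_on (dz q) U"
    using sesqui_dz[OF _ U] L sq by auto
  define i\<alpha> where "i\<alpha> z = inverse (\<alpha> z)" for z
  have "i\<alpha> holomorphic_on U" unfolding i\<alpha>_def using \<alpha> by (intro holomorphic_intros) auto
  then have si: "sesquiholomorphic_on (\<lambda>z w. i\<alpha> z) U" by (rule sesqui_left)
  have s\<alpha>: "sesquiholomorphic_on (\<lambda>z w. \<alpha> z) U" using \<alpha> by (intro sesqui_left)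
  define m where "m z w = i\<alpha> z * dz q z w" for z w
  have sm: "sesquiholomorphic_on m U" unfolding m_def by (intro sesqui_mult si sdq)
  have \<alpha>m: "dz q z w = \<alpha> z * m z w" if "z \<in> U" for z w using \<alpha>(2)[OF that] by (simp add: m_def i\<alpha>_def)
  have dLb: "dwb (dz L) z w = exp (L z w) * \<alpha> z * \<beta> w" if "z \<in> U" "w \<in> U" for z w
    using eq[OF that] dz_dwb_commute[OF L U that] by simp
  have dqb: "dwb (dz q) z w = - (1/2) * (dwb (dz L) z w * q z w + dz L z w * dwb q z w)"
    if "z \<in> U" "w \<in> U" for z w
  proof -
    have "dwb (dz q) z w = dwb (\<lambda>z w. - (1/2) * (dz L z w * q z w)) z w"
      by (rule dwb_cong[OF U that]) (simp add: qz that)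
    also have "\<dots> = - (1/2) * dwb (\<lambda>z w. dz L z w * q z w) z w"
      using dwb_mult[OF sesqui_const sesqui_mult[OF sdL sq] that, of "- (1/2)"] by (simp add: dwb_left)
    finally show ?thesis by (simp add: dwb_mult[OF sdL sq that])
  qed
  have mb: "dwb m z w = i\<alpha> z * dwb (dz q) z w" if "z \<in> U" "w \<in> U" for z w
    using dwb_mult[OF si sdq that] by (simp add: m_def[abs_def] dwb_left)
  \<comment> \<open>The term with \<open>dz L * dwb q\<close> cancels in the Wronskian, and
    \<open>exp L * q\<^sup>2 = 1\<close> turns the right side of the Liouville equation into a
    function of \<open>w\<close>.\<close>
  have wr: "q z w * dwb m z w - m z w * dwb q z w = - (1/2) * \<beta> w" if "z \<in> U" "w \<in> U" for z w
  proof -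
    have e: "exp (L z w) * q z w * q z w = 1"
      by (simp add: q_def mult_exp_exp)
    have "q z w * dwb m z w - m z w * dwb q z w = - (1/2) * (i\<alpha> z * \<alpha> z) * \<beta> w * (exp (L z w) * q z w * q z w)"
      unfolding mb[OF that] dqb[OF that] dLb[OF that] m_def qz[OF that] by (simp add: algebra_simps)
    then show ?thesis using \<alpha>(2)[OF that(1)] by (simp add: e i\<alpha>_def)
  qed
  have sqb: "sesquiholomorphic_on (dwb q) U" and smb: "sesquiholomorphic_on (dwb m) U"
    and smz: "sesquiholomorphic_on (dz m) U"
    using sesqui_dwb[OF _ U] sesqui_dz[OF _ U] sq sm by auto
  \<comment> \<open>Differentiating the Wronskian in \<open>z\<close>, the terms with first
    derivatives of \<open>q\<close> cancel because \<open>dz q = \<alpha> * m\<close>. What remains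
    says that \<open>dz m / q\<close> has zero derivative in the conjugate of
    \<open>w\<close>.\<close>
  have key: "q z w * dwb (dz m) z w = dz m z w * dwb q z w" if "z \<in> U" "w \<in> U" for z w
  proof -
    have "dz (\<lambda>z w. q z w * dwb m z w - m z w * dwb q z w) z w = dz (\<lambda>z w. - (1/2) * \<beta> w) z w"
      by (rule dz_cong[OF U that]) (simp add: wr that)
    then have "dz (\<lambda>z w. q z w * dwb m z w - m z w * dwb q z w) z w = 0" by (simp add: dz_right)
    then have "dz q z w * dwb m z w + q z w * dz (dwb m) z w - (dz m z w * dwb q z w + m z w * dz (dwb q) z w) = 0"
      using dz_diff[OF sesqui_mult[OF sq smb] sesqui_mult[OF sm sqb] that] dz_mult[OF sq smb that] dz_mult[OF sm sqb that]
      by simp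
    moreover have "dz (dwb q) z w = \<alpha> z * dwb m z w"
      using dz_dwb_commute[OF sq U that] mb[OF that] \<alpha>(2)[OF that(1)] by (simp add: i\<alpha>_def)
    ultimately show ?thesis
      using \<alpha>m[OF that(1)] dz_dwb_commute[OF sm U that] by (simp add: algebra_simps)
  qed
  define iq where "iq z w = inverse (q z w)" for z w
  have siq: "sesquiholomorphic_on iq U" unfolding iq_def by (rule sesqui_inverse[OF sq q0])
  have iqb: "dwb iq z w = - dwb q z w / (q z w)\<^sup>2" if "z \<in> U" "w \<in> U" for z w
  proof -
    have "dwb (\<lambda>z w. q z w * iq z w) z w = 0"
      using q0 by (simp add: iq_def dwb_eq)
    then have "dwb q z w * iq z w + q z w * dwb iq z w = 0"
      using dwb_mult[OF sq siq that] by simp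
    then have "q z w * dwb iq z w = - dwb q z w * iq z w" by (simp add: eq_neg_iff_add_eq_0 add.commute)
    then have "dwb iq z w = - dwb q z w * iq z w / q z w" using q0[of z w] by (simp add: field_simps)
    then show ?thesis using q0 by (simp add: iq_def power2_eq_square field_simps)
  qed
  have "dwb (\<lambda>z w. dz m z w * iq z w) z w = 0" if "z \<in> U" "w \<in> U" for z w
    using dwb_mult[OF smz siq that] key[OF that] iqb[OF that] q0[of z w]
    by (simp add: iq_def power2_eq_square field_simps)
  then have ratio: "dz m z w * iq z w = dz m z p * iq z p" if "z \<in> U" "w \<in> U" for z w
    using dwb_zero_constant[OF sesqui_mult[OF smz siq] cU, of z w p] that p by blast
  \<comment> \<open>\<open>q\<close> is identically one on the line \<open>w = p\<close>, so
    \<open>m\<close> and \<open>dz m\<close> vanish there; as the ratio does not depend on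
    \<open>w\<close>, \<open>dz m\<close> vanishes everywhere.\<close>
  have mp: "m z p = 0" if "z \<in> U" for z
  proof -
    have "dz q z p = dz (\<lambda>z w. 1) z p" by (rule dz_cong[OF U that p]) (simp add: qp)
    then show ?thesis by (simp add: m_def dz_right)
  qed
  have "dz m z p = 0" if "z \<in> U" for z
  proof -
    have "dz m z p = dz (\<lambda>z w. 0) z p" by (rule dz_cong[OF U that p]) (simp add: mp)
    then show ?thesis by (simp add: dz_right)
  qed
  then have "dz m z w = 0" if "z \<in> U" "w \<in> U" for z w
    using ratio[OF that] that q0[of z w] by (simp add: iq_def)
  then have mc: "m z w = m p w" if "z \<in> U" "w \<in> U" for z w
    using dz_zero_constant[OF sm cU, of w z p] that p by blast
  obtain A0 where A0: "\<And>x. x \<in> U \<Longrightarrow> (A0 has_field_derivative \<alpha> x) (at x)"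
    using holomorphic_convex_primitive'[OF cU U \<alpha>(1)] at_within_open[OF _ U] by metis
  \<comment> \<open>With \<open>m\<close> independent of \<open>z\<close>, the relation
    \<open>dz q = \<alpha> * m\<close> is integrated by a primitive of \<open>\<alpha>\<close> that
    vanishes at \<open>p\<close>.\<close>
  define A where "A z = A0 z - A0 p" for z
  have A: "(A has_field_derivative \<alpha> x) (at x)" if "x \<in> U" for x
    unfolding A_def using A0[OF that] by (auto intro!: derivative_eq_intros)
  have Ahol: "A holomorphic_on U" using A U by (auto simp: holomorphic_on_open)
  have qA: "q z w = 1 + m p w * A z" if "z \<in> U" "w \<in> U" for z w
  proof -
    have s: "sesquiholomorphic_on (\<lambda>z v. q z v - m p w * A z) U"
      by (intro sesqui_diff sq sesqui_left holomorphic_intros Ahol)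
    have "dz (\<lambda>z v. q z v - m p w * A z) x w = 0" if x: "x \<in> U" for x
    proof (rule dz_eqI)
      have "((\<lambda>x. q x w - m p w * A x) has_field_derivative dz q x w - m p w * \<alpha> x) (at x)"
        by (auto intro!: derivative_eq_intros sesqui_has_dz[OF sq U x \<open>w \<in> U\<close>] A x)
      then show "((\<lambda>x. q x w - m p w * A x) has_field_derivative 0) (at x)"
        using \<alpha>m[OF x] mc[OF x \<open>w \<in> U\<close>] by simp
    qed
    then have "q z w - m p w * A z = q p w - m p w * A p"
      using dz_zero_constant[OF s cU, of w z p] that p by blast
    then show ?thesis using qp[OF that(2)] by (simp add: A_def algebra_simps)
  qed
  show thesis
  proof (rule that[OF Ahol])
    show "deriv A z = \<alpha> z" if "z \<in> U" for z using A[OF that] by (rule DERIV_imp_deriv)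
    show "exp (- L z w / 2) = 1 + m p w * A z" if "z \<in> U" "w \<in> U" for z w
      using qA[OF that] by (simp add: q_def)
  qed (simp add: A_def)
qed

end

section \<open>From constant curvature to the local form of the kernel\<close>

locale liouville_domain = planar_domain +
  assumes metric: "has_bergman_metric D"
    and curvature: "\<And>z. z \<in> D \<Longrightarrow> bergman_curvature D z = - 2"
begin

lemma ker_diag_pos: "z \<in> D \<Longrightarrow> 0 < bergman_kernel D z"
  using metric by (simp add: has_bergman_metric_def)

lemma ker_diag_kernel: "z \<in> D \<Longrightarrow> ker z z = of_real (bergman_kernel D z)"
  by (simp add: ker_diag bergman_kernel_eq)

lemma ker_diag_ne: "z \<in> D \<Longrightarrow> ker z z \<noteq> 0"
  using ker_diag_pos[of z] by (simp add: ker_diag_kernel)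

text \<open>On such a ball the principal logarithm is holomorphic on the values of the function and
  commutes with conjugation. This is applied to the kernel and to the polarized metric.\<close>

lemma sesqui_right_half_ball:
  assumes "sesquiholomorphic_on \<Phi> V" "open V" "p \<in> V" "0 < Re (\<Phi> p p)"
  obtains r where "0 < r" "ball p r \<subseteq> V" "\<And>z w. z \<in> ball p r \<Longrightarrow> w \<in> ball p r \<Longrightarrow> 0 < Re (\<Phi> z w)"
proof -
  have "isCont (\<lambda>(z, w). \<Phi> z w) (p, p)"
    using assms by (auto simp: sesquiholomorphic_on_def continuous_on_eq_continuous_at open_Times)
  then have "isCont (\<lambda>x. Re ((\<lambda>(z, w). \<Phi> z w) x)) (p, p)" by (rule continuous_Re)
  then have "\<forall>\<^sub>F x in nhds (p, p). 0 < Re ((\<lambda>(z, w). \<Phi> z w) x)"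
    using assms(4) unfolding eventually_nhds_conv_at
    by (auto simp: isCont_def dest!: order_tendstoD(1)[where a = 0])
  then have "\<forall>\<^sub>F (z, w) in nhds p \<times>\<^sub>F nhds p. 0 < Re (\<Phi> z w)"
    by (simp add: nhds_prod case_prod_unfold)
  then obtain P where P: "eventually P (nhds p)" "\<And>z w. P z \<Longrightarrow> P w \<Longrightarrow> 0 < Re (\<Phi> z w)"
    unfolding eventually_prod_same by auto
  moreover have "\<forall>\<^sub>F z in nhds p. z \<in> V" using assms by (intro eventually_nhds_in_open)
  ultimately have "\<forall>\<^sub>F z in nhds p. P z \<and> z \<in> V" by (intro eventually_conj)
  then obtain r where "0 < r" "\<And>z. dist z p < r \<Longrightarrow> P z \<and> z \<in> V" unfolding eventually_nhds_metric by auto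
  then show thesis using P(2) by (intro that[of r]) (auto simp: dist_commute)
qed

text \<open>The Goursat solution gives \<open>exp (- L / 2) = 1 + c(w) A(z)\<close>. Hermitian
  symmetry forces \<open>c\<close> to be a real multiple \<open>\<kappa>\<close> of the conjugate of
  \<open>A\<close>; Cauchy-Schwarz excludes \<open>\<kappa> > 0\<close>, and positivity of the
  metric excludes \<open>\<kappa> = 0\<close>. The negative sign is what puts the unit disc into
  play, instead of the sphere.\<close>

lemma local_form:
  assumes p: "p \<in> D"
  obtains r F where "0 < r" "ball p r \<subseteq> D" "F holomorphic_on ball p r" "F p = 0" "deriv F p \<noteq> 0"
    "\<And>z w. z \<in> ball p r \<Longrightarrow> w \<in> ball p r \<Longrightarrow>
       ker z w * ker p p * (1 - F z * cnj (F w))\<^sup>2 = ker z p * ker p w"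
proof -
  obtain r0 where r0: "0 < r0" "ball p r0 \<subseteq> D"
    and K0: "\<And>z w. z \<in> ball p r0 \<Longrightarrow> w \<in> ball p r0 \<Longrightarrow> 0 < Re (ker z w)"
    using sesqui_right_half_ball[OF sesqui_ker open_D p] ker_diag_pos[OF p] p by (auto simp: ker_diag_kernel)
  define U0 where "U0 = ball p r0"
  have U0: "open U0" "p \<in> U0" "U0 \<subseteq> D" using r0 by (auto simp: U0_def)
  define lk where "lk z w = Ln (ker z w)" for z w
  have slk: "sesquiholomorphic_on lk U0"
    unfolding lk_def by (rule sesqui_Ln[OF sesqui_subset[OF sesqui_ker U0(3)]]) (auto simp: U0_def K0)
  have explk: "exp (lk z w) = ker z w" if "z \<in> U0" "w \<in> U0" for z w
    using K0[of z w] that by (auto simp: lk_def U0_def intro!: exp_Ln)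
  have alk: "adj lk z w = lk z w" if "z \<in> U0" "w \<in> U0" for z w
  proof -
    have "cnj (Ln (ker w z)) = Ln (cnj (ker w z))"
      using K0[of w z] that by (intro cnj_Ln) (auto simp: U0_def complex_nonpos_Reals_iff)
    moreover have "z \<in> D" "w \<in> D" using that U0(3) by auto
    ultimately show ?thesis by (simp add: adj_def lk_def ker_cnj)
  qed
  define G where "G = dz (dwb lk)"
  have sG: "sesquiholomorphic_on G U0" unfolding G_def using slk U0 by (intro sesqui_dz sesqui_dwb)
  have aG: "adj G z w = G z w" if "z \<in> U0" "w \<in> U0" for z w
    unfolding G_def by (rule adj_mixed[OF U0(1) slk alk that])
  have real_diag: "\<Phi> z z = of_real (Re (\<Phi> z z))" if "adj \<Phi> z z = \<Phi> z z" for \<Phi> z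
    using that unfolding adj_def by (metis Reals_cnj_iff of_real_Re)
  have Gd: "G z z = of_real (bergman_metric D z)" if "z \<in> U0" for z
  proof -
    have "wirtinger_z_zbar (\<lambda>z. ln (bergman_kernel D z)) z = Re (dz (dwb lk) z z)"
    proof (rule wirtinger_z_zbar_diagonal[OF slk U0(1) that])
      fix x assume "x \<in> U0"
      then have "x \<in> D" using U0 by blast
      then show "of_real (ln (bergman_kernel D x)) = lk x x"
        using ker_diag_pos by (simp add: lk_def ker_diag_kernel Ln_of_real)
    qed
    then show ?thesis using real_diag[of G z] aG that by (simp add: bergman_metric_def G_def)
  qed
  have bm: "0 < bergman_metric D z" if "z \<in> D" for z using metric that by (simp add: has_bergman_metric_def)
  obtain r where r: "0 < r" "ball p r \<subseteq> U0"
    and G0: "\<And>z w. z \<in> ball p r \<Longrightarrow> w \<in> ball p r \<Longrightarrow> 0 < Re (G z w)"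
    using sesqui_right_half_ball[OF sG U0(1,2)] Gd[OF U0(2)] bm[OF p] by auto
  define U where "U = ball p r"
  have U: "open U" "p \<in> U" "U \<subseteq> U0" "convex U" "U \<subseteq> D" using r U0 by (auto simp: U_def)
  define lg where "lg z w = Ln (G z w)" for z w
  have slg: "sesquiholomorphic_on lg U"
    unfolding lg_def by (rule sesqui_Ln[OF sesqui_subset[OF sG U(3)]]) (auto simp: U_def G0)
  have slk': "sesquiholomorphic_on lk U" using slk U(3) by (rule sesqui_subset)
  have explg: "exp (lg z w) = G z w" if "z \<in> U" "w \<in> U" for z w
    using G0[of z w] that by (auto simp: lg_def U_def intro!: exp_Ln)
  have alg: "adj lg z w = lg z w" if "z \<in> U" "w \<in> U" for z w
  proof -
    have "cnj (Ln (G w z)) = Ln (cnj (G w z))"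
      using G0[of w z] that by (intro cnj_Ln) (auto simp: U_def complex_nonpos_Reals_iff)
    moreover have "cnj (G w z) = G z w" using aG[of z w] that U(3) by (auto simp: adj_def)
    ultimately show ?thesis by (simp add: adj_def lg_def)
  qed
  \<comment> \<open>The curvature equation says that \<open>H\<close> vanishes on the diagonal;
    polarization extends this to all pairs.\<close>
  define H where "H z w = dz (dwb lg) z w - dz (dwb lk) z w" for z w
  have sH: "sesquiholomorphic_on H U"
    unfolding H_def using slg slk' U(1) by (intro sesqui_diff sesqui_dz sesqui_dwb)
  have Hd: "H z z = 0" if z: "z \<in> U" for z
  proof -
    have zD: "z \<in> D" using z U by blast
    have "wirtinger_z_zbar (\<lambda>z. ln (bergman_metric D z)) z = Re (dz (dwb lg) z z)"
    proof (rule wirtinger_z_zbar_diagonal[OF slg U(1) z])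
      fix x assume "x \<in> U"
      then have "x \<in> D" "x \<in> U0" using U by blast+
      then show "of_real (ln (bergman_metric D x)) = lg x x"
        using bm by (simp add: lg_def Gd Ln_of_real)
    qed
    moreover have "wirtinger_z_zbar (\<lambda>z. ln (bergman_metric D z)) z = bergman_metric D z"
      using curvature[OF zD] bm[OF zD] by (simp add: bergman_curvature_def field_simps)
    moreover have "dz (dwb lg) z z = of_real (Re (dz (dwb lg) z z))"
      by (rule real_diag) (rule adj_mixed[OF U(1) slg alg z z])
    ultimately have "dz (dwb lg) z z = of_real (bergman_metric D z)" by simp
    then show ?thesis using Gd z U(3) by (auto simp: H_def G_def)
  qed
  have H0: "H z w = 0" if "z \<in> U" "w \<in> U" for z w
    by (rule sesqui_polarization[OF sH U(1) _ Hd that]) (use U(4) in \<open>auto intro: convex_connected\<close>)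
  define Y where "Y z w = lg z w - lk z w" for z w
  have sY: "sesquiholomorphic_on Y U" unfolding Y_def by (intro sesqui_diff slg slk')
  have "dz (dwb Y) z w = 0" if "z \<in> U" "w \<in> U" for z w
  proof -
    have "dz (dwb Y) z w = dz (\<lambda>z w. dwb lg z w - dwb lk z w) z w"
      unfolding Y_def by (rule dz_cong[OF U(1) that]) (simp add: dwb_diff[OF U(1) slg slk'] that)
    also have "\<dots> = H z w"
      using dz_diff[OF U(1) sesqui_dwb[OF slg U(1)] sesqui_dwb[OF slk' U(1)] that] by (simp add: H_def)
    finally show ?thesis using H0[OF that] by simp
  qed
  then have Ysplit: "Y z w = Y z p + Y p w - Y p p" if "z \<in> U" "w \<in> U" for z w
    using mixed_zero_split[OF U(1) sY U(4)] that U(2) by blast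
  have hl: "(\<lambda>z. \<Phi> z p) holomorphic_on U" "(\<lambda>w. cnj (\<Phi> p w)) holomorphic_on U"
    if "sesquiholomorphic_on \<Phi> U" for \<Phi>
    using that U(2) by (auto simp: sesquiholomorphic_on_def adj_def)
  \<comment> \<open>The part of \<open>lk\<close> determined by the two lines through
    \<open>(p, p)\<close>. It has no mixed derivative, so subtracting it keeps the mixed derivative
    \<open>G\<close> and gives \<open>L\<close> zero Goursat data.\<close>
  define N where "N z w = (lk z p + lk p w) - lk p p" for z w
  have sr: "sesquiholomorphic_on (\<lambda>z w. lk p w) U"
    using sesqui_right[OF hl(2)[OF slk']] by simp
  have sN: "sesquiholomorphic_on N U"
    unfolding N_def by (intro sesqui_diff sesqui_add sesqui_left[OF hl(1)[OF slk']] sr sesqui_const)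
  define L where "L z w = lk z w - N z w" for z w
  have sL: "sesquiholomorphic_on L U" unfolding L_def by (intro sesqui_diff slk' sN)
  have Lp: "L z p = 0" "L p z = 0" for z by (simp_all add: L_def N_def)
  have "dwb N z w = dwb (\<lambda>z w. lk p w) z w" if "z \<in> U" "w \<in> U" for z w
  proof (rule dwb_eqI)
    have "((\<lambda>x. cnj (lk p x)) has_field_derivative cnj (dwb (\<lambda>z w. lk p w) z w)) (at w)"
      using sesqui_has_dwb[OF sr U(1) that] .
    then have "((\<lambda>x. (cnj (lk z p) + cnj (lk p x)) - cnj (lk p p)) has_field_derivative cnj (dwb (\<lambda>z w. lk p w) z w)) (at w)"
      by (auto intro!: derivative_eq_intros)
    then show "((\<lambda>x. cnj (N z x)) has_field_derivative cnj (dwb (\<lambda>z w. lk p w) z w)) (at w)"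
      by (simp add: N_def)
  qed
  then have N1: "dz (dwb N) z w = dz (\<lambda>z w. dwb (\<lambda>z w. lk p w) z w) z w" if "z \<in> U" "w \<in> U" for z w
    by (rule dz_cong[OF U(1) that]) (use that in auto)
  have N0: "dz (dwb N) z w = 0" if "z \<in> U" "w \<in> U" for z w
  proof -
    have "dz (\<lambda>z w. dwb (\<lambda>z w. lk p w) z w) z w = 0" by (simp add: dwb_eq dz_def)
    then show ?thesis using N1[OF that] by simp
  qed
  have LG: "dz (dwb L) z w = G z w" if "z \<in> U" "w \<in> U" for z w
  proof -
    have "dz (dwb L) z w = dz (\<lambda>z w. dwb lk z w - dwb N z w) z w"
      unfolding L_def by (rule dz_cong[OF U(1) that]) (simp add: dwb_diff[OF U(1) slk' sN] that)
    also have "\<dots> = G z w"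
      using dz_diff[OF U(1) sesqui_dwb[OF slk' U(1)] sesqui_dwb[OF sN U(1)] that] N0[OF that] by (simp add: G_def)
    finally show ?thesis .
  qed
  \<comment> \<open>\<open>G\<close> is the exponential of \<open>lk + Y\<close>; the splitting of
    \<open>Y\<close> and the definition of \<open>L\<close> leave \<open>L\<close> plus exponents in
    one variable each.\<close>
  define \<alpha> where "\<alpha> z = exp (Y z p + lk z p)" for z
  define \<beta> where "\<beta> w = exp (Y p w - Y p p + lk p w - lk p p)" for w
  have \<alpha>: "\<alpha> holomorphic_on U"
    unfolding \<alpha>_def by (intro holomorphic_intros hl sY slk')
  have eq: "dz (dwb L) z w = exp (L z w) * \<alpha> z * \<beta> w" if "z \<in> U" "w \<in> U" for z w
  proof -
    have "dz (dwb L) z w = exp (lk z w + Y z w)" using LG[OF that] explg[OF that] by (simp add: Y_def)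
    also have "lk z w + Y z w = L z w + (Y z p + lk z p) + (Y p w - Y p p + lk p w - lk p p)"
      unfolding Ysplit[OF that] by (simp add: L_def N_def)
    finally show ?thesis by (simp only: exp_add \<alpha>_def \<beta>_def)
  qed
  obtain A c where A: "A holomorphic_on U" "A p = 0" "\<And>z. z \<in> U \<Longrightarrow> deriv A z = \<alpha> z"
    and qA: "\<And>z w. z \<in> U \<Longrightarrow> w \<in> U \<Longrightarrow> exp (- L z w / 2) = 1 + c w * A z"
    by (rule Liouville_Goursat[OF U(1,4,2) sL Lp \<alpha> _ eq, rule_format]) (auto simp: \<alpha>_def)
  have aL: "cnj (L w z) = L z w" if "z \<in> U" "w \<in> U" for z w
  proof -
    have "cnj (lk x y) = lk y x" if "x \<in> U" "y \<in> U" for x y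
      using alk[of y x] that U(3) by (auto simp: adj_def)
    then show ?thesis using that U(2) by (simp add: L_def N_def)
  qed
  have herm: "cnj (c z * A w) = c w * A z" if "z \<in> U" "w \<in> U" for z w
  proof -
    have "cnj (exp (- L w z / 2)) = exp (- L z w / 2)" using aL[OF that] by (simp add: exp_cnj)
    then have "cnj (1 + c z * A w) = 1 + c w * A z" using qA that by metis
    then show ?thesis by simp
  qed
  have "\<exists>z0\<in>U. A z0 \<noteq> 0"
  proof (rule ccontr)
    assume "\<not> ?thesis"
    then have "deriv A p = deriv (\<lambda>z. 0) p"
      using eventually_nhds_in_open[OF U(1,2)] by (intro deriv_cong_ev) (auto elim!: eventually_mono)
    then show False using A(3)[OF U(2)] by (simp add: \<alpha>_def)
  qed
  then obtain z0 where z0: "z0 \<in> U" "A z0 \<noteq> 0" by blast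
  \<comment> \<open>Symmetry at the pair \<open>(z0, w)\<close> makes \<open>c w\<close>
    proportional to \<open>cnj (A w)\<close>; the factor is read off at \<open>z0\<close>, where
    \<open>A\<close> does not vanish, and is real by symmetry at \<open>(z0, z0)\<close>.\<close>
  define \<kappa> where "\<kappa> = cnj (c z0) / A z0"
  have c\<kappa>: "c w = \<kappa> * cnj (A w)" if "w \<in> U" for w
    using herm[OF z0(1) that] z0(2) by (simp add: \<kappa>_def field_simps)
  have "cnj \<kappa> * (cnj (A z0) * A z0) = \<kappa> * (cnj (A z0) * A z0)"
    using herm[OF z0(1) z0(1)] c\<kappa>[OF z0(1)] by (simp add: algebra_simps)
  then have "cnj \<kappa> = \<kappa>" using z0(2) by simp
  then have \<kappa>r: "\<kappa> = of_real (Re \<kappa>)" by (metis Reals_cnj_iff of_real_Re)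
  have form: "exp (- L z w / 2) = 1 + of_real (Re \<kappa>) * A z * cnj (A w)" if "z \<in> U" "w \<in> U" for z w
    using qA[OF that] c\<kappa>[OF that(2)] \<kappa>r by (simp add: mult_ac)
  \<comment> \<open>On the diagonal Cauchy-Schwarz says that \<open>exp L\<close> is at least one,
    hence \<open>exp (- L / 2)\<close> is at most one.\<close>
  have \<kappa>le: "Re \<kappa> \<le> 0"
  proof -
    have D0: "z0 \<in> D" "p \<in> D" "z0 \<in> U0" using z0 U p by auto
    have "L z0 z0 = of_real (Re (L z0 z0))" using aL[OF z0(1) z0(1)] by (metis Reals_cnj_iff of_real_Re)
    then obtain x where x: "L z0 z0 = of_real x" by metis
    have "ker z0 p \<noteq> 0" "ker p z0 \<noteq> 0"
      using explk[of z0 p] explk[of p z0] D0 U0(2) exp_not_eq_zero by metis+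
    then have "exp (L z0 z0) * (ker z0 p * ker p z0) = ker z0 z0 * ker p p"
      using D0 U0(2) explk[of z0 z0] explk[of z0 p] explk[of p z0] explk[of p p]
      by (simp add: L_def N_def exp_diff exp_add)
    moreover have "ker z0 p * ker p z0 = of_real ((cmod (ker z0 p))\<^sup>2)"
      unfolding ker_cnj[OF D0(2,1), symmetric] by (simp only: complex_norm_square)
    ultimately have "complex_of_real (exp x * (cmod (ker z0 p))\<^sup>2) = of_real (nsq (rep z0) * nsq (rep p))"
      using ker_diag[OF D0(1)] ker_diag[OF D0(2)] by (simp add: x exp_of_real)
    then have "exp x * (cmod (ker z0 p))\<^sup>2 = nsq (rep z0) * nsq (rep p)" by (simp only: of_real_eq_iff)
    moreover have "(cmod (ker z0 p))\<^sup>2 \<le> nsq (rep z0) * nsq (rep p)"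
      by (rule ker_Cauchy_Schwarz[OF D0(1,2)])
    moreover have "0 < (cmod (ker z0 p))\<^sup>2"
      using explk[of z0 p] D0 U0(2) by (metis exp_not_eq_zero norm_eq_zero zero_less_power2)
    ultimately have "1 * (cmod (ker z0 p))\<^sup>2 \<le> exp x * (cmod (ker z0 p))\<^sup>2" by simp
    then have "1 \<le> exp x" using \<open>0 < (cmod (ker z0 p))\<^sup>2\<close> by (metis mult_le_cancel_right_pos)
    then have "0 \<le> x" by simp
    have cm: "A z0 * cnj (A z0) = of_real ((cmod (A z0))\<^sup>2)" by (simp only: complex_norm_square)
    have "complex_of_real (exp (- x / 2)) = exp (- L z0 z0 / 2)" unfolding x by (simp flip: exp_of_real)
    also have "\<dots> = 1 + of_real (Re \<kappa>) * (A z0 * cnj (A z0))"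
      using form[OF z0(1) z0(1)] by (simp only: mult.assoc)
    also have "\<dots> = of_real (1 + Re \<kappa> * (cmod (A z0))\<^sup>2)" unfolding cm by simp
    finally have "complex_of_real (exp (- x / 2)) = of_real (1 + Re \<kappa> * (cmod (A z0))\<^sup>2)" .
    then have "exp (- x / 2) = 1 + Re \<kappa> * (cmod (A z0))\<^sup>2" by (simp only: of_real_eq_iff)
    moreover have "exp (- x / 2) \<le> 1" using \<open>0 \<le> x\<close> by simp
    ultimately have "Re \<kappa> * (cmod (A z0))\<^sup>2 \<le> 0" by simp
    then show ?thesis using z0(2) by (simp add: mult_le_0_iff)
  qed
  \<comment> \<open>For \<open>\<kappa> = 0\<close> the function \<open>exp (- L / 2)\<close> is
    constant and the mixed derivative of \<open>L\<close> vanishes, whereas the equation makes it a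
    product of exponentials.\<close>
  have \<kappa>ne: "Re \<kappa> \<noteq> 0"
  proof
    assume "Re \<kappa> = 0"
    then have e1: "exp (- L z w / 2) = 1" if "z \<in> U" "w \<in> U" for z w using form[OF that] by simp
    have "dz (\<lambda>z w. exp (- L z w / 2)) z w = 0" if "z \<in> U" "w \<in> U" for z w
      using dz_cong[OF U(1) that, of "\<lambda>z w. exp (- L z w / 2)" "\<lambda>z w. 1"] e1 that by (simp add: dz_right)
    moreover have "dz (\<lambda>z w. exp (- L z w / 2)) z w = exp (- L z w / 2) * (- dz L z w / 2)" if "z \<in> U" "w \<in> U" for z w
      by (rule dz_eqI) (auto intro!: derivative_eq_intros sesqui_has_dz[OF sL U(1) that])
    ultimately have "dz L z w = 0" if "z \<in> U" "w \<in> U" for z w using that by fastforce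
    then have "dwb (dz L) p p = dwb (\<lambda>z w. 0) p p"
      using U(2) by (intro dwb_cong[OF U(1)]) auto
    then have "dz (dwb L) p p = 0" using dz_dwb_commute[OF sL U(1) U(2) U(2)] by (simp add: dwb_left)
    then show False using eq[OF U(2) U(2)] by (simp add: \<alpha>_def \<beta>_def)
  qed
  define F where "F z = of_real (sqrt (- Re \<kappa>)) * A z" for z
  show thesis
  proof (rule that[of r F])
    show "F holomorphic_on ball p r" unfolding F_def using A(1) by (auto simp: U_def intro!: holomorphic_intros)
    have "(A has_field_derivative \<alpha> p) (at p)" using A U by (metis holomorphic_derivI)
    then have "(F has_field_derivative of_real (sqrt (- Re \<kappa>)) * \<alpha> p) (at p)"
      unfolding F_def by (rule DERIV_cmult)
    then show "deriv F p \<noteq> 0" using \<kappa>ne by (simp add: DERIV_imp_deriv \<alpha>_def)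
    show "F p = 0" by (simp add: F_def A)
    fix z w assume "z \<in> ball p r" "w \<in> ball p r"
    then have zw: "z \<in> U" "w \<in> U" by (auto simp: U_def)
    have "F z * cnj (F w) = of_real (sqrt (- Re \<kappa>) * sqrt (- Re \<kappa>)) * (A z * cnj (A w))"
      by (simp only: F_def complex_cnj_mult complex_cnj_complex_of_real of_real_mult mult_ac)
    moreover have "sqrt (- Re \<kappa>) * sqrt (- Re \<kappa>) = - Re \<kappa>" using \<kappa>le by simp
    ultimately have "F z * cnj (F w) = - (of_real (Re \<kappa>) * A z * cnj (A w))" by (simp only: of_real_minus) simp
    then have "1 - F z * cnj (F w) = exp (- L z w / 2)" using form[OF zw] by simp
    then have "(1 - F z * cnj (F w))\<^sup>2 = exp (- L z w)" by (simp flip: exp_double)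
    then have "ker z w * ker p p * (1 - F z * cnj (F w))\<^sup>2 = exp (lk z w) * exp (lk p p) * exp (- L z w)"
      using explk zw U by (simp add: subset_iff)
    also have "\<dots> = exp (lk z p + lk p w)" by (simp add: L_def N_def flip: exp_add)
    also have "\<dots> = ker z p * ker p w" using explk zw U by (simp add: subset_iff exp_add)
    finally show "ker z w * ker p p * (1 - F z * cnj (F w))\<^sup>2 = ker z p * ker p w" .
  qed (use r U in \<open>auto simp: U_def\<close>)
qed

end

subsection \<open>The developing map\<close>

text \<open>The identity theorem is used in one variable at a time: in the first for
  \<open>w\<close> in \<open>U\<close>, then in the second for arbitrary \<open>z\<close>.\<close>

lemma sesqui_identity:
  assumes \<Phi>: "sesquiholomorphic_on \<Phi> D" and D: "open D" "connected D" and U: "open U" "U \<noteq> {}" "U \<subseteq> D"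
    and 0: "\<And>z w. z \<in> U \<Longrightarrow> w \<in> U \<Longrightarrow> \<Phi> z w = 0" and zw: "z \<in> D" "w \<in> D"
  shows "\<Phi> z w = 0"
proof -
  have 1: "\<Phi> x v = 0" if "x \<in> D" "v \<in> U" for x v
  proof -
    have "(\<lambda>x. \<Phi> x v) holomorphic_on D" using \<Phi> that U by (auto simp: sesquiholomorphic_on_def)
    from analytic_continuation_open[OF U(1) D(1) U(2) D(2) U(3) this holomorphic_on_const[of 0]]
    show ?thesis using 0 that by auto
  qed
  have "(\<lambda>v. adj \<Phi> v z) holomorphic_on D" using \<Phi> zw by (auto simp: sesquiholomorphic_on_def)
  from analytic_continuation_open[OF U(1) D(1) U(2) D(2) U(3) this holomorphic_on_const[of 0]]
  have "adj \<Phi> w z = 0" using 1 zw by (auto simp: adj_def)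
  then show ?thesis by (simp add: adj_def)
qed

context liouville_domain
begin

text \<open>Formally \<open>ker z p * ker p p\<close> times the derivative of
  \<open>log (ker z w / ker p w)\<close> in the conjugate of \<open>w\<close> at \<open>p\<close>.
  It is a multiple of \<open>ker z p\<close> times the developing map, but holomorphic on all of
  \<open>D\<close>, and so carries out the continuation.\<close>

definition log_slope :: "complex \<Rightarrow> complex \<Rightarrow> complex" where
  "log_slope p z = dwb ker z p * ker p p - ker z p * dwb ker p p"

lemma hol_ker: "w \<in> D \<Longrightarrow> (\<lambda>z. ker z w) holomorphic_on D"
  using sesqui_ker by (simp add: sesquiholomorphic_on_def)

lemma hol_log_slope: "p \<in> D \<Longrightarrow> log_slope p holomorphic_on D"
  using sesqui_dwb[OF sesqui_ker open_D] hol_ker unfolding log_slope_def sesquiholomorphic_on_def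
  by (auto intro!: holomorphic_intros)

text \<open>The local identity is differentiated in the conjugate of \<open>w\<close> at
  \<open>w = p\<close>. As \<open>F p = 0\<close>, the squared factor is one there, and its
  derivative contributes the term \<open>2 * F z * cnj (deriv F p)\<close>; hence
  \<open>c = 2 * ker p p * cnj (deriv F p)\<close>.\<close>

lemma local_form_slope:
  assumes p: "p \<in> D"
  obtains r F c where "0 < r" "ball p r \<subseteq> D" "F holomorphic_on ball p r" "deriv F p \<noteq> 0" "c \<noteq> 0"
    "\<And>z w. z \<in> ball p r \<Longrightarrow> w \<in> ball p r \<Longrightarrow>
       ker z w * ker p p * (1 - F z * cnj (F w))\<^sup>2 = ker z p * ker p w"
    "\<And>z. z \<in> ball p r \<Longrightarrow> log_slope p z = c * ker z p * F z"
proof -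
  obtain r F where r: "0 < r" "ball p r \<subseteq> D" and F: "F holomorphic_on ball p r" "F p = 0" "deriv F p \<noteq> 0"
    and eq: "\<And>z w. z \<in> ball p r \<Longrightarrow> w \<in> ball p r \<Longrightarrow>
       ker z w * ker p p * (1 - F z * cnj (F w))\<^sup>2 = ker z p * ker p w"
    using local_form[OF p] by blast
  have pB: "p \<in> ball p r" using r by simp
  have dF: "(F has_field_derivative deriv F p) (at p)"
    using F(1) pB by (intro holomorphic_derivI) auto
  define c where "c = 2 * ker p p * cnj (deriv F p)"
  have "log_slope p z = c * ker z p * F z" if z: "z \<in> ball p r" for z
  proof -
    have zD: "z \<in> D" using z r by blast
    have d1: "((\<lambda>w. cnj (ker z w)) has_field_derivative cnj (dwb ker z p)) (at p)"
      by (rule sesqui_has_dwb[OF sesqui_ker open_D zD p])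
    have d2: "((\<lambda>w. cnj (ker p w)) has_field_derivative cnj (dwb ker p p)) (at p)"
      by (rule sesqui_has_dwb[OF sesqui_ker open_D p p])
    have "((\<lambda>w. cnj (ker z w) * (cnj (ker p p) * (1 - cnj (F z) * F w)\<^sup>2)) has_field_derivative
       cnj (dwb ker z p) * cnj (ker p p) - 2 * cnj (ker z p) * cnj (ker p p) * cnj (F z) * deriv F p) (at p)"
      by (auto intro!: derivative_eq_intros d1 dF simp: F(2))
    moreover have "((\<lambda>w. cnj (ker z p) * cnj (ker p w)) has_field_derivative cnj (ker z p) * cnj (dwb ker p p)) (at p)"
      by (intro DERIV_cmult d2)
    then have "((\<lambda>w. cnj (ker z w) * (cnj (ker p p) * (1 - cnj (F z) * F w)\<^sup>2)) has_field_derivative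
        cnj (ker z p) * cnj (dwb ker p p)) (at p)"
    proof (rule has_field_derivative_transform_within_open[of _ _ _ "ball p r"])
      fix w assume w: "w \<in> ball p r"
      have "cnj (ker z p * ker p w) = cnj (ker z w * ker p p * (1 - F z * cnj (F w))\<^sup>2)"
        using eq[OF z w] by simp
      then show "cnj (ker z p) * cnj (ker p w) = cnj (ker z w) * (cnj (ker p p) * (1 - cnj (F z) * F w)\<^sup>2)"
        by simp
    qed (use pB in auto)
    ultimately have "cnj (dwb ker z p) * cnj (ker p p) - 2 * cnj (ker z p) * cnj (ker p p) * cnj (F z) * deriv F p
       = cnj (ker z p) * cnj (dwb ker p p)" by (rule DERIV_unique)
    then have "cnj (cnj (dwb ker z p) * cnj (ker p p) - 2 * cnj (ker z p) * cnj (ker p p) * cnj (F z) * deriv F p)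
       = cnj (cnj (ker z p) * cnj (dwb ker p p))" by simp
    then show ?thesis by (simp add: log_slope_def c_def algebra_simps)
  qed
  moreover have "c \<noteq> 0" using F(3) ker_diag_ne[OF p] by (simp add: c_def)
  ultimately show thesis using that r F eq by blast
qed

text \<open>Multiplying the local identity by the denominators gives an identity of functions
  that are sesquiholomorphic on all of \<open>D\<close>, so it holds globally.\<close>

lemma meromorphic_form:
  assumes p: "p \<in> D"
  obtains c where "c \<noteq> 0"
    "\<And>z. z \<in> D \<Longrightarrow> ker z p \<noteq> 0 \<Longrightarrow> cmod (log_slope p z / (c * ker z p)) < 1"
    "\<And>z w. z \<in> D \<Longrightarrow> w \<in> D \<Longrightarrow> ker z p \<noteq> 0 \<Longrightarrow> ker w p \<noteq> 0 \<Longrightarrow>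
       ker z w * ker p p * (1 - log_slope p z / (c * ker z p) * cnj (log_slope p w / (c * ker w p)))\<^sup>2 = ker z p * ker p w"
proof -
  obtain r F c where r: "0 < r" "ball p r \<subseteq> D" and c: "c \<noteq> 0"
    and eq: "\<And>z w. z \<in> ball p r \<Longrightarrow> w \<in> ball p r \<Longrightarrow>
       ker z w * ker p p * (1 - F z * cnj (F w))\<^sup>2 = ker z p * ker p w"
    and sl: "\<And>z. z \<in> ball p r \<Longrightarrow> log_slope p z = c * ker z p * F z"
    using local_form_slope[OF p] by metis
  define C where "C = c * cnj c"
  define k where "k = (\<lambda>z. ker z p)"
  define N where "N = log_slope p"
  have hk: "k holomorphic_on D" and hN: "N holomorphic_on D"
    using hol_ker[OF p] hol_log_slope[OF p] by (simp_all add: k_def N_def)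
  have kp: "ker p w = cnj (k w)" if "w \<in> D" for w using ker_cnj[OF p that] by (simp add: k_def)
  \<comment> \<open>The local identity with \<open>F = N / (c * k)\<close>, multiplied by the square
    of \<open>C * k z * cnj (k w)\<close>, where \<open>C\<close> is the squared modulus of
    \<open>c\<close>.\<close>
  define \<Phi> where "\<Phi> z w = ker z w * (ker p p * ((C * (k z * cnj (k w)) - N z * cnj (N w)) * (C * (k z * cnj (k w)) - N z * cnj (N w))))
     - C * C * ((k z * cnj (k w)) * (k z * cnj (k w)) * (k z * cnj (k w)))" for z w
  have s\<Phi>: "sesquiholomorphic_on \<Phi> D"
    unfolding \<Phi>_def
    by (intro sesqui_mult sesqui_diff sesqui_const sesqui_ker sesqui_left[OF hk] sesqui_right[OF hk]
        sesqui_left[OF hN] sesqui_right[OF hN])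
  have "\<Phi> z w = 0" if "z \<in> ball p r" "w \<in> ball p r" for z w
  proof -
    have e: "ker z w * ker p p * (1 - F z * cnj (F w))\<^sup>2 = k z * cnj (k w)"
      using eq[OF that] kp that r by (auto simp: k_def)
    have f: "C * (k z * cnj (k w)) - N z * cnj (N w) = C * (k z * cnj (k w)) * (1 - F z * cnj (F w))"
      using sl that by (simp add: N_def C_def k_def algebra_simps)
    have "\<Phi> z w = C * C * ((k z * cnj (k w)) * (k z * cnj (k w))) *
       (ker z w * ker p p * (1 - F z * cnj (F w))\<^sup>2 - k z * cnj (k w))"
      unfolding \<Phi>_def f by (simp add: power2_eq_square algebra_simps)
    then show ?thesis using e by simp
  qed
  then have \<Phi>0: "\<Phi> z w = 0" if "z \<in> D" "w \<in> D" for z w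
    using sesqui_identity[OF s\<Phi> open_D connected_D, of "ball p r"] r that by auto
  define G where "G z = N z / (c * k z)" for z
  have id: "ker z w * ker p p * (1 - G z * cnj (G w))\<^sup>2 = ker z p * ker p w"
    if "z \<in> D" "w \<in> D" "k z \<noteq> 0" "k w \<noteq> 0" for z w
  proof -
    have C0: "C \<noteq> 0" using c by (simp add: C_def)
    have f: "C * (k z * cnj (k w)) - N z * cnj (N w) = C * (k z * cnj (k w)) * (1 - G z * cnj (G w))"
      using that c by (simp add: G_def C_def field_simps)
    have "C * C * ((k z * cnj (k w)) * (k z * cnj (k w))) *
       (ker z w * ker p p * (1 - G z * cnj (G w))\<^sup>2 - k z * cnj (k w)) = \<Phi> z w"
      unfolding \<Phi>_def f by (simp add: power2_eq_square algebra_simps)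
    then have "ker z w * ker p p * (1 - G z * cnj (G w))\<^sup>2 = k z * cnj (k w)"
      using C0 that \<Phi>0 by simp
    then show ?thesis using kp that by (simp add: k_def)
  qed
  \<comment> \<open>The zeros are countable, so removing them keeps \<open>D\<close> connected, and
    \<open>G\<close> can be compared with its value at \<open>p\<close>.\<close>
  define Z where "Z = {z \<in> D. k z = 0}"
  have "countable Z"
  proof (cases "k constant_on D")
    case True
    then have "Z = {}" using ker_diag_ne[OF p] p unfolding constant_on_def Z_def k_def by auto
    then show ?thesis by simp
  next
    case False
    moreover have "fsigma D"
    proof -
      obtain C :: "nat \<Rightarrow> complex set" where "\<And>n. compact (C n)" "\<Union> (range C) = D"
        by (rule open_Union_compact_subsets[OF open_D], rule that)
      then show ?thesis unfolding fsigma_Union_compact by (intro exI[of _ C]) auto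
    qed
    ultimately show ?thesis
      unfolding Z_def using hk open_D connected_D by (intro holomorphic_countable_zeros)
  qed
  then have conn: "connected (D - Z)"
    using open_D connected_D by (intro connected_open_diff_countable) auto
  have DZ: "D - Z = {z \<in> D. k z \<noteq> 0}" by (auto simp: Z_def)
  \<comment> \<open>Modulus one would annihilate the left side of the identity at
    \<open>w = z\<close>, while the right side is the squared modulus of \<open>k z\<close>.\<close>
  have ne1: "cmod (G z) \<noteq> 1" if "z \<in> D" "k z \<noteq> 0" for z
  proof
    assume "cmod (G z) = 1"
    then have "G z * cnj (G z) = 1" using complex_norm_square[of "G z"] by simp
    then have "k z * cnj (k z) = 0" using id[of z z] kp[of z] that by (simp add: k_def)
    then show False using that by simp
  qed
  have "continuous_on (D - Z) (\<lambda>z. cmod (G z))"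
    unfolding G_def DZ using c
    by (intro continuous_intros holomorphic_on_imp_continuous_on[OF holomorphic_on_subset[OF hN]]
        holomorphic_on_imp_continuous_on[OF holomorphic_on_subset[OF hk]]) auto
  then have ci: "connected ((\<lambda>z. cmod (G z)) ` (D - Z))" using conn by (rule connected_continuous_image)
  have pDZ: "p \<in> D - Z" using p ker_diag_ne[OF p] by (simp add: Z_def k_def)
  have Gp: "cmod (G p) = 0" by (simp add: G_def N_def log_slope_def)
  \<comment> \<open>Since \<open>G p = 0\<close>, a modulus of at least one would force the
    connected range to contain one.\<close>
  have lt1: "cmod (G z) < 1" if "z \<in> D" "k z \<noteq> 0" for z
  proof (rule ccontr)
    assume "\<not> ?thesis"
    then have "1 \<in> {cmod (G p)..cmod (G z)}" using Gp by simp
    moreover have "{cmod (G p)..cmod (G z)} \<subseteq> (\<lambda>z. cmod (G z)) ` (D - Z)"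
      using ci pDZ that by (intro connected_contains_Icc) (auto simp: DZ)
    ultimately obtain x where "x \<in> D - Z" "cmod (G x) = 1" by force
    then show False using ne1 by (simp add: DZ)
  qed
  show thesis
    by (rule that[OF c]) (use lt1 id in \<open>auto simp: G_def N_def k_def\<close>)
qed

text \<open>At a zero of the kernel the developing map would extend holomorphically with modulus one,
  contradicting the maximum principle.\<close>

lemma ker_nonzero:
  assumes p: "p \<in> D" and z0: "z0 \<in> D"
  shows "ker z0 p \<noteq> 0"
proof
  assume k0: "ker z0 p = 0"
  obtain c where c: "c \<noteq> 0"
    and lt: "\<And>z. z \<in> D \<Longrightarrow> ker z p \<noteq> 0 \<Longrightarrow> cmod (log_slope p z / (c * ker z p)) < 1"
    and id: "\<And>z w. z \<in> D \<Longrightarrow> w \<in> D \<Longrightarrow> ker z p \<noteq> 0 \<Longrightarrow> ker w p \<noteq> 0 \<Longrightarrow>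
       ker z w * ker p p * (1 - log_slope p z / (c * ker z p) * cnj (log_slope p w / (c * ker w p)))\<^sup>2 = ker z p * ker p w"
    using meromorphic_form[OF p] by blast
  define G where "G z = log_slope p z / (c * ker z p)" for z
  obtain r where r: "0 < r" "ball z0 r \<subseteq> D" and nz: "\<And>z. z \<in> ball z0 r - {z0} \<Longrightarrow> ker z p \<noteq> 0"
    using isolated_zeros[OF hol_ker[OF p] open_D connected_D z0 k0 p ker_diag_ne[OF p]] by blast
  define B where "B = ball z0 r"
  have "G holomorphic_on B - {z0}"
    unfolding G_def B_def using nz r c
    by (intro holomorphic_intros holomorphic_on_subset[OF hol_log_slope[OF p]] holomorphic_on_subset[OF hol_ker[OF p]]) auto
  moreover have "z0 \<in> interior B" using r by (simp add: B_def)
  moreover have "\<forall>\<^sub>F z in at z0. cmod (G z) \<le> 1"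
  proof -
    have "\<forall>\<^sub>F z in at z0. z \<in> B - {z0}"
      using r eventually_at_in_open[of B z0] by (simp add: B_def)
    then show ?thesis
      by eventually_elim (use lt nz r in \<open>auto simp: G_def B_def intro!: less_imp_le\<close>)
  qed
  ultimately obtain g where g: "g holomorphic_on B" and gG: "\<And>z. z \<in> B - {z0} \<Longrightarrow> g z = G z"
    using holomorphic_on_extend_bounded[of G B z0] by blast
  have contg: "isCont g z0"
    using holomorphic_on_imp_continuous_on[OF g] r by (auto simp: B_def intro: continuous_on_interior)
  have contK: "isCont (\<lambda>z. ker z z) z0" "isCont (\<lambda>z. ker z p) z0"
  proof -
    have "continuous_on D (\<lambda>z. ker z p)" using hol_ker[OF p] by (rule holomorphic_on_imp_continuous_on)
    then show "isCont (\<lambda>z. ker z p) z0" using z0 open_D by (simp add: continuous_on_eq_continuous_at)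
    have "continuous_on D (\<lambda>z. (\<lambda>(z, w). ker z w) (z, z))"
      by (rule continuous_on_compose2[of "D \<times> D"])
        (use sesqui_ker in \<open>auto simp: sesquiholomorphic_on_def intro!: continuous_intros\<close>)
    then show "isCont (\<lambda>z. ker z z) z0" using z0 open_D by (simp add: continuous_on_eq_continuous_at)
  qed
  \<comment> \<open>The diagonal identity survives the passage to \<open>z0\<close>. There its right
    side is zero and both kernel values on the left are not, so \<open>g z0\<close> has modulus
    one.\<close>
  have ev: "\<forall>\<^sub>F z in at z0. ker z z * ker p p * (1 - g z * cnj (g z))\<^sup>2 = ker z p * cnj (ker z p)"
  proof -
    have "\<forall>\<^sub>F z in at z0. z \<in> B - {z0}"
      using r eventually_at_in_open[of B z0] by (simp add: B_def)
    then show ?thesis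
    proof eventually_elim
      case (elim z)
      then have "z \<in> D" "ker z p \<noteq> 0" using nz r by (auto simp: B_def)
      then show ?case using id[of z z] gG[OF elim] ker_cnj[OF p, of z] by (simp add: G_def)
    qed
  qed
  have "((\<lambda>z. ker z z * ker p p * (1 - g z * cnj (g z))\<^sup>2) \<longlongrightarrow> ker z0 z0 * ker p p * (1 - g z0 * cnj (g z0))\<^sup>2) (at z0)"
    using contg contK by (auto intro!: tendsto_intros simp: isCont_def)
  then have "((\<lambda>z. ker z p * cnj (ker z p)) \<longlongrightarrow> ker z0 z0 * ker p p * (1 - g z0 * cnj (g z0))\<^sup>2) (at z0)"
    by (rule Lim_transform_eventually[OF _ ev])
  moreover have "((\<lambda>z. ker z p * cnj (ker z p)) \<longlongrightarrow> ker z0 p * cnj (ker z0 p)) (at z0)"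
    using contK by (auto intro!: tendsto_intros simp: isCont_def)
  ultimately have "ker z0 z0 * ker p p * (1 - g z0 * cnj (g z0))\<^sup>2 = ker z0 p * cnj (ker z0 p)"
    by (rule LIM_unique)
  then have "ker z0 z0 * ker p p * (1 - g z0 * cnj (g z0))\<^sup>2 = 0" using k0 by simp
  then have "g z0 * cnj (g z0) = 1" using ker_diag_ne[OF z0] ker_diag_ne[OF p] by simp
  then have "complex_of_real ((cmod (g z0))\<^sup>2) = of_real 1" by (simp only: complex_norm_square of_real_1)
  then have g1: "cmod (g z0) = 1" by (simp only: of_real_eq_iff power2_eq_1_iff) (use norm_ge_zero[of "g z0"] in linarith)
  have gl: "cmod (g z) < 1" if "z \<in> B - {z0}" for z
    using lt[of z] nz[of z] gG[OF that] that r by (auto simp: G_def B_def)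
  have "g constant_on B"
    by (rule maximum_modulus_principle[OF g, of B z0]) (use g1 gl r in \<open>force simp: B_def intro: less_imp_le\<close>)+
  then obtain y where y: "\<And>z. z \<in> B \<Longrightarrow> g z = y" unfolding constant_on_def by blast
  have "z0 + of_real (r / 2) \<in> B - {z0}" using r by (simp add: B_def dist_norm)
  moreover have "z0 \<in> B" using r by (simp add: B_def)
  ultimately show False
    using gl[of "z0 + of_real (r / 2)"] g1 y by auto
qed

text \<open>The identity determines \<open>ker x z\<close> up to the factor \<open>ker p z\<close>
  by \<open>F z\<close> alone. The representatives of points with equal \<open>F\<close> are
  therefore proportional, and so are all evaluations there.\<close>

lemma same_value_proportional:
  assumes p: "p \<in> D" and z: "z1 \<in> D" "z2 \<in> D" and eq: "F z1 = F z2" and f: "f \<in> \<A>"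
    and lt: "\<And>z. z \<in> D \<Longrightarrow> cmod (F z) < 1"
    and id: "\<And>z w. z \<in> D \<Longrightarrow> w \<in> D \<Longrightarrow> ker z w * ker p p * (1 - F z * cnj (F w))\<^sup>2 = ker z p * ker p w"
  shows "f z1 * ker z2 p = f z2 * ker z1 p"
proof -
  have k: "ker p z1 \<noteq> 0" "ker p z2 \<noteq> 0" using ker_nonzero p z by auto
  have "rep z1 x = ker p z1 / ker p z2 * rep z2 x" if x: "x \<in> D" for x
  proof -
    have "cmod (F x * cnj (F z1)) < 1"
      using lt[OF x] lt[OF z(1)] by (simp add: norm_mult) (metis less_1_mult' linorder_not_less mult_le_one norm_ge_zero order_less_le mult_strict_mono' mult.right_neutral)
    then have "1 - F x * cnj (F z1) \<noteq> 0" by auto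
    then have s: "ker p p * (1 - F x * cnj (F z1))\<^sup>2 \<noteq> 0" using ker_diag_ne[OF p] by simp
    have "ker x z1 * (ker p p * (1 - F x * cnj (F z1))\<^sup>2) * ker p z2 = ker x z2 * (ker p p * (1 - F x * cnj (F z1))\<^sup>2) * ker p z1"
      using id[OF x z(1)] id[OF x z(2)] eq by (simp add: mult_ac)
    then have "ker x z1 * ker p z2 = ker x z2 * ker p z1"
      using s by (simp add: mult_ac)
    then show ?thesis using k by (simp add: ker_def field_simps)
  qed
  then have "f z1 = ip f (\<lambda>x. ker p z1 / ker p z2 * rep z2 x)"
    unfolding reproducing[OF z(1) f] by (intro ip_cong) auto
  also have "\<dots> = cnj (ker p z1 / ker p z2) * f z2"
    using ip_cmult[OF f rep_A[OF z(2)], of 1 "ker p z1 / ker p z2"] reproducing[OF z(2) f] by simp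
  finally show ?thesis using k ker_cnj[of z1 p] ker_cnj[of z2 p] p z ker_nonzero[OF p z(2)] by (simp add: field_simps)
qed

lemma developing_map:
  assumes p: "p \<in> D"
  obtains F where "F holomorphic_on D" "inj_on F D" "F ` D \<subseteq> ball 0 1"
    "\<And>z. z \<in> D \<Longrightarrow> deriv F z \<noteq> 0"
    "\<And>z w. z \<in> D \<Longrightarrow> w \<in> D \<Longrightarrow> ker z w * ker p p * (1 - F z * cnj (F w))\<^sup>2 = ker z p * ker p w"
proof -
  obtain c where c: "c \<noteq> 0"
    and lt: "\<And>z. z \<in> D \<Longrightarrow> ker z p \<noteq> 0 \<Longrightarrow> cmod (log_slope p z / (c * ker z p)) < 1"
    and id0: "\<And>z w. z \<in> D \<Longrightarrow> w \<in> D \<Longrightarrow> ker z p \<noteq> 0 \<Longrightarrow> ker w p \<noteq> 0 \<Longrightarrow>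
       ker z w * ker p p * (1 - log_slope p z / (c * ker z p) * cnj (log_slope p w / (c * ker w p)))\<^sup>2 = ker z p * ker p w"
    using meromorphic_form[OF p] by blast
  define F where "F z = log_slope p z / (c * ker z p)" for z
  have hF: "F holomorphic_on D"
    unfolding F_def using c ker_nonzero[OF p] by (intro holomorphic_intros hol_log_slope p hol_ker) auto
  have lF: "cmod (F z) < 1" if "z \<in> D" for z using lt[OF that] ker_nonzero[OF p that] by (simp add: F_def)
  have id: "ker z w * ker p p * (1 - F z * cnj (F w))\<^sup>2 = ker z p * ker p w" if "z \<in> D" "w \<in> D" for z w
    using id0 that ker_nonzero[OF p] by (simp add: F_def)
  have ne: "1 - F z * cnj (F w) \<noteq> 0" if "z \<in> D" "w \<in> D" for z w
    using id[OF that] ker_nonzero p that by (metis mult_eq_0_iff power_zero_numeral)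
  \<comment> \<open>At a critical point \<open>w\<close> the squared factor is stationary, so
    differentiating the identity at \<open>w\<close> shows that \<open>log_slope w\<close> vanishes
    identically. The local form with base point \<open>w\<close> contradicts this.\<close>
  have dF0: "deriv F w \<noteq> 0" if w: "w \<in> D" for w
  proof
    assume d0: "deriv F w = 0"
    have dF: "(F has_field_derivative 0) (at w)"
      using holomorphic_derivI[OF hF open_D w] d0 by simp
    have dw: "dwb ker z w * (ker p p * (1 - F z * cnj (F w))\<^sup>2) = ker z p * dwb ker p w" if z: "z \<in> D" for z
    proof -
      have "((\<lambda>x. cnj (ker z x) * (cnj (ker p p) * (1 - cnj (F z) * F x)\<^sup>2)) has_field_derivative
         cnj (dwb ker z w) * (cnj (ker p p) * (1 - cnj (F z) * F w)\<^sup>2)) (at w)"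
        by (auto intro!: derivative_eq_intros sesqui_has_dwb[OF sesqui_ker open_D z w] dF)
      moreover have "((\<lambda>x. cnj (ker z p) * cnj (ker p x)) has_field_derivative cnj (ker z p) * cnj (dwb ker p w)) (at w)"
        by (intro DERIV_cmult sesqui_has_dwb[OF sesqui_ker open_D p w])
      then have "((\<lambda>x. cnj (ker z x) * (cnj (ker p p) * (1 - cnj (F z) * F x)\<^sup>2)) has_field_derivative
          cnj (ker z p) * cnj (dwb ker p w)) (at w)"
      proof (rule has_field_derivative_transform_within_open[of _ _ _ D])
        fix x assume x: "x \<in> D"
        have "cnj (ker z p * ker p x) = cnj (ker z x * ker p p * (1 - F z * cnj (F x))\<^sup>2)"
          using id[OF z x] by simp
        then show "cnj (ker z p) * cnj (ker p x) = cnj (ker z x) * (cnj (ker p p) * (1 - cnj (F z) * F x)\<^sup>2)"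
          by simp
      qed (use w open_D in auto)
      ultimately have "cnj (dwb ker z w) * (cnj (ker p p) * (1 - cnj (F z) * F w)\<^sup>2) = cnj (ker z p) * cnj (dwb ker p w)"
        by (rule DERIV_unique)
      then have "cnj (cnj (dwb ker z w) * (cnj (ker p p) * (1 - cnj (F z) * F w)\<^sup>2)) = cnj (cnj (ker z p) * cnj (dwb ker p w))"
        by simp
      then show ?thesis by simp
    qed
    have slope0: "log_slope w z = 0" if z: "z \<in> D" for z
    proof -
      define s where "s z = ker p p * (1 - F z * cnj (F w))\<^sup>2" for z
      have s: "s z \<noteq> 0" "s w \<noteq> 0" using ne[OF z w] ne[OF w w] ker_diag_ne[OF p] by (auto simp: s_def)
      have "dwb ker z w = ker z p * dwb ker p w / s z" "dwb ker w w = ker w p * dwb ker p w / s w"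
        using dw[OF z] dw[OF w] s by (simp_all add: s_def[symmetric] nonzero_eq_divide_eq)
      moreover have "ker z w = ker z p * ker p w / s z" "ker w w = ker w p * ker p w / s w"
        using id[OF z w] id[OF w w] s by (simp_all add: s_def[symmetric] nonzero_eq_divide_eq mult.assoc)
      ultimately show ?thesis by (simp add: log_slope_def)
    qed
    \<comment> \<open>\<open>F'\<close> is the local map with base point \<open>w\<close>, not a
      derivative of \<open>F\<close>.\<close>
    obtain r F' c' where r: "0 < r" "ball w r \<subseteq> D" and F': "deriv F' w \<noteq> 0" "c' \<noteq> 0"
      "\<And>z. z \<in> ball w r \<Longrightarrow> log_slope w z = c' * ker z w * F' z"
      using local_form_slope[OF w] by metis
    have "F' z = 0" if "z \<in> ball w r" for z
      using F'(2,3) slope0 ker_nonzero[OF w] that r by (metis mult_eq_0_iff subsetD)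
    then have "deriv F' w = deriv (\<lambda>z. 0) w"
      using r eventually_nhds_in_open[of "ball w r" w] by (intro deriv_cong_ev) (auto elim!: eventually_mono)
    then show False using F' by simp
  qed
  have "inj_on F D"
  proof (rule inj_onI, rule ccontr)
    fix z1 z2 assume z: "z1 \<in> D" "z2 \<in> D" and eq: "F z1 = F z2" and ne12: "z1 \<noteq> z2"
    \<comment> \<open>The difference quotient of \<open>F\<close> at \<open>z2\<close> is bounded,
      so its product \<open>u\<close> with \<open>rep p\<close> is square integrable. It vanishes at
      \<open>z1\<close> but not at \<open>z2\<close>, against proportionality.\<close>
    define h where "h z = (if z = z2 then deriv F z2 else (F z - F z2) / (z - z2))" for z
    have hh: "h holomorphic_on D" unfolding h_def using hF open_D by (rule pole_lemma_open)
    obtain \<delta> where \<delta>: "0 < \<delta>" "cball z2 \<delta> \<subseteq> D" using open_D z open_contains_cball by blast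
    have "bounded (h ` cball z2 \<delta>)"
      using holomorphic_on_imp_continuous_on[OF hh] \<delta>
      by (intro compact_imp_bounded compact_continuous_image) (auto intro: continuous_on_subset)
    then obtain M where M: "\<And>x. x \<in> cball z2 \<delta> \<Longrightarrow> cmod (h x) \<le> M"
      unfolding bounded_iff by (metis imageI)
    \<comment> \<open>Near \<open>z2\<close> compactness gives the bound \<open>M\<close>; farther
      away the values of \<open>F\<close> in the unit disc bound the numerator by two.\<close>
    define b where "b = max M (2 / \<delta>)"
    have hb: "cmod (h x) \<le> b" if x: "x \<in> D" for x
    proof (cases "x \<in> cball z2 \<delta>")
      case True
      then show ?thesis using M[OF True] by (simp add: b_def)
    next
      case False
      then have "\<delta> < cmod (x - z2)" by (simp add: dist_norm norm_minus_commute)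
      moreover have "cmod (F x - F z2) \<le> 2"
        using norm_triangle_ineq4[of "F x" "F z2"] lF[OF x] lF[OF z(2)] by linarith
      ultimately have "cmod (h x) \<le> 2 / \<delta>"
        using \<delta>(1) by (auto simp: h_def norm_divide intro!: frac_le)
      then show ?thesis by (simp add: b_def)
    qed
    define u where "u x = ker x p * h x" for x
    have uA: "u \<in> \<A>"
    proof (rule A_I[where g = "\<lambda>x. b\<^sup>2 * (cmod (rep p x))\<^sup>2"])
      show "u holomorphic_on D" unfolding u_def by (intro holomorphic_intros hol_ker p hh)
      show "set_integrable lborel D (\<lambda>x. b\<^sup>2 * (cmod (rep p x))\<^sup>2)"
        by (intro set_integrable_mult_right A_set_integrable rep_A p)
      fix x assume "x \<in> D"
      then have "(cmod (h x))\<^sup>2 \<le> b\<^sup>2" using hb by (intro power_mono) auto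
      then show "(cmod (u x))\<^sup>2 \<le> b\<^sup>2 * (cmod (rep p x))\<^sup>2"
        by (simp add: u_def ker_def norm_mult power_mult_distrib mult.commute mult_right_mono)
    qed
    have "u z1 * ker z2 p = u z2 * ker z1 p"
      by (rule same_value_proportional[where F = F, OF p z eq uA lF id])
    moreover have "u z1 = 0" using ne12 eq by (simp add: u_def h_def)
    moreover have "u z2 = ker z2 p * deriv F z2" by (simp add: u_def h_def)
    ultimately show False using dF0[OF z(2)] ker_nonzero[OF p] z by auto
  qed
  then show thesis by (intro that[of F] hF dF0 id) (use lF in auto)
qed

text \<open>In the reproducing formula for \<open>f w\<close> the kernel is replaced by means of the
  identity. Then \<open>w\<close> occurs only in the factor \<open>ker w p\<close> and through
  \<open>F w\<close> in \<open>1 / (1 - F w * cnj (F z))\<^sup>2\<close>, and there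
  \<open>F w\<close> may be replaced by any \<open>\<xi>\<close> of the unit disc.\<close>

lemma factor_through_disc:
  assumes p: "p \<in> D" and hF: "F holomorphic_on D" and lF: "F ` D \<subseteq> ball 0 1"
    and id: "\<And>z w. z \<in> D \<Longrightarrow> w \<in> D \<Longrightarrow> ker z w * ker p p * (1 - F z * cnj (F w))\<^sup>2 = ker z p * ker p w"
    and f: "f \<in> \<A>"
  obtains H where "H holomorphic_on ball 0 1" "\<And>w. w \<in> D \<Longrightarrow> f w = ker w p * H (F w)"
proof -
  define g where "g z = indicator D z *\<^sub>R (f z * cnj (rep p z))" for z
  have ig: "integrable lborel g"
    using A_prod_integrable[OF f rep_A[OF p]] by (simp add: set_integrable_def g_def[abs_def])
  have cF: "(\<lambda>z. indicator D z *\<^sub>R F z) \<in> borel_measurable lborel"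
    by (intro indicator_measurable holomorphic_on_imp_continuous_on hF)
  define \<phi> where "\<phi> z = indicator D z *\<^sub>R F z" for z
  have \<phi>m [measurable]: "\<phi> \<in> borel_measurable lborel" using cF by (simp add: \<phi>_def[abs_def])
  have \<phi>1: "cmod (\<phi> z) < 1" for z using lF by (auto simp: \<phi>_def indicator_def)
  have [measurable]: "(\<lambda>z. cnj (\<phi> z)) \<in> borel_measurable borel"
    using measurable_compose[OF \<phi>m borel_measurable_continuous_onI[OF continuous_on_cnj[OF continuous_on_id]]] by simp
  define a where "a n = (\<integral>z. g z * cnj (\<phi> z) ^ n \<partial>lborel)" for n
  define S where "S = (\<integral>z. norm (g z) \<partial>lborel)"
  have gm [measurable]: "g \<in> borel_measurable lborel" using ig by (rule borel_measurable_integrable)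
  have pw: "cmod (\<phi> z) ^ n \<le> 1" for z n using \<phi>1[of z] by (simp add: power_le_one)
  have in1: "integrable lborel (\<lambda>z. g z * cnj (\<phi> z) ^ n)" for n
  proof (rule Bochner_Integration.integrable_bound[OF ig])
    show "AE z in lborel. norm (g z * cnj (\<phi> z) ^ n) \<le> norm (g z)"
      using pw by (intro AE_I2) (simp add: norm_mult norm_power mult_left_le)
  qed measurable
  have S0: "0 \<le> S" unfolding S_def by simp
  \<comment> \<open>The series of \<open>1 / (1 - x)\<^sup>2\<close> is integrated termwise; as
    \<open>\<phi>\<close> is bounded by one, the majorant is \<open>Suc n * cmod \<xi> ^ n\<close>
    times the integrable \<open>norm (g z)\<close>.\<close>
  have key: "(\<lambda>n. of_nat (Suc n) * a n * \<xi> ^ n) sums (\<integral>z. g z * (1 / (1 - \<xi> * cnj (\<phi> z))\<^sup>2) \<partial>lborel)"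
    if \<xi>: "cmod \<xi> < 1" for \<xi>
  proof -
    let ?t = "\<lambda>n z. (of_nat (Suc n) * \<xi> ^ n) * (g z * cnj (\<phi> z) ^ n)"
    have sm: "summable (\<lambda>n. real (Suc n) * cmod \<xi> ^ n)"
      using geometric_deriv_sums[of "cmod \<xi>"] \<xi> by (auto simp: sums_iff)
    have nb: "norm (?t n z) \<le> norm (g z) * (real (Suc n) * cmod \<xi> ^ n)" for n z
    proof -
      have "norm (?t n z) = (real (Suc n) * cmod \<xi> ^ n) * (norm (g z) * cmod (\<phi> z) ^ n)"
        by (simp add: norm_mult norm_power del: of_nat_Suc)
      also have "\<dots> \<le> (real (Suc n) * cmod \<xi> ^ n) * (norm (g z) * 1)"
        using pw by (intro mult_left_mono) auto
      finally show ?thesis by (simp add: mult.commute)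
    qed
    have "(\<lambda>n. \<integral>z. ?t n z \<partial>lborel) sums (\<integral>z. (\<Sum>n. ?t n z) \<partial>lborel)"
    proof (rule sums_integral)
      show "integrable lborel (?t n)" for n by (intro integrable_mult_right in1)
      show "AE z in lborel. summable (\<lambda>n. norm (?t n z))"
        by (intro AE_I2 summable_comparison_test'[OF summable_mult[OF sm]]) (use nb in auto)
      have "norm (\<integral>z. norm (?t n z) \<partial>lborel) \<le> S * (real (Suc n) * cmod \<xi> ^ n)" for n
      proof -
        have "(\<integral>z. norm (?t n z) \<partial>lborel) \<le> (\<integral>z. norm (g z) * (real (Suc n) * cmod \<xi> ^ n) \<partial>lborel)"
          by (intro integral_mono integrable_norm integrable_mult_right in1 integrable_mult_left ig nb)
        then show ?thesis by (simp add: S_def)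
      qed
      then show "summable (\<lambda>n. \<integral>z. norm (?t n z) \<partial>lborel)"
        by (intro summable_comparison_test'[OF summable_mult[OF sm, of S]]) auto
    qed
    moreover have "(\<integral>z. ?t n z \<partial>lborel) = of_nat (Suc n) * a n * \<xi> ^ n" for n
      unfolding a_def by (simp del: of_nat_Suc)
    moreover have "(\<Sum>n. ?t n z) = g z * (1 / (1 - \<xi> * cnj (\<phi> z))\<^sup>2)" for z
    proof -
      have "cmod (\<xi> * cnj (\<phi> z)) < 1"
        using \<xi> \<phi>1[of z] by (simp add: norm_mult) (metis mult_strict_mono' norm_ge_zero mult_1)
      then have "(\<lambda>n. g z * (of_nat (Suc n) * (\<xi> * cnj (\<phi> z)) ^ n)) sums (g z * (1 / (1 - \<xi> * cnj (\<phi> z))\<^sup>2))"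
        by (intro sums_mult geometric_deriv_sums)
      then show ?thesis by (simp add: sums_iff power_mult_distrib mult_ac del: of_nat_Suc)
    qed
    ultimately show ?thesis by (simp only:)
  qed
  define H where "H \<xi> = (\<integral>z. g z * (1 / (1 - \<xi> * cnj (\<phi> z))\<^sup>2) \<partial>lborel) / ker p p" for \<xi>
  have "(\<lambda>\<xi>. \<integral>z. g z * (1 / (1 - \<xi> * cnj (\<phi> z))\<^sup>2) \<partial>lborel) holomorphic_on ball 0 1"
    by (rule power_series_holomorphic[of 0 1 "\<lambda>n. of_nat (Suc n) * a n"]) (use key in auto)
  then have "H holomorphic_on ball 0 1"
    unfolding H_def using ker_diag_ne[OF p] by (intro holomorphic_intros) auto
  moreover have "f w = ker w p * H (F w)" if w: "w \<in> D" for w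
  proof -
    have "f w = (\<integral>z. indicator D z *\<^sub>R (f z * cnj (rep w z)) \<partial>lborel)"
      using reproducing[OF w f] by (simp add: bergman_inner_def set_lebesgue_integral_def)
    also have "\<dots> = (\<integral>z. ker w p / ker p p * (g z * (1 / (1 - F w * cnj (\<phi> z))\<^sup>2)) \<partial>lborel)"
    proof (intro Bochner_Integration.integral_cong refl)
      fix z
      show "indicator D z *\<^sub>R (f z * cnj (rep w z)) = ker w p / ker p p * (g z * (1 / (1 - F w * cnj (\<phi> z))\<^sup>2))"
      proof (cases "z \<in> D")
        case True
        have e: "ker w z * ker p p * (1 - F w * cnj (F z))\<^sup>2 = ker w p * ker p z" by (rule id[OF w True])
        have "cmod (F w * cnj (F z)) < 1"
        proof -
          have "cmod (F w) < 1" "cmod (F z) < 1" using lF w True by auto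
          then show ?thesis by (simp add: norm_mult) (metis mult_strict_mono' norm_ge_zero mult_1)
        qed
        then have ne: "1 - F w * cnj (F z) \<noteq> 0" by auto
        have "cnj (rep w z) = ker w z" using ker_cnj[OF w True] by (simp add: ker_def)
        also have "\<dots> = ker w p * ker p z / (ker p p * (1 - F w * cnj (F z))\<^sup>2)"
          using e ne ker_diag_ne[OF p] by (simp add: field_simps)
        finally have "cnj (rep w z) = ker w p * ker p z / (ker p p * (1 - F w * cnj (F z))\<^sup>2)" .
        moreover have "cnj (rep p z) = ker p z" using ker_cnj[OF p True] by (simp add: ker_def)
        ultimately show ?thesis using True by (simp add: g_def \<phi>_def)
      qed (simp add: g_def)
    qed
    also have "\<dots> = ker w p * H (F w)"
      by (simp only: H_def Bochner_Integration.integral_mult_right_zero) simp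
    finally show ?thesis .
  qed
  ultimately show thesis by (rule that)
qed

end

subsection \<open>Logarithmic potentials\<close>

text \<open>\<open>ennreal\<close> cuts negative values off at zero, so this is the positive part of
  \<open>log (R / |\<zeta>|)\<close>. Extended values make it continuous on the whole plane, pole
  included.\<close>

definition log_pot :: "real \<Rightarrow> complex \<Rightarrow> ennreal" where
  "log_pot R \<zeta> = (if \<zeta> = 0 then \<infinity> else ennreal (ln (R / cmod \<zeta>)))"

lemma less_log_pot_iff:
  assumes "0 < R" "0 \<le> x"
  shows "ennreal x < log_pot R \<zeta> \<longleftrightarrow> cmod \<zeta> < R * exp (- x)"
proof (cases "\<zeta> = 0")
  case False
  then have "x < ln (R / cmod \<zeta>) \<longleftrightarrow> exp x < R / cmod \<zeta>"
    using assms by (metis divide_pos_pos exp_less_cancel_iff exp_ln zero_less_norm_iff)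
  also have "\<dots> \<longleftrightarrow> cmod \<zeta> < R * exp (- x)"
    using False by (simp add: exp_minus field_simps)
  finally show ?thesis using False assms by (simp add: log_pot_def ennreal_less_iff)
qed (use assms in \<open>simp add: log_pot_def\<close>)

lemma isCont_log_pot:
  assumes "0 < R"
  shows "isCont (log_pot R) \<zeta>"
proof (cases "\<zeta> = 0")
  case True
  have "(log_pot R \<longlongrightarrow> top) (at 0)"
    unfolding tendsto_top_iff_ennreal
  proof (intro allI impI)
    fix l :: real assume l: "0 \<le> l"
    have "\<forall>\<^sub>F x in at 0. x \<in> ball 0 (R * exp (- l))"
      using assms by (intro eventually_at_in_open') auto
    then show "\<forall>\<^sub>F x in at 0. ennreal l < log_pot R x"
      by eventually_elim (simp add: less_log_pot_iff assms l)
  qed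
  then show ?thesis using True by (simp add: isCont_def log_pot_def)
next
  case False
  have "((\<lambda>x. ennreal (ln (R / cmod x))) \<longlongrightarrow> ennreal (ln (R / cmod \<zeta>))) (at \<zeta>)"
    using False assms by (intro tendsto_intros) auto
  moreover have "\<forall>\<^sub>F x in at \<zeta>. ennreal (ln (R / cmod x)) = log_pot R x"
    using False eventually_at_in_open'[of "-{0}" \<zeta>] by (auto elim!: eventually_mono simp: log_pot_def)
  ultimately show ?thesis using False by (auto simp: isCont_def log_pot_def intro: Lim_transform_eventually)
qed

text \<open>The real part of the mean value property for \<open>Ln (1 + b * u)\<close>, which is
  holomorphic beyond the unit disc because \<open>b\<close> has modulus below one.\<close>

lemma has_integral_ln_one_plus:
  assumes "cmod b < 1"
  shows "((\<lambda>t. ln (cmod (1 + b * cis t))) has_integral 0) {0..2*pi}"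
proof -
  define \<rho> where "\<rho> = (if b = 0 then 2 else 1 / cmod b)"
  have \<rho>: "1 < \<rho>" using assms by (simp add: \<rho>_def)
  have small: "cmod (b * u) < 1" if "u \<in> ball 0 \<rho>" for u
    using that by (cases "b = 0") (auto simp: \<rho>_def norm_mult field_simps)
  have pos: "0 < Re (1 + b * u)" if "u \<in> ball 0 \<rho>" for u
    using small[OF that] abs_Re_le_cmod[of "b * u"] by simp
  have "(\<lambda>u. Ln (1 + b * u)) holomorphic_on ball 0 \<rho>"
    using pos by (intro holomorphic_intros) (force simp: complex_nonpos_Reals_iff)
  from has_integral_circle_mean[OF this, of 1] \<rho>
  have "((\<lambda>t. Ln (1 + b * cis t)) has_integral 0) {0..2*pi}" by simp
  then have "((\<lambda>t. Re (Ln (1 + b * cis t))) has_integral Re 0) {0..2*pi}"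
    by (rule has_integral_Re)
  moreover have "Re (Ln (1 + b * cis t)) = ln (cmod (1 + b * cis t))" for t
  proof (rule Re_Ln)
    have "Re (1 + b * cis t) \<noteq> 0" using pos[of "cis t"] \<rho> by (auto simp del: plus_complex.sel)
    then show "1 + b * cis t \<noteq> 0" by (metis zero_complex.sel(1))
  qed
  ultimately show ?thesis by simp
qed

text \<open>Jensen's formula: the mean of the logarithm is that of \<open>R\<close> over the larger
  of \<open>cmod a\<close> and \<open>r\<close>. If they are equal, \<open>a\<close> is shrunk
  radially and Fatou's lemma applies. The condition on \<open>R\<close> keeps the circle inside the
  region where \<open>log_pot\<close> is not cut off.\<close>

lemma nn_integral_log_pot_circle:
  assumes r: "0 < r" and R: "cmod a + r < R"
  shows "(\<integral>\<^sup>+ t\<in>{0..2*pi}. log_pot R (a + of_real r * cis t) \<partial>lborel) \<le> ennreal (2 * pi) * log_pot R a"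
proof -
  have R0: "0 < R" using r R norm_ge_zero[of a] by linarith
  have leR: "cmod (a + of_real r * cis t) \<le> R" if "cmod a + r < R" for a t
    using norm_triangle_ineq[of a "of_real r * cis t"] r that by (simp add: norm_mult)
  have aux: "(\<integral>\<^sup>+ t\<in>{0..2*pi}. log_pot R (a + of_real r * cis t) \<partial>lborel) = ennreal (2 * pi * ln (R / m))"
    if m: "0 < m" and b: "cmod b < 1" and eq: "\<And>t. cmod (a + of_real r * cis t) = m * cmod (1 + b * cis t)"
      and aR: "cmod a + r < R" for a b m
  proof -
    have nz: "0 < cmod (1 + b * cis t)" for t
    proof -
      have "cmod (b * cis t) < 1" using b by (simp add: norm_mult)
      then have "1 + b * cis t \<noteq> 0" by (metis add_eq_0_iff norm_minus_cancel norm_one less_irrefl)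
      then show ?thesis by simp
    qed
    have "((\<lambda>t. ln (R / m) - ln (cmod (1 + b * cis t))) has_integral (2 * pi) *\<^sub>R ln (R / m) - 0) {0..2*pi}"
      using has_integral_const_real[of "ln (R / m)" 0 "2*pi"] has_integral_ln_one_plus[OF b]
      by (intro has_integral_diff) auto
    moreover have e: "ln (R / m) - ln (cmod (1 + b * cis t)) = ln (R / cmod (a + of_real r * cis t))" for t
      unfolding eq using R0 m nz[of t] by (simp add: ln_div ln_mult)
    ultimately have I: "((\<lambda>t. ln (R / cmod (a + of_real r * cis t))) has_integral 2 * pi * ln (R / m)) {0..2*pi}"
      by simp
    have p: "0 < cmod (a + of_real r * cis t)" for t unfolding eq using m nz[of t] by simp
    have "(\<integral>\<^sup>+ t\<in>{0..2*pi}. log_pot R (a + of_real r * cis t) \<partial>lborel)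
       = (\<integral>\<^sup>+ t\<in>{0..2*pi}. ennreal (ln (R / cmod (a + of_real r * cis t))) \<partial>lborel)"
      using p by (intro nn_integral_cong) (simp add: log_pot_def)
    also have "\<dots> = ennreal (2 * pi * ln (R / m))"
      by (rule nn_integral_has_integral_lebesgue'[OF _ I]) (use p leR[OF aR] in auto)
    finally show ?thesis .
  qed
  have lt: "(\<integral>\<^sup>+ t\<in>{0..2*pi}. log_pot R (a + of_real r * cis t) \<partial>lborel) \<le> ennreal (2 * pi) * log_pot R a"
    if ar: "cmod a < r" and aR: "cmod a + r < R" for a
  proof (cases "a = 0")
    case True
    then show ?thesis by (simp add: log_pot_def ennreal_mult_top)
  next
    case False
    have "cmod (a + of_real r * cis t) = r * cmod (1 + (cnj a / r) * cis t)" for t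
    proof -
      \<comment> \<open>Conjugating the second factor preserves its modulus and brings it to the
        form \<open>1 + b * cis t\<close> with \<open>b\<close> of modulus below one.\<close>
      have "a + of_real r * cis t = of_real r * cis t * cnj (1 + (cnj a / r) * cis t)"
        using r by (simp add: field_simps cis_cnj) (simp add: cis_mult mult.assoc[symmetric] mult.commute)
      then have "cmod (a + of_real r * cis t) = cmod (of_real r * cis t) * cmod (cnj (1 + (cnj a / r) * cis t))"
        by (simp only: norm_mult)
      moreover have "cmod (of_real r * cis t) = r" using r by (simp add: norm_mult)
      ultimately show ?thesis by (simp only: complex_mod_cnj)
    qed
    then have "(\<integral>\<^sup>+ t\<in>{0..2*pi}. log_pot R (a + of_real r * cis t) \<partial>lborel) = ennreal (2 * pi * ln (R / r))"
      using ar r aR by (intro aux[where b = "cnj a / r"]) (auto simp: norm_divide)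
    also have "\<dots> \<le> ennreal (2 * pi * ln (R / cmod a))"
      using False ar r R0 by (intro ennreal_leI mult_left_mono) (auto simp: frac_le)
    also have "\<dots> = ennreal (2 * pi) * log_pot R a"
      using False by (simp add: log_pot_def ennreal_mult')
    finally show ?thesis .
  qed
  show ?thesis
  proof (cases "cmod a < r")
    case True
    then show ?thesis using lt R by blast
  next
    case False
    show ?thesis
    proof (cases "r < cmod a")
      case True
      then have a0: "a \<noteq> 0" using r by auto
      have "cmod (a + of_real r * cis t) = cmod a * cmod (1 + (of_real r / a) * cis t)" for t
      proof -
        have "a + of_real r * cis t = a * (1 + (of_real r / a) * cis t)"
          using a0 by (simp add: field_simps)
        then show ?thesis by (simp add: norm_mult)
      qed
      then have "(\<integral>\<^sup>+ t\<in>{0..2*pi}. log_pot R (a + of_real r * cis t) \<partial>lborel) = ennreal (2 * pi * ln (R / cmod a))"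
        using True r R a0 by (intro aux[where b = "of_real r / a"]) (auto simp: norm_divide)
      also have "\<dots> = ennreal (2 * pi) * log_pot R a"
        using a0 by (simp add: log_pot_def ennreal_mult')
      finally show ?thesis by simp
    next
      case False
      with \<open>\<not> cmod a < r\<close> have ar: "cmod a = r" by simp
      define s where "s n = 1 - 1 / real (n + 2)" for n
      have s: "0 < s n" "s n < 1" for n by (auto simp: s_def)
      have "(\<lambda>n. 1 / real (n + 2)) \<longlonglongrightarrow> 0"
        using LIMSEQ_ignore_initial_segment[OF lim_inverse_n', of 2] by simp
      then have "s \<longlonglongrightarrow> 1 - 0" unfolding s_def by (intro tendsto_diff tendsto_const)
      then have s1: "s \<longlonglongrightarrow> 1" by simp
      have lim: "(\<lambda>n. log_pot R (of_real (s n) * a + b)) \<longlonglongrightarrow> log_pot R (a + b)" for b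
      proof (rule isCont_tendsto_compose[OF isCont_log_pot[OF R0]])
        show "(\<lambda>n. of_real (s n) * a + b) \<longlonglongrightarrow> a + b"
          using s1 by (auto intro!: tendsto_eq_intros)
      qed
      have le: "cmod (of_real (s n) * a) < r" "cmod (of_real (s n) * a) + r < R" for n
      proof -
        have "cmod (of_real (s n) * a) = s n * r" using s(1)[of n] ar by (simp add: norm_mult)
        moreover have "s n * r < 1 * r" using s(2)[of n] r by (rule mult_strict_right_mono)
        ultimately show "cmod (of_real (s n) * a) < r" "cmod (of_real (s n) * a) + r < R"
          using R ar by linarith+
      qed
      have [measurable]: "log_pot R \<in> borel_measurable borel"
        using isCont_log_pot[OF R0] by (intro borel_measurable_continuous_onI continuous_at_imp_continuous_on) auto
      have [measurable]: "(\<lambda>t. b + of_real r * cis t) \<in> borel \<rightarrow>\<^sub>M borel" for b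
        by (intro borel_measurable_continuous_onI continuous_intros)
      have "(\<integral>\<^sup>+ t\<in>{0..2*pi}. log_pot R (a + of_real r * cis t) \<partial>lborel)
         = (\<integral>\<^sup>+ t. liminf (\<lambda>n. log_pot R (of_real (s n) * a + of_real r * cis t) * indicator {0..2*pi} t) \<partial>lborel)"
      proof (intro nn_integral_cong)
        fix t :: real
        have "(\<lambda>n. log_pot R (of_real (s n) * a + of_real r * cis t) * indicator {0..2*pi} t) \<longlonglongrightarrow> log_pot R (a + of_real r * cis t) * indicator {0..2*pi} t"
          using lim[of "of_real r * cis t"] by (cases "t \<in> {0..2*pi}") auto
        then show "log_pot R (a + of_real r * cis t) * indicator {0..2*pi} t =
          liminf (\<lambda>n. log_pot R (of_real (s n) * a + of_real r * cis t) * indicator {0..2*pi} t)"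
          by (rule lim_imp_Liminf[symmetric, rotated]) simp
      qed
      also have "\<dots> \<le> liminf (\<lambda>n. \<integral>\<^sup>+ t. log_pot R (of_real (s n) * a + of_real r * cis t) * indicator {0..2*pi} t \<partial>lborel)"
        by (rule nn_integral_liminf) measurable
      also have "\<dots> \<le> liminf (\<lambda>n. ennreal (2 * pi) * log_pot R (of_real (s n) * a))"
        by (rule Liminf_mono) (use lt[OF le] in auto)
      also have "\<dots> = ennreal (2 * pi) * log_pot R a"
        using ennreal_tendsto_cmult[OF _ lim[of 0], of "ennreal (2 * pi)"]
        by (intro lim_imp_Liminf) auto
      finally show ?thesis .
    qed
  qed
qed

section \<open>Superharmonic potentials and their series\<close>

definition superharmonic_pot :: "complex set \<Rightarrow> (complex \<Rightarrow> ennreal) \<Rightarrow> bool" where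
  "superharmonic_pot U v \<longleftrightarrow> continuous_on UNIV v \<and>
     (\<forall>w r. 0 < r \<and> cball w r \<subseteq> U \<longrightarrow>
        (\<integral>\<^sup>+ t\<in>{0..2*pi}. v (w + of_real r * cis t) \<partial>lborel) \<le> ennreal (2 * pi) * v w)"

lemma superharmonic_pot_measurable:
  assumes "superharmonic_pot U v"
  shows "(\<lambda>t. v (w + of_real r * cis t) * indicator {0..2*pi} t) \<in> borel_measurable borel"
proof -
  have [measurable]: "v \<in> borel_measurable borel"
    using assms by (intro borel_measurable_continuous_onI) (auto simp: superharmonic_pot_def)
  have [measurable]: "(\<lambda>t. w + of_real r * cis t) \<in> borel \<rightarrow>\<^sub>M borel"
    by (intro borel_measurable_continuous_onI continuous_intros)
  show ?thesis by measurable
qed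

text \<open>A closed disc in \<open>ball a (R / 3)\<close> has centre within \<open>R / 3\<close> of
  \<open>a\<close> and radius below \<open>2 * R / 3\<close>, as the circle inequality for
  \<open>log_pot\<close> requires.\<close>

lemma superharmonic_pot_log:
  assumes R: "0 < R" and U: "U \<subseteq> ball a (R / 3)"
  shows "superharmonic_pot U (\<lambda>\<zeta>. log_pot R (\<zeta> - a))"
  unfolding superharmonic_pot_def
proof (intro conjI allI impI)
  show "continuous_on UNIV (\<lambda>\<zeta>. log_pot R (\<zeta> - a))"
  proof (rule continuous_on_compose2[of UNIV "log_pot R" UNIV "\<lambda>\<zeta>. \<zeta> - a"])
    show "continuous_on UNIV (log_pot R)"
      using isCont_log_pot[OF R] by (simp add: continuous_at_imp_continuous_on)
  qed (auto intro: continuous_intros)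
  fix w r assume wr: "0 < r \<and> cball w r \<subseteq> U"
  then have "w \<in> ball a (R / 3)" "w + of_real r \<in> ball a (R / 3)" using U by (auto simp: subset_iff dist_norm)
  then have "cmod (w - a) < R / 3" "cmod (w + of_real r - a) < R / 3" by (auto simp: dist_norm norm_minus_commute)
  moreover have "r \<le> cmod (w + of_real r - a) + cmod (w - a)"
    using norm_triangle_ineq4[of "w + of_real r - a" "w - a"] wr by simp
  ultimately have "cmod (w - a) + r < R" by linarith
  then show "(\<integral>\<^sup>+ t\<in>{0..2*pi}. log_pot R (w + of_real r * cis t - a) \<partial>lborel) \<le> ennreal (2 * pi) * log_pot R (w - a)"
    using nn_integral_log_pot_circle[of r "w - a" R] wr by (simp add: algebra_simps)
qed

lemma superharmonic_pot_add:
  assumes "superharmonic_pot U v1" "superharmonic_pot U v2"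
  shows "superharmonic_pot U (\<lambda>\<zeta>. v1 \<zeta> + v2 \<zeta>)"
  unfolding superharmonic_pot_def
proof (intro conjI allI impI)
  show "continuous_on UNIV (\<lambda>\<zeta>. v1 \<zeta> + v2 \<zeta>)"
    using assms by (auto simp: superharmonic_pot_def intro!: continuous_intros)
  fix w r assume wr: "0 < r \<and> cball w r \<subseteq> U"
  have "(\<integral>\<^sup>+ t\<in>{0..2*pi}. (v1 (w + of_real r * cis t) + v2 (w + of_real r * cis t)) \<partial>lborel)
    = (\<integral>\<^sup>+ t\<in>{0..2*pi}. v1 (w + of_real r * cis t) \<partial>lborel) + (\<integral>\<^sup>+ t\<in>{0..2*pi}. v2 (w + of_real r * cis t) \<partial>lborel)"
    by (subst nn_integral_add[symmetric]) (auto intro!: superharmonic_pot_measurable assms nn_integral_cong simp: distrib_right)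
  also have "\<dots> \<le> ennreal (2 * pi) * v1 w + ennreal (2 * pi) * v2 w"
    using assms wr by (intro add_mono) (auto simp: superharmonic_pot_def)
  finally show "(\<integral>\<^sup>+ t\<in>{0..2*pi}. (v1 (w + of_real r * cis t) + v2 (w + of_real r * cis t)) \<partial>lborel)
     \<le> ennreal (2 * pi) * (v1 w + v2 w)" by (simp add: distrib_left)
qed

lemma superharmonic_pot_cmult:
  assumes "superharmonic_pot U v"
  shows "superharmonic_pot U (\<lambda>\<zeta>. ennreal c * v \<zeta>)"
  unfolding superharmonic_pot_def
proof (intro conjI allI impI)
  show "continuous_on UNIV (\<lambda>\<zeta>. ennreal c * v \<zeta>)"
    using assms unfolding superharmonic_pot_def continuous_on_def
    by (auto intro!: ennreal_tendsto_cmult)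
  fix w r assume wr: "0 < r \<and> cball w r \<subseteq> U"
  have "(\<integral>\<^sup>+ t\<in>{0..2*pi}. ennreal c * v (w + of_real r * cis t) \<partial>lborel)
    = ennreal c * (\<integral>\<^sup>+ t\<in>{0..2*pi}. v (w + of_real r * cis t) \<partial>lborel)"
    by (subst nn_integral_cmult[symmetric]) (auto intro!: superharmonic_pot_measurable assms nn_integral_cong simp: mult.assoc)
  also have "\<dots> \<le> ennreal c * (ennreal (2 * pi) * v w)"
    using assms wr by (intro mult_left_mono) (auto simp: superharmonic_pot_def)
  finally show "(\<integral>\<^sup>+ t\<in>{0..2*pi}. ennreal c * v (w + of_real r * cis t) \<partial>lborel) \<le> ennreal (2 * pi) * (ennreal c * v w)"
    by (simp add: mult_ac)
qed

lemma superharmonic_pot_zero: "superharmonic_pot U (\<lambda>\<zeta>. 0)"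
  by (simp add: superharmonic_pot_def)

lemma superharmonic_pot_sum:
  "finite I \<Longrightarrow> (\<And>i. i \<in> I \<Longrightarrow> superharmonic_pot U (v i)) \<Longrightarrow> superharmonic_pot U (\<lambda>\<zeta>. \<Sum>i\<in>I. v i \<zeta>)"
  by (induction I rule: finite_induct) (auto intro: superharmonic_pot_zero superharmonic_pot_add)

text \<open>Partial sums are continuous and increase, so strict superlevel sets of the sum are open,
  and nonnegative terms are integrated one by one. The function is nonpositive, so the positive part
  in \<open>circle_mean\<close> contributes nothing.\<close>

lemma subharmonic_uminus_suminf:
  assumes U: "open U" and v: "\<And>k::nat. superharmonic_pot U (v k)"
  shows "subharmonic_on (\<lambda>\<zeta>. - enn2ereal (\<Sum>k. v k \<zeta>)) U"
  unfolding subharmonic_on_def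
proof (intro conjI ballI allI)
  define V where "V \<zeta> = (\<Sum>k. v k \<zeta>)" for \<zeta>
  have openV: "open {\<zeta>. c < V \<zeta>}" for c
  proof -
    have "{\<zeta>. c < V \<zeta>} = (\<Union>n. {\<zeta>. c < (\<Sum>k<n. v k \<zeta>)})"
      unfolding V_def suminf_eq_SUP by (auto simp: less_SUP_iff)
    moreover have "open {\<zeta>. c < (\<Sum>k<n. v k \<zeta>)}" for n
      using superharmonic_pot_sum[of "{..<n}" U v] v
      by (intro open_Collect_less continuous_on_const) (auto simp: superharmonic_pot_def)
    ultimately show ?thesis by auto
  qed
  show "- enn2ereal (\<Sum>k. v k z) < \<infinity>" for z
    using enn2ereal_nonneg[of "\<Sum>k. v k z"] by (cases "enn2ereal (\<Sum>k. v k z)") auto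
  show "openin (top_of_set U) {z \<in> U. - enn2ereal (\<Sum>k. v k z) < c}" for c
  proof (cases "- c < 0")
    case True
    have "- enn2ereal x < c" for x
    proof -
      have "- enn2ereal x \<le> 0" using enn2ereal_nonneg[of x] by (simp add: ereal_uminus_le_reorder)
      also have "0 < c" using True by (simp add: ereal_uminus_less_reorder)
      finally show ?thesis .
    qed
    then show ?thesis by simp
  next
    case False
    then have "enn2ereal (e2ennreal (- c)) = - c" by (intro enn2ereal_e2ennreal) (simp only: not_less)
    then have "- enn2ereal (V z) < c \<longleftrightarrow> e2ennreal (- c) < V z" for z
      by (simp add: less_ennreal.rep_eq ereal_uminus_less_reorder)
    then have "{z \<in> U. - enn2ereal (\<Sum>k. v k z) < c} = U \<inter> {z. e2ennreal (- c) < V z}"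
      by (auto simp: V_def)
    then show ?thesis using openV by (auto simp: openin_open)
  qed
  fix w assume w: "w \<in> U"
  obtain \<rho> where \<rho>: "0 < \<rho>" "ball w \<rho> \<subseteq> U" using U w open_contains_ball by blast
  show "\<exists>\<rho>>0. \<forall>r. 0 < r \<and> r < \<rho> \<longrightarrow> - enn2ereal (\<Sum>k. v k w) \<le> circle_mean (\<lambda>\<zeta>. - enn2ereal (\<Sum>k. v k \<zeta>)) w r"
  proof (intro exI[of _ \<rho>] conjI allI impI \<rho>(1))
    fix r assume r: "0 < r \<and> r < \<rho>"
    then have sub: "cball w r \<subseteq> U" using \<rho>(2) by (auto simp: subset_iff)
    define I where "I = (\<integral>\<^sup>+ t\<in>{0..2*pi}. V (w + of_real r * cis t) \<partial>lborel)"
    have "I = (\<integral>\<^sup>+ t. (\<Sum>k. v k (w + of_real r * cis t) * indicator {0..2*pi} t) \<partial>lborel)"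
      unfolding I_def V_def by (intro nn_integral_cong) simp
    also have "\<dots> = (\<Sum>k. \<integral>\<^sup>+ t\<in>{0..2*pi}. v k (w + of_real r * cis t) \<partial>lborel)"
      by (rule nn_integral_suminf) (simp add: superharmonic_pot_measurable[OF v])
    also have "\<dots> \<le> (\<Sum>k. ennreal (2 * pi) * v k w)"
      using v r sub by (intro suminf_le) (auto simp: superharmonic_pot_def)
    also have "\<dots> = ennreal (2 * pi) * V w" by (simp add: V_def)
    finally have I: "I \<le> ennreal (2 * pi) * V w" .
    have neg: "e2ennreal (- enn2ereal x) = 0" for x
      using enn2ereal_nonneg[of x] by (intro e2ennreal_neg) (simp add: ereal_uminus_le_reorder)
    have cm: "circle_mean (\<lambda>\<zeta>. - enn2ereal (V \<zeta>)) w r = (0 - enn2ereal I) / ereal (2 * pi)"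
      unfolding circle_mean_def by (simp add: neg I_def e2ennreal_enn2ereal zero_ennreal.rep_eq)
    have "- enn2ereal (V w) \<le> (0 - enn2ereal I) / ereal (2 * pi)"
    proof (cases "V w")
      case (real x)
      have "I \<le> ennreal (2 * pi * x)" using I real by (simp add: ennreal_mult')
      then have "enn2ereal I \<le> ereal (2 * pi * x)"
        using real(1) by (simp add: less_eq_ennreal.rep_eq enn2ereal_ennreal)
      then obtain y where y: "enn2ereal I = ereal y" "y \<le> 2 * pi * x"
        using enn2ereal_nonneg[of I] by (cases "enn2ereal I") auto
      then have "y / (2 * pi) \<le> x" by (simp add: field_simps)
      then show ?thesis using real y by (simp add: enn2ereal_ennreal)
    next
      case top
      then show ?thesis by simp
    qed
    then show "- enn2ereal (\<Sum>k. v k w) \<le> circle_mean (\<lambda>\<zeta>. - enn2ereal (\<Sum>k. v k \<zeta>)) w r"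
      using cm by (simp add: V_def)
  qed
qed

text \<open>The function is minus a series: a logarithmic pole at \<open>z\<close>, and for each
  \<open>k\<close> the mean potential of points of \<open>C\<close> that is at least
  \<open>4 ^ k\<close> on \<open>K k\<close>, weighted by \<open>1 / 2 ^ k\<close>. On
  \<open>K j\<close> the weighted terms with \<open>k \<ge> j\<close> are at least
  \<open>2 ^ k\<close>, so the sum is infinite; at \<open>b\<close>, which has positive distance
  from \<open>C\<close>, the weights make it converge.\<close>

lemma polar_neighbourhood:
  fixes z :: complex
  assumes \<epsilon>: "0 < \<epsilon>" and C: "closed C" "z \<in> C" "C \<subseteq> cball z \<epsilon>" and b: "b \<in> ball z \<epsilon>" "b \<notin> C"
    and cover: "P \<inter> ball z \<epsilon> \<subseteq> insert z (\<Union>j. K j)" and inc: "incseq K"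
    and pots: "\<And>(j::nat) M. \<exists>n w. 0 < n \<and> (\<forall>i<n. w i \<in> C) \<and>
       (\<forall>\<zeta>\<in>K j. ennreal (real n * M) \<le> (\<Sum>i<n. log_pot (9 * \<epsilon>) (\<zeta> - w i)))"
  shows "\<exists>u. subharmonic_on u (ball z \<epsilon>) \<and> (\<exists>w\<in>ball z \<epsilon>. u w \<noteq> -\<infinity>) \<and> P \<inter> ball z \<epsilon> \<subseteq> {w. u w = -\<infinity>}"
proof -
  \<comment> \<open>Points of the ball are less than \<open>2 * \<epsilon>\<close> away from points
    of \<open>C\<close>, hence within \<open>R / 3 = 3 * \<epsilon>\<close>.\<close>
  define R where "R = 9 * \<epsilon>"
  have R: "0 < R" using \<epsilon> by (simp add: R_def)
  have "\<forall>k. \<exists>n w. 0 < n \<and> (\<forall>i<n. w i \<in> C) \<and>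
     (\<forall>\<zeta>\<in>K k. ennreal (real n * 4 ^ k) \<le> (\<Sum>i<n. log_pot R (\<zeta> - w i)))"
    using pots unfolding R_def by blast
  then obtain n w where n: "\<And>k. 0 < n k" and w: "\<And>k i. i < n k \<Longrightarrow> w k i \<in> C"
    and big: "\<And>k \<zeta>. \<zeta> \<in> K k \<Longrightarrow> ennreal (real (n k) * 4 ^ k) \<le> (\<Sum>i<n k. log_pot R (\<zeta> - w k i))"
    by metis
  define c where "c k = 1 / (2 ^ k * real (n k))" for k
  define v where "v k \<zeta> = (case k of 0 \<Rightarrow> log_pot R (\<zeta> - z) | Suc k \<Rightarrow> ennreal (c k) * (\<Sum>i<n k. log_pot R (\<zeta> - w k i)))" for k \<zeta>
  have ball: "ball z \<epsilon> \<subseteq> ball a (R / 3)" if "a \<in> C" for a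
  proof
    fix x assume "x \<in> ball z \<epsilon>"
    moreover have "dist z a \<le> \<epsilon>" using that C by auto
    ultimately show "x \<in> ball a (R / 3)"
      using dist_triangle[of a x z] \<epsilon> by (simp add: R_def dist_commute)
  qed
  have sv: "superharmonic_pot (ball z \<epsilon>) (v k)" for k
    unfolding v_def
    by (cases k) (auto intro!: superharmonic_pot_log superharmonic_pot_cmult superharmonic_pot_sum R ball C w)
  define u where "u \<zeta> = - enn2ereal (\<Sum>k. v k \<zeta>)" for \<zeta>
  have "subharmonic_on u (ball z \<epsilon>)"
    unfolding u_def by (intro subharmonic_uminus_suminf sv) auto
  moreover have "u b \<noteq> -\<infinity>"
  proof -
    obtain \<delta> where \<delta>: "0 < \<delta>" "ball b \<delta> \<subseteq> - C"
      using C(1) b(2) open_contains_ball[of "-C"] by auto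
    have far: "\<delta> \<le> cmod (b - a)" if "a \<in> C" for a
      using \<delta>(2) that by (force simp: dist_norm)
    define l where "l = ln (R / \<delta>)"
    have "\<delta> \<le> \<epsilon>" using far[OF C(2)] b by (simp add: dist_norm norm_minus_commute)
    then have l0: "0 \<le> l" using \<delta> \<epsilon> by (simp add: l_def R_def)
    have lp: "log_pot R (b - a) \<le> ennreal l" if "a \<in> C" for a
    proof -
      have "ln (R / cmod (b - a)) \<le> l"
      proof -
        have "0 < cmod (b - a)" using far[OF that] \<delta> by linarith
        then show ?thesis
          unfolding l_def using far[OF that] \<delta>(1) R by (intro ln_mono divide_left_mono) auto
      qed
      then show ?thesis using far[OF that] \<delta> by (auto simp: log_pot_def intro: ennreal_leI)
    qed
    have "v k b \<le> ennreal (l * 2 * (1/2) ^ k)" for k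
    proof (cases k)
      case 0
      then show ?thesis using lp[OF C(2)] l0 by (auto simp: v_def intro: order_trans ennreal_leI)
    next
      case (Suc k)
      have "(\<Sum>i<n k. log_pot R (b - w k i)) \<le> (\<Sum>i<n k. ennreal l)"
        by (intro sum_mono lp w) auto
      then have "v (Suc k) b \<le> ennreal (c k) * (\<Sum>i<n k. ennreal l)"
        by (simp add: v_def mult_left_mono)
      also have "\<dots> = ennreal (c k * (real (n k) * l))"
      proof -
        have "(\<Sum>i<n k. ennreal l) = ennreal (real (n k) * l)"
          using l0 by (simp add: ennreal_mult ennreal_of_nat_eq_real_of_nat)
        moreover have "0 \<le> c k" by (simp add: c_def)
        ultimately show ?thesis by (simp only: ennreal_mult')
      qed
      also have "c k * (real (n k) * l) = l * 2 * (1/2) ^ Suc k"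
        using n[of k] by (simp add: c_def field_simps)
      finally show ?thesis using Suc by simp
    qed
    then have "(\<Sum>k. v k b) \<le> (\<Sum>k. ennreal (l * 2 * (1/2) ^ k))" by (intro suminf_le) auto
    also have "\<dots> = ennreal (l * 2 * 2)"
      using sums_mult[OF geometric_sums[of "1/2::real"], of "l * 2"] l0
      by (intro suminf_ennreal_eq) auto
    finally have "(\<Sum>k. v k b) \<noteq> top" using ennreal_neq_top neq_top_trans by blast
    then obtain x where "(\<Sum>k. v k b) = ennreal x" "0 \<le> x" by (cases "\<Sum>k. v k b") auto
    then show ?thesis by (simp add: u_def enn2ereal_ennreal)
  qed
  moreover have "u \<zeta> = -\<infinity>" if \<zeta>: "\<zeta> \<in> P \<inter> ball z \<epsilon>" for \<zeta>
  proof -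
    have "(\<Sum>k. v k \<zeta>) = top"
    proof (cases "\<zeta> = z")
      case True
      have "v 0 \<zeta> \<le> (\<Sum>k. v k \<zeta>)" by (rule le_suminf_ennreal)
      then show ?thesis using True by (simp add: v_def log_pot_def top_unique)
    next
      case False
      then obtain j where j: "\<zeta> \<in> K j" using cover \<zeta> by blast
      have ge: "ennreal (2 ^ k) \<le> (\<Sum>k. v k \<zeta>)" if "j \<le> k" for k
      proof -
        have "\<zeta> \<in> K k" using j inc that by (auto simp: incseq_def)
        have "ennreal (2 ^ k) = ennreal (c k) * ennreal (real (n k) * 4 ^ k)"
          using n[of k] by (subst ennreal_mult'[symmetric]) (auto simp: c_def field_simps power_mult_distrib[symmetric])
        also have "\<dots> \<le> v (Suc k) \<zeta>"
          using big[OF \<open>\<zeta> \<in> K k\<close>] by (simp add: v_def mult_left_mono)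
        also have "\<dots> \<le> (\<Sum>k. v k \<zeta>)" by (rule le_suminf_ennreal)
        finally show ?thesis .
      qed
      show ?thesis
      proof (rule ccontr)
        assume "(\<Sum>k. v k \<zeta>) \<noteq> top"
        then obtain x where x: "(\<Sum>k. v k \<zeta>) = ennreal x" "0 \<le> x" by (cases "\<Sum>k. v k \<zeta>") auto
        obtain m where "x < 2 ^ m" using real_arch_pow[of 2 x] by auto
        also have "(2::real) ^ m \<le> 2 ^ (max m j)" by (intro power_increasing) auto
        finally show False using ge[of "max m j"] x by simp
      qed
    qed
    then show ?thesis by (simp add: u_def)
  qed
  ultimately show ?thesis using b(1) by blast
qed

text \<open>Leja points: each point maximizes the product of the distances to its predecessors. The
  recursion carries the list of predecessors; for the first point the product is empty and any
  choice is maximal.\<close>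

lemma Leja_sequence:
  fixes K :: "complex set"
  assumes "compact K" "K \<noteq> {}"
  obtains w :: "nat \<Rightarrow> complex" where "\<And>n. w n \<in> K"
    "\<And>n y. y \<in> K \<Longrightarrow> (\<Prod>j<n. cmod (y - w j)) \<le> (\<Prod>j<n. cmod (w n - w j))"
proof -
  define m where "m xs y = (\<Prod>a\<leftarrow>xs. cmod (y - a))" for xs :: "complex list" and y
  define pick where "pick xs = (SOME x. x \<in> K \<and> (\<forall>y\<in>K. m xs y \<le> m xs x))" for xs
  have cont: "continuous_on K (m xs)" for xs
    unfolding m_def by (induction xs) (auto intro!: continuous_intros)
  have pick: "pick xs \<in> K" "\<And>y. y \<in> K \<Longrightarrow> m xs y \<le> m xs (pick xs)" for xs
  proof -
    have "\<exists>x. x \<in> K \<and> (\<forall>y\<in>K. m xs y \<le> m xs x)"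
      using continuous_attains_sup[OF assms cont[of xs]] by blast
    from someI_ex[OF this] show "pick xs \<in> K" "\<And>y. y \<in> K \<Longrightarrow> m xs y \<le> m xs (pick xs)"
      by (auto simp: pick_def)
  qed
  define L where "L = rec_nat [] (\<lambda>n xs. xs @ [pick xs])"
  have L0: "L 0 = []" and LS: "L (Suc n) = L n @ [pick (L n)]" for n by (simp_all add: L_def)
  define w where "w n = pick (L n)" for n
  have Lw: "L n = map w [0..<n]" for n by (induction n) (auto simp: L0 LS w_def)
  have mL: "m (L n) y = (\<Prod>j<n. cmod (y - w j))" for n y
    unfolding Lw m_def by (induction n) (auto simp: mult.commute)
  show thesis
  proof (rule that[of w])
    show "w n \<in> K" for n using pick(1) by (simp add: w_def)
    show "(\<Prod>j<n. cmod (y - w j)) \<le> (\<Prod>j<n. cmod (w n - w j))" if "y \<in> K" for n y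
      using pick(2)[OF that, of "L n"] unfolding mL[symmetric] by (simp add: w_def[of n])
  qed
qed

subsection \<open>Removability and polarity\<close>

lemma sum_offdiagonal:
  fixes f :: "nat \<Rightarrow> nat \<Rightarrow> real"
  assumes "\<And>i j. f i j = f j i"
  shows "(\<Sum>i<n. \<Sum>j<n. if i = j then 0 else f i j) = 2 * (\<Sum>i<n. \<Sum>j<i. f i j)"
proof (induction n)
  case (Suc n)
  have "(\<Sum>i<Suc n. \<Sum>j<Suc n. if i = j then 0 else f i j) =
     (\<Sum>i<n. \<Sum>j<n. if i = j then 0 else f i j) + (\<Sum>i<n. if i = n then 0 else f i n) + (\<Sum>j<n. if n = j then 0 else f n j)"
    by (simp add: sum.distrib)
  also have "(\<Sum>i<n. if i = n then 0 else f i n) = (\<Sum>j<n. f n j)"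
    using assms by (intro sum.cong) auto
  also have "(\<Sum>j<n. if n = j then 0 else f n j) = (\<Sum>j<n. f n j)"
    by (intro sum.cong) auto
  finally show ?case using Suc by simp
qed simp

text \<open>The square expands into a double sum. Off the diagonal the product kernel costs a
  logarithm of the distance, which sums to the energy; on the diagonal the truncation at
  \<open>1 / n\<close> costs a logarithm of \<open>n\<close>. Division by \<open>n\<^sup>2\<close>
  leaves a bound independent of \<open>n\<close>.\<close>

lemma Cauchy_transform_energy:
  fixes \<mu> :: "complex measure" and w :: "nat \<Rightarrow> complex"
  assumes sets [simp]: "sets \<mu> = sets borel"
    and ball: "\<And>c r. 0 < r \<Longrightarrow> emeasure \<mu> (ball c r) \<le> ennreal (pi * r\<^sup>2)"
    and w: "\<And>i. w i \<in> ball 0 1" and dist: "\<And>i j. i \<noteq> j \<Longrightarrow> w i \<noteq> w j"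
    and M: "0 \<le> M" and en: "(\<Sum>i<n. \<Sum>j<i. ln (1 / cmod (w i - w j))) \<le> M * (real n)\<^sup>2"
    and n: "0 < n" and a: "\<And>j. cmod (a j) \<le> B"
  shows "(\<integral>\<^sup>+ \<zeta>. ennreal ((cmod ((\<Sum>j<n. a j / (\<zeta> - w j)) / of_nat n))\<^sup>2) *
      indicator {\<zeta>\<in>ball 0 1. \<forall>j<n. 1 / real n \<le> cmod (\<zeta> - w j)} \<zeta> \<partial>\<mu>)
    \<le> ennreal (B\<^sup>2 * (40 * pi + 32 * pi * (ln 4 + M)))"
proof -
  let ?T = "{\<zeta>\<in>ball 0 1. \<forall>j<n. 1 / real n \<le> cmod (\<zeta> - w j)}"
  \<comment> \<open>The cut-off diagonal kernel agrees with the inverse square on \<open>?T\<close>,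
    where all distances are at least \<open>1 / n\<close>.\<close>
  define g where "g i j \<zeta> = (if i = j then ennreal (1 / (cmod (\<zeta> - w i) * max (cmod (\<zeta> - w i)) (1 / real n)))
      else ennreal (1 / (cmod (\<zeta> - w i) * cmod (\<zeta> - w j)))) * indicator (ball 0 1) \<zeta>" for i j \<zeta>
  define f where "f i j = ln (4 / cmod (w i - w j))" for i j
  define d where "d i j = (if i = j then 8 * pi * ln (2 * real n) + 8 * pi else 16 * pi * f i j + 16 * pi)" for i j
  have B0: "0 \<le> B" using a[of 0] norm_ge_zero[of "a 0"] by linarith
  define k where "k = B\<^sup>2 / (real n)\<^sup>2"
  have k0: "0 \<le> k" by (simp add: k_def)
  have f0: "0 \<le> f i j" if "i \<noteq> j" for i j
  proof -
    have "cmod (w i - w j) < 4" using norm_triangle_ineq4[of "w i" "w j"] w[of i] w[of j] by simp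
    then show ?thesis using dist[OF that] by (simp add: f_def)
  qed
  have d0: "0 \<le> d i j" for i j using f0 n by (auto simp: d_def)
  have gm: "g i j \<in> borel_measurable \<mu>" for i j
  proof -
    have "g i j \<in> borel_measurable borel"
      unfolding g_def by (cases "i = j") (simp_all, (intro borel_measurable_times_ennreal borel_measurable_indicator borel_open open_ball; measurable)+)
    then show ?thesis by (simp add: measurable_cong_sets[OF sets refl])
  qed
  have gI: "(\<integral>\<^sup>+ \<zeta>. g i j \<zeta> \<partial>\<mu>) \<le> ennreal (d i j)" for i j
  proof (cases "i = j")
    case True
    have "1 / real n \<le> 1" using n by simp
    then have "1 / real n \<le> 2" by linarith
    then have "(\<integral>\<^sup>+ \<zeta>. g i j \<zeta> \<partial>\<mu>) \<le> ennreal (8 * pi * ln (2 / (1 / real n)) + 8 * pi)"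
      using nn_integral_truncated_inverse_square[OF sets ball w[of i], of "1 / real n"] n True by (simp add: g_def)
    then show ?thesis using True by (simp add: d_def)
  next
    case False
    then show ?thesis
      using nn_integral_inverse_product[OF sets ball w[of i] w[of j] dist[OF False]] by (simp add: g_def d_def f_def)
  qed
  have pt: "ennreal ((cmod ((\<Sum>j<n. a j / (\<zeta> - w j)) / of_nat n))\<^sup>2) * indicator ?T \<zeta>
     \<le> (\<Sum>i<n. \<Sum>j<n. ennreal k * g i j \<zeta>)" for \<zeta>
  proof (cases "\<zeta> \<in> ?T")
    case True
    have "cmod (\<Sum>j<n. a j / (\<zeta> - w j)) \<le> (\<Sum>j<n. B * (1 / cmod (\<zeta> - w j)))"
      by (rule sum_norm_le) (use a in \<open>auto simp: norm_divide intro!: divide_right_mono\<close>)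
    also have "\<dots> = B * (\<Sum>j<n. 1 / cmod (\<zeta> - w j))" by (simp add: sum_distrib_left)
    finally have "(cmod (\<Sum>j<n. a j / (\<zeta> - w j)))\<^sup>2 \<le> (B * (\<Sum>j<n. 1 / cmod (\<zeta> - w j)))\<^sup>2"
      by (intro power_mono) auto
    also have "\<dots> = B\<^sup>2 * ((\<Sum>i<n. 1 / cmod (\<zeta> - w i)) * (\<Sum>j<n. 1 / cmod (\<zeta> - w j)))"
      by (simp add: power2_eq_square)
    also have "(\<Sum>i<n. 1 / cmod (\<zeta> - w i)) * (\<Sum>j<n. 1 / cmod (\<zeta> - w j))
        = (\<Sum>i<n. \<Sum>j<n. 1 / (cmod (\<zeta> - w i) * cmod (\<zeta> - w j)))"
      by (simp add: sum_product)
    finally have "(cmod ((\<Sum>j<n. a j / (\<zeta> - w j)) / of_nat n))\<^sup>2 \<le>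
        k * (\<Sum>i<n. \<Sum>j<n. 1 / (cmod (\<zeta> - w i) * cmod (\<zeta> - w j)))"
      using n by (simp add: norm_divide power_divide k_def divide_right_mono)
    then have "ennreal ((cmod ((\<Sum>j<n. a j / (\<zeta> - w j)) / of_nat n))\<^sup>2)
      \<le> ennreal (\<Sum>i<n. \<Sum>j<n. k * (1 / (cmod (\<zeta> - w i) * cmod (\<zeta> - w j))))"
      by (intro ennreal_leI) (simp add: sum_distrib_left)
    also have "\<dots> = (\<Sum>i<n. \<Sum>j<n. ennreal (k * (1 / (cmod (\<zeta> - w i) * cmod (\<zeta> - w j)))))"
      using k0 by (subst sum_ennreal[symmetric], intro sum_nonneg) (auto intro!: sum.cong sum_ennreal[symmetric])
    also have "\<dots> = (\<Sum>i<n. \<Sum>j<n. ennreal k * g i j \<zeta>)"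
    proof (intro sum.cong refl)
      fix i j assume "i \<in> {..<n}" "j \<in> {..<n}"
      then have "max (cmod (\<zeta> - w i)) (1 / real n) = cmod (\<zeta> - w i)" using True by (auto simp: max_def)
      then show "ennreal (k * (1 / (cmod (\<zeta> - w i) * cmod (\<zeta> - w j)))) = ennreal k * g i j \<zeta>"
        using True k0 by (subst ennreal_mult') (auto simp: g_def)
    qed
    finally show ?thesis using True by simp
  qed simp
  have "(\<integral>\<^sup>+ \<zeta>. ennreal ((cmod ((\<Sum>j<n. a j / (\<zeta> - w j)) / of_nat n))\<^sup>2) * indicator ?T \<zeta> \<partial>\<mu>)
     \<le> (\<integral>\<^sup>+ \<zeta>. (\<Sum>i<n. \<Sum>j<n. ennreal k * g i j \<zeta>) \<partial>\<mu>)"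
    by (rule nn_integral_mono) (rule pt)
  also have "\<dots> = (\<Sum>i<n. \<integral>\<^sup>+ \<zeta>. (\<Sum>j<n. ennreal k * g i j \<zeta>) \<partial>\<mu>)"
    by (intro nn_integral_sum borel_measurable_sum borel_measurable_times_ennreal borel_measurable_const gm)
  also have "\<dots> = (\<Sum>i<n. \<Sum>j<n. \<integral>\<^sup>+ \<zeta>. ennreal k * g i j \<zeta> \<partial>\<mu>)"
    by (intro sum.cong refl nn_integral_sum borel_measurable_times_ennreal borel_measurable_const gm)
  also have "\<dots> = (\<Sum>i<n. \<Sum>j<n. ennreal k * (\<integral>\<^sup>+ \<zeta>. g i j \<zeta> \<partial>\<mu>))"
    by (intro sum.cong refl nn_integral_cmult gm)
  also have "\<dots> \<le> (\<Sum>i<n. \<Sum>j<n. ennreal k * ennreal (d i j))"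
    by (intro sum_mono mult_left_mono gI) auto
  also have "\<dots> = (\<Sum>i<n. \<Sum>j<n. ennreal (k * d i j))"
    using k0 by (simp add: ennreal_mult')
  also have "\<dots> = ennreal (\<Sum>i<n. \<Sum>j<n. k * d i j)"
    using k0 d0 by (simp add: sum_ennreal sum_nonneg)
  also have "\<dots> \<le> ennreal (B\<^sup>2 * (40 * pi + 32 * pi * (ln 4 + M)))"
  proof (rule ennreal_leI)
    \<comment> \<open>The crude bound \<open>ln (2 * n) \<le> 2 * n\<close> is enough: the
      \<open>n\<close> diagonal terms together remain of order \<open>n\<^sup>2\<close>.\<close>
    have dle: "d i j \<le> (if i = j then 16 * pi * real n + 8 * pi else 0) + 16 * pi + 16 * pi * (if i = j then 0 else f i j)" for i j
    proof (cases "i = j")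
      case True
      have "ln (2 * real n) \<le> 2 * real n" using n ln_le_minus_one[of "2 * real n"] by linarith
      then have "8 * pi * ln (2 * real n) \<le> 8 * pi * (2 * real n)" by (intro mult_left_mono) auto
      then show ?thesis unfolding d_def if_P[OF True] using pi_gt_zero by linarith
    qed (simp add: d_def)
    have dg: "(\<Sum>i<n. \<Sum>j<n. if i = j then c else 0) = c * real n" for c :: real
      by simp
    have "(\<Sum>i<n. \<Sum>j<n. d i j) \<le> (\<Sum>i<n. \<Sum>j<n. (if i = j then 16 * pi * real n + 8 * pi else 0) + 16 * pi + 16 * pi * (if i = j then 0 else f i j))"
      by (intro sum_mono dle)
    also have "\<dots> = (\<Sum>i<n. \<Sum>j<n. if i = j then 16 * pi * real n + 8 * pi else 0) + (\<Sum>i<n. \<Sum>j<n. 16 * pi)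
        + 16 * pi * (\<Sum>i<n. \<Sum>j<n. if i = j then 0 else f i j)"
      by (simp only: sum.distrib sum_distrib_left)
    also have "\<dots> = (16 * pi * real n + 8 * pi) * real n + 16 * pi * (real n)\<^sup>2 + 16 * pi * (2 * (\<Sum>i<n. \<Sum>j<i. f i j))"
      unfolding dg by (subst sum_offdiagonal) (simp_all add: f_def norm_minus_commute power2_eq_square)
    also have "(\<Sum>i<n. \<Sum>j<i. f i j) \<le> ln 4 * (real n)\<^sup>2 + M * (real n)\<^sup>2"
    proof -
      have "(\<Sum>i<n. \<Sum>j<i. f i j) = (\<Sum>i<n. \<Sum>j<i. ln 4 + ln (1 / cmod (w i - w j)))"
        by (intro sum.cong refl) (use dist in \<open>auto simp: f_def ln_div\<close>)
      also have "\<dots> = (\<Sum>i<n. real i * ln 4) + (\<Sum>i<n. \<Sum>j<i. ln (1 / cmod (w i - w j)))"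
        by (simp only: sum.distrib) simp
      also have "(\<Sum>i<n. real i * ln 4) \<le> (\<Sum>i<n. real n * ln 4)"
        by (intro sum_mono mult_right_mono) auto
      finally show ?thesis using en by (simp add: power2_eq_square mult_ac)
    qed
    finally have "(\<Sum>i<n. \<Sum>j<n. d i j) \<le> (16 * pi * real n + 8 * pi) * real n + 16 * pi * (real n)\<^sup>2
        + 16 * pi * (2 * (ln 4 * (real n)\<^sup>2 + M * (real n)\<^sup>2))" by simp
    also have "\<dots> \<le> (40 * pi + 32 * pi * (ln 4 + M)) * (real n)\<^sup>2"
    proof -
      have "8 * pi * real n \<le> 8 * pi * (real n)\<^sup>2" using n by (intro mult_left_mono self_le_power) auto
      then show ?thesis by (simp add: algebra_simps power2_eq_square)
    qed
    finally have "k * (\<Sum>i<n. \<Sum>j<n. d i j) \<le> k * ((40 * pi + 32 * pi * (ln 4 + M)) * (real n)\<^sup>2)"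
      using k0 by (rule mult_left_mono)
    also have "\<dots> = B\<^sup>2 * (40 * pi + 32 * pi * (ln 4 + M))" using n by (simp add: k_def)
    finally show "(\<Sum>i<n. \<Sum>j<n. k * d i j) \<le> B\<^sup>2 * (40 * pi + 32 * pi * (ln 4 + M))"
      by (simp add: sum_distrib_left)
  qed
  finally show ?thesis .
qed

section \<open>The image of the developing map and its complement\<close>

locale developed_domain = liouville_domain +
  fixes p :: complex and F :: "complex \<Rightarrow> complex"
  assumes p: "p \<in> D" and hol_F: "F holomorphic_on D" and inj_F: "inj_on F D" and F_disc: "F ` D \<subseteq> ball 0 1"
    and deriv_F: "\<And>z. z \<in> D \<Longrightarrow> deriv F z \<noteq> 0"
    and ker_form: "\<And>z w. z \<in> D \<Longrightarrow> w \<in> D \<Longrightarrow>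
       ker z w * ker p p * (1 - F z * cnj (F w))\<^sup>2 = ker z p * ker p w"
begin

lemma cont_F: "continuous_on D F"
  using hol_F by (rule holomorphic_on_imp_continuous_on)

lemma hol_dF: "deriv F holomorphic_on D"
  using hol_F open_D by (rule holomorphic_deriv)

lemma open_image: "open (F ` D)"
  using open_mapping_thm3[OF hol_F open_D inj_F] .

lemma area_le:
  assumes "open S" "S \<subseteq> D" "F ` S \<subseteq> T" "T \<in> sets borel"
  shows "(\<integral>\<^sup>+ z\<in>S. ennreal ((cmod (deriv F z))\<^sup>2) \<partial>lborel) \<le> emeasure lborel T"
proof -
  have "bounded (F ` S)" by (rule bounded_subset[of "ball 0 1"]) (use F_disc assms in auto)
  then have "(\<integral>\<^sup>+ z\<in>S. ennreal ((cmod (deriv F z))\<^sup>2) \<partial>lborel) = emeasure lborel (F ` S)"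
    using assms by (intro nn_integral_deriv_image holomorphic_on_subset[OF hol_F] inj_on_subset[OF inj_F])
  also have "\<dots> \<le> emeasure lborel T" using assms by (intro emeasure_mono) auto
  finally show ?thesis .
qed

lemma dF_A: "deriv F \<in> \<A>"
proof (rule A_nnI(1)[OF hol_dF, of pi])
  have "(\<integral>\<^sup>+ z\<in>D. ennreal ((cmod (deriv F z))\<^sup>2) \<partial>lborel) \<le> emeasure lborel (ball (0::complex) 1)"
    using open_D F_disc by (intro area_le) auto
  then show "(\<integral>\<^sup>+ z\<in>D. ennreal ((cmod (deriv F z))\<^sup>2) \<partial>lborel) \<le> ennreal pi"
    by (simp add: emeasure_ball unit_ball_vol_2)
qed simp

text \<open>By injectivity this is area on the image of \<open>F\<close>. As a push-forward it
  transfers integrals over \<open>D\<close> directly, and the kernel estimates ask only for its mass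
  on balls. The values given to \<open>F\<close> off \<open>D\<close> are immaterial since the
  density is zero there.\<close>

definition img_measure :: "complex measure" where
  "img_measure = distr (density lborel (\<lambda>z. ennreal ((cmod (deriv F z))\<^sup>2) * indicator D z)) borel (\<lambda>z. indicator D z *\<^sub>R F z)"

lemma sets_img_measure [simp]: "sets img_measure = sets borel"
  by (simp add: img_measure_def)

lemma nn_integral_img_measure:
  assumes g: "g \<in> borel_measurable borel"
  shows "(\<integral>\<^sup>+ \<zeta>. g \<zeta> \<partial>img_measure) = (\<integral>\<^sup>+ z\<in>D. ennreal ((cmod (deriv F z))\<^sup>2) * g (F z) \<partial>lborel)"
proof -
  have Fm: "(\<lambda>z. indicator D z *\<^sub>R F z) \<in> borel_measurable lborel"
    using cont_F by (rule indicator_measurable)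
  have dm: "(\<lambda>z. ennreal ((cmod (deriv F z))\<^sup>2) * indicator D z) \<in> borel_measurable lborel"
  proof -
    have "(\<lambda>z. ennreal (indicator D z *\<^sub>R (cmod (deriv F z))\<^sup>2)) \<in> borel_measurable lborel"
      by (intro measurable_compose[OF _ measurable_ennreal] indicator_measurable continuous_intros
          holomorphic_on_imp_continuous_on hol_dF)
    also have "(\<lambda>z. ennreal (indicator D z *\<^sub>R (cmod (deriv F z))\<^sup>2)) = (\<lambda>z. ennreal ((cmod (deriv F z))\<^sup>2) * indicator D z)"
      by (auto simp: indicator_def)
    finally show ?thesis .
  qed
  have gF: "(\<lambda>z. g (indicator D z *\<^sub>R F z)) \<in> borel_measurable lborel"
    by (rule measurable_compose[OF Fm g])
  have "(\<integral>\<^sup>+ \<zeta>. g \<zeta> \<partial>img_measure) = (\<integral>\<^sup>+ z. g (indicator D z *\<^sub>R F z) \<partial>density lborel (\<lambda>z. ennreal ((cmod (deriv F z))\<^sup>2) * indicator D z))"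
    unfolding img_measure_def by (rule nn_integral_distr) (use Fm g in auto)
  also have "\<dots> = (\<integral>\<^sup>+ z. (ennreal ((cmod (deriv F z))\<^sup>2) * indicator D z) * g (indicator D z *\<^sub>R F z) \<partial>lborel)"
    by (rule nn_integral_density[OF dm gF])
  also have "\<dots> = (\<integral>\<^sup>+ z\<in>D. ennreal ((cmod (deriv F z))\<^sup>2) * g (F z) \<partial>lborel)"
    by (intro nn_integral_cong) (auto simp: indicator_def)
  finally show ?thesis .
qed

lemma img_measure_ball:
  assumes "0 < r"
  shows "emeasure img_measure (ball c r) \<le> ennreal (pi * r\<^sup>2)"
proof -
  define S where "S = {z \<in> D. F z \<in> ball c r}"
  have "open S" using continuous_open_preimage[OF cont_F open_D open_ball, of c r] by (simp add: S_def vimage_def Int_def)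
  have "emeasure img_measure (ball c r) = (\<integral>\<^sup>+ \<zeta>. indicator (ball c r) \<zeta> \<partial>img_measure)"
    by simp
  also have "\<dots> = (\<integral>\<^sup>+ z\<in>D. ennreal ((cmod (deriv F z))\<^sup>2) * indicator (ball c r) (F z) \<partial>lborel)"
    by (rule nn_integral_img_measure, rule borel_measurable_indicator) simp
  also have "\<dots> = (\<integral>\<^sup>+ z\<in>S. ennreal ((cmod (deriv F z))\<^sup>2) \<partial>lborel)"
    by (intro nn_integral_cong) (auto simp: S_def indicator_def)
  also have "\<dots> \<le> emeasure lborel (ball c r)"
    using \<open>open S\<close> by (intro area_le) (auto simp: S_def)
  also have "\<dots> = ennreal (pi * r\<^sup>2)" using assms by (simp add: emeasure_ball unit_ball_vol_2)
  finally show ?thesis .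
qed

context
  fixes H1 :: "complex \<Rightarrow> complex"
  assumes hol_H1: "H1 holomorphic_on ball 0 1" and H1: "\<And>w. w \<in> D \<Longrightarrow> deriv F w = ker w p * H1 (F w)"
begin

lemma H1_image: "\<xi> \<in> F ` D \<Longrightarrow> H1 \<xi> \<noteq> 0"
  using H1 deriv_F by fastforce

text \<open>A square integrable \<open>h\<close> on the image pulls back to
  \<open>(h \<circ> F) * deriv F\<close>. Its factorization and that of \<open>deriv F\<close> share
  the factor \<open>ker w p\<close>, which cancels.\<close>

lemma extension:
  assumes "(\<lambda>z. h (F z) * deriv F z) \<in> \<A>"
  obtains G where "G holomorphic_on ball 0 1" "\<And>\<xi>. \<xi> \<in> F ` D \<Longrightarrow> h \<xi> * H1 \<xi> = G \<xi>"
proof -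
  obtain G where G: "G holomorphic_on ball 0 1" "\<And>w. w \<in> D \<Longrightarrow> h (F w) * deriv F w = ker w p * G (F w)"
    by (rule factor_through_disc[OF p hol_F F_disc ker_form assms]) (auto intro: that)
  have "h \<xi> * H1 \<xi> = G \<xi>" if \<xi>: "\<xi> \<in> F ` D" for \<xi>
  proof -
    obtain w where w: "w \<in> D" "\<xi> = F w" using \<xi> by blast
    have "ker w p * (h \<xi> * H1 \<xi>) = ker w p * G \<xi>" using G(2)[OF w(1)] H1[OF w(1)] w(2) by (simp add: mult_ac)
    then show ?thesis using ker_nonzero[OF p w(1)] by simp
  qed
  with G(1) show thesis by (rule that)
qed

text \<open>If the image missed a disc, \<open>1 / (\<xi> - b)\<close> would have to extend for every \<open>b\<close> in it, so that
  \<open>H1\<close> would vanish there.\<close>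

lemma image_dense: "ball 0 1 \<subseteq> closure (F ` D)"
proof (rule ccontr)
  assume "\<not> ?thesis"
  then obtain a where a: "a \<in> ball 0 1" "a \<notin> closure (F ` D)" by blast
  then have "open (ball 0 1 \<inter> - closure (F ` D))" "a \<in> ball 0 1 \<inter> - closure (F ` D)"
    by (auto intro!: open_Int)
  then obtain \<delta> where \<delta>: "0 < \<delta>" "ball a \<delta> \<subseteq> ball 0 1 \<inter> - closure (F ` D)"
    using open_contains_ball by meson
  have far: "\<delta> \<le> cmod (\<xi> - a)" if "\<xi> \<in> F ` D" for \<xi>
  proof (rule ccontr)
    assume "\<not> ?thesis"
    then have "\<xi> \<in> ball a \<delta>" by (simp add: dist_norm norm_minus_commute)
    then show False using \<delta> that closure_subset[of "F ` D"] by blast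
  qed
  have H10: "H1 b = 0" if b: "b \<in> ball a (\<delta> / 2)" for b
  proof -
    have bd: "\<delta> / 2 \<le> cmod (\<xi> - b)" if "\<xi> \<in> F ` D" for \<xi>
      using far[OF that] b norm_triangle_ineq[of "\<xi> - b" "b - a"] by (simp add: dist_norm norm_minus_commute)
    have bB: "b \<in> ball 0 1" using b \<delta> by (auto simp: subset_iff)
    have nb: "F z - b \<noteq> 0" if "z \<in> D" for z using bd[of "F z"] that \<delta> by auto
    have "(\<lambda>z. 1 / (F z - b) * deriv F z) \<in> \<A>"
    proof (rule A_I[where g = "\<lambda>z. (2 / \<delta>)\<^sup>2 * (cmod (deriv F z))\<^sup>2"])
      show "(\<lambda>z. 1 / (F z - b) * deriv F z) holomorphic_on D"
        using nb by (intro holomorphic_intros hol_F hol_dF) auto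
      show "set_integrable lborel D (\<lambda>z. (2 / \<delta>)\<^sup>2 * (cmod (deriv F z))\<^sup>2)"
        by (intro set_integrable_mult_right A_set_integrable dF_A)
      fix z assume z: "z \<in> D"
      have "1 / cmod (F z - b) \<le> 1 / (\<delta> / 2)"
        using bd[of "F z"] z \<delta>(1) nb[OF z] by (intro divide_left_mono mult_pos_pos) auto
      then have "(1 / cmod (F z - b))\<^sup>2 \<le> (2 / \<delta>)\<^sup>2" by (intro power_mono) auto
      then have "(1 / cmod (F z - b))\<^sup>2 * (cmod (deriv F z))\<^sup>2 \<le> (2 / \<delta>)\<^sup>2 * (cmod (deriv F z))\<^sup>2"
        by (rule mult_right_mono) simp
      then show "(cmod (1 / (F z - b) * deriv F z))\<^sup>2 \<le> (2 / \<delta>)\<^sup>2 * (cmod (deriv F z))\<^sup>2"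
        by (simp add: norm_mult norm_divide power_mult_distrib power_divide)
    qed
    then obtain G where G: "G holomorphic_on ball 0 1" "\<And>\<xi>. \<xi> \<in> F ` D \<Longrightarrow> 1 / (\<xi> - b) * H1 \<xi> = G \<xi>"
      using extension[of "\<lambda>\<xi>. 1 / (\<xi> - b)"] by blast
    \<comment> \<open>The identity theorem spreads \<open>H1 \<xi> = (\<xi> - b) * G \<xi>\<close>
      from the image to the whole disc, including the point \<open>b\<close>.\<close>
    have "H1 b = (b - b) * G b"
    proof (rule analytic_continuation_open[OF open_image open_ball _ _ F_disc hol_H1, of "\<lambda>\<xi>. (\<xi> - b) * G \<xi>"])
      show "(\<lambda>\<xi>. (\<xi> - b) * G \<xi>) holomorphic_on ball 0 1" by (intro holomorphic_intros G(1))
      fix \<xi> assume \<xi>: "\<xi> \<in> F ` D"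
      then have "\<xi> - b \<noteq> 0" using nb by auto
      then show "H1 \<xi> = (\<xi> - b) * G \<xi>" using G(2)[OF \<xi>] by (simp add: field_simps)
    qed (use bB nonempty_D in auto)
    then show ?thesis by simp
  qed
  have "H1 (F p) = 0"
  proof (rule analytic_continuation_open[OF open_ball open_ball _ _ _ hol_H1 holomorphic_on_const, of a "\<delta> / 2"])
    have "ball a (\<delta> / 2) \<subseteq> ball a \<delta>" using \<delta>(1) by auto
    then show "ball a (\<delta> / 2) \<subseteq> ball 0 1" using \<delta>(2) by blast
  qed (use \<delta>(1) H10 F_disc p in auto)
  then show False using H1_image p by blast
qed

lemma no_finite_energy:
  fixes w :: "nat \<Rightarrow> complex"
  assumes K: "compact K" "K \<subseteq> ball 0 1 - F ` D" and H1K: "\<And>\<xi>. \<xi> \<in> K \<Longrightarrow> H1 \<xi> \<noteq> 0"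
    and w: "\<And>n. w n \<in> K" and dist: "\<And>i j. i \<noteq> j \<Longrightarrow> w i \<noteq> w j" and M: "0 \<le> M"
    and en: "\<And>n. (\<Sum>i<n. \<Sum>j<i. ln (1 / cmod (w i - w j))) \<le> M * (real n)\<^sup>2"
  shows False
proof -
  have Kne: "K \<noteq> {}" using w by blast
  define S where "S = ball 0 1 - K"
  have opS: "open S" unfolding S_def using K(1) by (intro open_Diff) (auto intro: compact_imp_closed)
  have ES: "F ` D \<subseteq> S" using K(2) F_disc by (auto simp: S_def)
  have wB: "w i \<in> ball 0 1" for i using w K by blast
  \<comment> \<open>With these weights each term of \<open>h n * H1\<close> has residue one before
    averaging.\<close>
  define a where "a j = 1 / H1 (w j)" for j
  have "continuous_on K (\<lambda>\<xi>. 1 / H1 \<xi>)"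
    using K(2) H1K by (intro continuous_intros continuous_on_subset[OF holomorphic_on_imp_continuous_on[OF hol_H1]]) auto
  then have "bounded ((\<lambda>\<xi>. 1 / H1 \<xi>) ` K)"
    by (intro compact_imp_bounded compact_continuous_image K(1))
  then obtain B where "\<forall>x\<in>(\<lambda>\<xi>. 1 / H1 \<xi>) ` K. cmod x \<le> B" unfolding bounded_iff by blast
  then have aB: "cmod (a j) \<le> B" for j using w by (auto simp: a_def)
  then have B0: "0 \<le> B" using norm_ge_zero order_trans by blast
  define h where "h n \<zeta> = (\<Sum>j<Suc n. a j / (\<zeta> - w j)) / of_nat (Suc n)" for n \<zeta>
  have ne: "\<zeta> - w j \<noteq> 0" if "\<zeta> \<in> S" for \<zeta> j using that w[of j] by (auto simp: S_def)
  have hh: "h n holomorphic_on S" for n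
    unfolding h_def using ne by (intro holomorphic_intros) (auto simp del: of_nat_Suc)
  have bound: "\<exists>b. \<forall>f\<in>range h. \<forall>z\<in>X. cmod (f z) \<le> b" if X: "compact X" "X \<subseteq> S" for X
  proof (cases "X = {}")
    case False
    have "X \<inter> K = {}" using X(2) by (auto simp: S_def)
    then have sd: "0 < setdist X K"
      using X(1) K(1) False Kne by (simp add: setdist_gt_0_compact_closed compact_imp_closed)
    have "cmod (h n z) \<le> B / setdist X K" if z: "z \<in> X" for n z
    proof -
      have "cmod (\<Sum>j<Suc n. a j / (z - w j)) \<le> (\<Sum>j<Suc n. B / setdist X K)"
      proof (rule sum_norm_le)
        fix j
        have "setdist X K \<le> cmod (z - w j)" using setdist_le_dist[OF z w[of j]] by (simp add: dist_norm)
        then show "cmod (a j / (z - w j)) \<le> B / setdist X K"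
          using aB[of j] sd B0 by (auto simp: norm_divide intro!: frac_le)
      qed
      then have "cmod (\<Sum>j<Suc n. a j / (z - w j)) \<le> real (Suc n) * (B / setdist X K)" by simp
      then show ?thesis by (simp add: h_def norm_divide field_simps del: of_nat_Suc sum.lessThan_Suc)
    qed
    then show ?thesis by (intro exI[of _ "B / setdist X K"]) auto
  qed auto
  obtain g r where g: "g holomorphic_on S" and r: "strict_mono (r :: nat \<Rightarrow> nat)"
    and lim: "\<And>x. x \<in> S \<Longrightarrow> ((\<lambda>n. h (r n) x) \<longlongrightarrow> g x) sequentially"
    and ulim: "\<And>X. compact X \<Longrightarrow> X \<subseteq> S \<Longrightarrow> uniform_limit X (h \<circ> r) g sequentially"
    by (rule Montel[OF opS _ bound, where \<F> = h]) (use hh in \<open>auto intro: that\<close>)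
  \<comment> \<open>The excluded discs shrink as \<open>n\<close> grows, and points of the image
    keep a positive distance from \<open>K\<close>, so each of them lies in \<open>T n\<close>
    eventually.\<close>
  define T where "T n = {\<zeta>\<in>ball 0 1. \<forall>j<Suc n. 1 / real (Suc n) \<le> cmod (\<zeta> - w j)}" for n
  define C where "C = B\<^sup>2 * (40 * pi + 32 * pi * (ln 4 + M))"
  have C0: "0 \<le> C" using M by (simp add: C_def)
  define \<Psi> where "\<Psi> n \<zeta> = ennreal ((cmod (h n \<zeta>))\<^sup>2) * indicator (T n) \<zeta>" for n \<zeta>
  have \<Psi>m: "\<Psi> n \<in> borel_measurable borel" for n
  proof -
    have "T n = ball 0 1 \<inter> (\<Inter>j<Suc n. {\<zeta>. 1 / real (Suc n) \<le> cmod (\<zeta> - w j)})"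
      by (auto simp: T_def)
    moreover have "closed {\<zeta>. 1 / real (Suc n) \<le> cmod (\<zeta> - w j)}" for j
      by (intro closed_Collect_le continuous_intros)
    then have "closed (\<Inter>j<Suc n. {\<zeta>. 1 / real (Suc n) \<le> cmod (\<zeta> - w j)})" by auto
    ultimately have Tm: "T n \<in> sets borel" by (metis borel_closed borel_open open_ball sets.Int)
    have "h n \<in> borel_measurable borel" unfolding h_def by measurable
    then have "(\<lambda>\<zeta>. ennreal ((cmod (h n \<zeta>))\<^sup>2)) \<in> borel_measurable borel" by measurable
    then show ?thesis unfolding \<Psi>_def using Tm by (intro borel_measurable_times_ennreal borel_measurable_indicator)
  qed
  have \<Psi>I: "(\<integral>\<^sup>+ \<zeta>. \<Psi> n \<zeta> \<partial>img_measure) \<le> ennreal C" for n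
    unfolding \<Psi>_def h_def T_def C_def
    by (rule Cauchy_transform_energy[OF sets_img_measure img_measure_ball wB dist M en _ aB]) auto
  define f where "f z = g (F z) * deriv F z" for z
  have fhol: "f holomorphic_on D"
    unfolding f_def
    by (intro holomorphic_intros hol_dF holomorphic_on_compose_gen[OF hol_F g, unfolded o_def] ES)
  have ptw: "(\<lambda>n. ennreal ((cmod (deriv F z))\<^sup>2) * \<Psi> (r n) (F z)) \<longlonglongrightarrow> ennreal ((cmod (f z))\<^sup>2)" if z: "z \<in> D" for z
  proof -
    have FS: "F z \<in> S" using ES z by blast
    obtain \<delta> where \<delta>: "0 < \<delta>" "ball (F z) \<delta> \<subseteq> S" using opS FS open_contains_ball by blast
    have far: "\<delta> \<le> cmod (F z - w j)" for j
    proof (rule ccontr)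
      assume "\<not> ?thesis"
      then have "w j \<in> ball (F z) \<delta>" by (simp add: dist_norm)
      then show False using \<delta>(2) w[of j] by (auto simp: S_def)
    qed
    obtain N where N: "1 / real (Suc N) < \<delta>" using \<delta>(1) nat_approx_posE by blast
    have inT: "F z \<in> T (r n)" if "N \<le> n" for n
    proof -
      have "N \<le> r n" using that seq_suble[OF r, of n] by simp
      then have "1 / real (Suc (r n)) \<le> 1 / real (Suc N)" by (intro divide_left_mono) auto
      then have "1 / real (Suc (r n)) \<le> cmod (F z - w j)" for j using N far[of j] by linarith
      then show ?thesis using FS by (auto simp: T_def S_def)
    qed
    have "(\<lambda>n. ennreal ((cmod (deriv F z))\<^sup>2 * (cmod (h (r n) (F z)))\<^sup>2)) \<longlonglongrightarrow> ennreal ((cmod (deriv F z))\<^sup>2 * (cmod (g (F z)))\<^sup>2)"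
      by (intro tendsto_intros lim FS)
    moreover have "\<forall>\<^sub>F n in sequentially. ennreal ((cmod (deriv F z))\<^sup>2 * (cmod (h (r n) (F z)))\<^sup>2) = ennreal ((cmod (deriv F z))\<^sup>2) * \<Psi> (r n) (F z)"
      by (rule eventually_sequentiallyI[of N]) (use inT in \<open>auto simp: \<Psi>_def ennreal_mult'\<close>)
    moreover have "(cmod (deriv F z))\<^sup>2 * (cmod (g (F z)))\<^sup>2 = (cmod (f z))\<^sup>2"
      by (simp add: f_def norm_mult power_mult_distrib mult.commute)
    ultimately show ?thesis by (auto intro: Lim_transform_eventually)
  qed
  have fA: "f \<in> \<A>"
  proof (rule A_nnI(1)[OF fhol _ C0])
    have dm: "(\<lambda>z. ennreal ((cmod (deriv F z))\<^sup>2) * \<Psi> n (F z) * indicator D z) \<in> borel_measurable lborel" for n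
    proof -
      have 1: "(\<lambda>z. ennreal (indicator D z *\<^sub>R (cmod (deriv F z))\<^sup>2)) \<in> borel_measurable lborel"
        by (intro measurable_compose[OF _ measurable_ennreal] indicator_measurable continuous_intros
            holomorphic_on_imp_continuous_on hol_dF)
      have 2: "(\<lambda>z. \<Psi> n (indicator D z *\<^sub>R F z)) \<in> borel_measurable lborel"
        by (rule measurable_compose[OF indicator_measurable[OF cont_F] \<Psi>m])
      have "(\<lambda>z. ennreal (indicator D z *\<^sub>R (cmod (deriv F z))\<^sup>2) * \<Psi> n (indicator D z *\<^sub>R F z)) \<in> borel_measurable lborel"
        using 1 2 by (rule borel_measurable_times_ennreal)
      also have "(\<lambda>z. ennreal (indicator D z *\<^sub>R (cmod (deriv F z))\<^sup>2) * \<Psi> n (indicator D z *\<^sub>R F z))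
         = (\<lambda>z. ennreal ((cmod (deriv F z))\<^sup>2) * \<Psi> n (F z) * indicator D z)"
        by (auto simp: indicator_def)
      finally show ?thesis .
    qed
    have "(\<integral>\<^sup>+ z\<in>D. ennreal ((cmod (f z))\<^sup>2) \<partial>lborel)
       = (\<integral>\<^sup>+ z. liminf (\<lambda>n. ennreal ((cmod (deriv F z))\<^sup>2) * \<Psi> (r n) (F z) * indicator D z) \<partial>lborel)"
    proof (intro nn_integral_cong)
      fix z
      have "(\<lambda>n. ennreal ((cmod (deriv F z))\<^sup>2) * \<Psi> (r n) (F z) * indicator D z) \<longlonglongrightarrow> ennreal ((cmod (f z))\<^sup>2) * indicator D z"
        using ptw[of z] by (cases "z \<in> D") auto
      then show "ennreal ((cmod (f z))\<^sup>2) * indicator D z = liminf (\<lambda>n. ennreal ((cmod (deriv F z))\<^sup>2) * \<Psi> (r n) (F z) * indicator D z)"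
        by (rule lim_imp_Liminf[symmetric, rotated]) simp
    qed
    also have "\<dots> \<le> liminf (\<lambda>n. \<integral>\<^sup>+ z. ennreal ((cmod (deriv F z))\<^sup>2) * \<Psi> (r n) (F z) * indicator D z \<partial>lborel)"
      by (rule nn_integral_liminf) (rule dm)
    also have "\<dots> = liminf (\<lambda>n. \<integral>\<^sup>+ \<zeta>. \<Psi> (r n) \<zeta> \<partial>img_measure)"
      by (simp add: nn_integral_img_measure[OF \<Psi>m])
    also have "\<dots> \<le> liminf (\<lambda>n. ennreal C)"
      by (rule Liminf_mono) (use \<Psi>I in auto)
    also have "\<dots> = ennreal C" by (simp add: Liminf_const)
    finally show "(\<integral>\<^sup>+ z\<in>D. ennreal ((cmod (f z))\<^sup>2) \<partial>lborel) \<le> ennreal C" .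
  qed
  obtain G where G: "G holomorphic_on ball 0 1" and GE: "\<And>\<xi>. \<xi> \<in> F ` D \<Longrightarrow> g \<xi> * H1 \<xi> = G \<xi>"
    using extension[of g] fA unfolding f_def by blast
  have SB: "S \<subseteq> ball 0 1" by (auto simp: S_def)
  \<comment> \<open>\<open>S\<close> need not be connected, so the identity theorem cannot be used;
    density of the image and continuity suffice.\<close>
  have gG: "g \<xi> * H1 \<xi> = G \<xi>" if \<xi>: "\<xi> \<in> S" for \<xi>
  proof (rule ccontr)
    assume neq: "g \<xi> * H1 \<xi> \<noteq> G \<xi>"
    define d where "d x = g x * H1 x - G x" for x
    have "continuous_on S d"
      unfolding d_def using SB
      by (intro continuous_intros holomorphic_on_imp_continuous_on[OF g]
          continuous_on_subset[OF holomorphic_on_imp_continuous_on[OF hol_H1]]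
          continuous_on_subset[OF holomorphic_on_imp_continuous_on[OF G]])
    then have "open (S \<inter> d -` (-{0}))" using opS by (intro continuous_open_preimage) auto
    moreover have "\<xi> \<in> (S \<inter> d -` (-{0})) \<inter> closure (F ` D)"
      using \<xi> neq image_dense SB by (auto simp: d_def)
    ultimately have "(S \<inter> d -` (-{0})) \<inter> F ` D \<noteq> {}"
      using open_Int_closure_eq_empty by blast
    then show False using GE by (auto simp: d_def)
  qed
  obtain \<rho> where \<rho>: "0 < \<rho>" "\<rho> < 1" "K \<subseteq> ball 0 \<rho>"
  proof -
    obtain x where x: "x \<in> K" "\<And>y. y \<in> K \<Longrightarrow> cmod y \<le> cmod x"
      using continuous_attains_sup[OF K(1) Kne, of cmod] by (auto intro: continuous_intros)
    have "cmod x < 1" using x(1) K(2) by auto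
    then obtain s where s: "cmod x < s" "s < 1" using dense by blast
    show thesis
    proof (rule that[of s])
      show "0 < s" using s(1) norm_ge_zero[of x] by linarith
      show "K \<subseteq> ball 0 s" using x(2) s by force
    qed (rule s)
  qed
  have circS: "sphere 0 \<rho> \<subseteq> S" using \<rho> by (auto simp: S_def)
  have pathS: "path_image (circlepath 0 \<rho>) = sphere 0 \<rho>" using \<rho> by simp
  have cb: "cball 0 \<rho> \<subseteq> ball (0::complex) 1" using \<rho> by auto
  have I1: "contour_integral (circlepath 0 \<rho>) (\<lambda>\<zeta>. h n \<zeta> * H1 \<zeta>) = 2 * of_real pi * \<i>" for n
  proof -
    have 1: "((\<lambda>\<zeta>. a j * (H1 \<zeta> / (\<zeta> - w j))) has_contour_integral a j * (2 * of_real pi * \<i> * H1 (w j))) (circlepath 0 \<rho>)" for j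
      using w[of j] \<rho>(3)
      by (intro has_contour_integral_lmul Cauchy_integral_circlepath_simple holomorphic_on_subset[OF hol_H1 cb]) auto
    have "((\<lambda>\<zeta>. (\<Sum>j<Suc n. a j * (H1 \<zeta> / (\<zeta> - w j))) / of_nat (Suc n)) has_contour_integral
        (\<Sum>j<Suc n. a j * (2 * of_real pi * \<i> * H1 (w j))) / of_nat (Suc n)) (circlepath 0 \<rho>)"
      by (intro has_contour_integral_div has_contour_integral_sum 1) auto
    moreover have "(\<lambda>\<zeta>. (\<Sum>j<Suc n. a j * (H1 \<zeta> / (\<zeta> - w j))) / of_nat (Suc n)) = (\<lambda>\<zeta>. h n \<zeta> * H1 \<zeta>)"
      by (simp add: h_def sum_distrib_right fun_eq_iff del: of_nat_Suc sum.lessThan_Suc)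
    moreover have "a j * (2 * of_real pi * \<i> * H1 (w j)) = 2 * of_real pi * \<i>" for j
      using H1K[OF w[of j]] by (simp add: a_def)
    then have "(\<Sum>j<Suc n. a j * (2 * of_real pi * \<i> * H1 (w j))) = of_nat (Suc n) * (2 * of_real pi * \<i>)"
      by (simp only: sum_constant card_lessThan)
    then have "(\<Sum>j<Suc n. a j * (2 * of_real pi * \<i> * H1 (w j))) / of_nat (Suc n) = 2 * of_real pi * \<i>"
      by (simp del: of_nat_Suc sum.lessThan_Suc)
    ultimately show ?thesis by (simp add: contour_integral_unique)
  qed
  have H1b: "bounded (H1 ` sphere 0 \<rho>)"
    using cb by (intro compact_imp_bounded compact_continuous_image
        continuous_on_subset[OF holomorphic_on_imp_continuous_on[OF hol_H1]]) auto
  have gb: "bounded (g ` sphere 0 \<rho>)"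
    using circS by (intro compact_imp_bounded compact_continuous_image
        continuous_on_subset[OF holomorphic_on_imp_continuous_on[OF g]]) auto
  have ul: "uniform_limit (sphere 0 \<rho>) (\<lambda>n \<zeta>. h (r n) \<zeta> * H1 \<zeta>) (\<lambda>\<zeta>. g \<zeta> * H1 \<zeta>) sequentially"
    using ulim[OF compact_sphere circS] gb H1b
    by (intro uniform_lim_mult uniform_limit_const) (auto simp: o_def)
  have ci: "(\<lambda>\<zeta>. h n \<zeta> * H1 \<zeta>) contour_integrable_on circlepath 0 \<rho>" for n
    using circS cb pathS
    by (intro contour_integrable_continuous_circlepath continuous_intros
       continuous_on_subset[OF holomorphic_on_imp_continuous_on[OF hh]]
       continuous_on_subset[OF holomorphic_on_imp_continuous_on[OF hol_H1]]) auto
  have "((\<lambda>n. contour_integral (circlepath 0 \<rho>) (\<lambda>\<zeta>. h (r n) \<zeta> * H1 \<zeta>)) \<longlongrightarrow>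
      contour_integral (circlepath 0 \<rho>) (\<lambda>\<zeta>. g \<zeta> * H1 \<zeta>)) sequentially"
    by (rule contour_integral_uniform_limit_circlepath(2)[OF _ _ _ \<rho>(1)]) (use ci ul in auto)
  then have "contour_integral (circlepath 0 \<rho>) (\<lambda>\<zeta>. g \<zeta> * H1 \<zeta>) = 2 * of_real pi * \<i>"
    unfolding I1 by (simp add: LIMSEQ_const_iff)
  moreover have "contour_integral (circlepath 0 \<rho>) (\<lambda>\<zeta>. g \<zeta> * H1 \<zeta>) = contour_integral (circlepath 0 \<rho>) G"
    using gG circS pathS by (intro contour_integral_cong) auto
  moreover have "contour_integral (circlepath 0 \<rho>) G = 0"
    by (rule contour_integral_unique, rule Cauchy_theorem_disc_simple[OF G]) (use \<rho> in auto)
  ultimately show False by simp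
qed

text \<open>Either some Leja product with \<open>n\<close> factors is at most
  \<open>exp (- M' * n)\<close>; by maximality it bounds the product at every point of
  \<open>K\<close>, and minus its logarithm is the potential. Or all products are larger; then the
  points are distinct and summing logarithms bounds their energy, which
  \<open>no_finite_energy\<close> excludes.\<close>

lemma small_potentials:
  assumes K: "compact K" "K \<subseteq> ball 0 1 - F ` D" "K \<noteq> {}" and H1K: "\<And>\<xi>. \<xi> \<in> K \<Longrightarrow> H1 \<xi> \<noteq> 0" and R: "0 < R"
    and KR: "\<And>x y. x \<in> K \<Longrightarrow> y \<in> K \<Longrightarrow> cmod (x - y) \<le> R"
  shows "\<exists>n w. 0 < n \<and> (\<forall>i<n. w i \<in> K) \<and> (\<forall>\<zeta>\<in>K. ennreal (real n * M) \<le> (\<Sum>i<n. log_pot R (\<zeta> - w i)))"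
proof -
  obtain w :: "nat \<Rightarrow> complex" where w: "\<And>n. w n \<in> K" and max: "\<And>n y. y \<in> K \<Longrightarrow> (\<Prod>j<n. cmod (y - w j)) \<le> (\<Prod>j<n. cmod (w n - w j))"
    by (rule Leja_sequence[OF K(1,3)]) (auto intro: that)
  \<comment> \<open>\<open>ln R\<close> accounts for the scale in \<open>log_pot\<close>;
    nonnegativity is needed to replace \<open>M' * i\<close> by \<open>M' * n\<close> in the energy
    bound.\<close>
  define M' where "M' = max 0 (M - ln R)"
  show ?thesis
  proof (cases "\<exists>n>0. (\<Prod>j<n. cmod (w n - w j)) \<le> exp (- M' * real n)")
    case True
    then obtain n where n: "0 < n" "(\<Prod>j<n. cmod (w n - w j)) \<le> exp (- M' * real n)" by blast
    have "ennreal (real n * M) \<le> (\<Sum>i<n. log_pot R (\<zeta> - w i))" if \<zeta>: "\<zeta> \<in> K" for \<zeta>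
    proof (cases "\<exists>i<n. \<zeta> = w i")
      case True
      then obtain i where i: "i < n" "\<zeta> = w i" by blast
      have "log_pot R (\<zeta> - w i) \<le> (\<Sum>i<n. log_pot R (\<zeta> - w i))"
        using i by (intro member_le_sum) auto
      then have "(\<Sum>i<n. log_pot R (\<zeta> - w i)) = top" using i by (simp add: log_pot_def top_unique)
      then show ?thesis by (simp only: top_greatest)
    next
      case False
      then have pos: "0 < cmod (\<zeta> - w i)" if "i < n" for i using that by auto
      have "(\<Sum>i<n. ln (R / cmod (\<zeta> - w i))) = real n * ln R - ln (\<Prod>i<n. cmod (\<zeta> - w i))"
        using pos R by (subst ln_prod) (auto simp: ln_div sum_subtractf)
      moreover have "ln (\<Prod>i<n. cmod (\<zeta> - w i)) \<le> ln (exp (- M' * real n))"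
        using max[OF \<zeta>, of n] n(2) pos by (intro ln_mono prod_pos) auto
      moreover have "real n * (M - ln R) \<le> real n * M'" by (intro mult_left_mono) (auto simp: M'_def)
      ultimately have "real n * M \<le> (\<Sum>i<n. ln (R / cmod (\<zeta> - w i)))"
        by (simp add: algebra_simps)
      then have "ennreal (real n * M) \<le> ennreal (\<Sum>i<n. ln (R / cmod (\<zeta> - w i)))" by (rule ennreal_leI)
      also have "\<dots> = (\<Sum>i<n. ennreal (ln (R / cmod (\<zeta> - w i))))"
        using pos KR[OF \<zeta> w] R by (intro sum_ennreal[symmetric]) auto
      also have "\<dots> = (\<Sum>i<n. log_pot R (\<zeta> - w i))"
        using pos by (intro sum.cong) (auto simp: log_pot_def)
      finally show ?thesis .
    qed
    then show ?thesis using n(1) w by blast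
  next
    case False
    then have big: "exp (- M' * real n) < (\<Prod>j<n. cmod (w n - w j))" if "0 < n" for n
      using that by (meson linorder_not_le)
    have pos: "0 < cmod (w i - w j)" if "j < i" for i j
    proof -
      have "(\<Prod>j<i. cmod (w i - w j)) \<noteq> 0"
        using big[of i] that by (metis exp_gt_zero gr_zeroI less_asym less_nat_zero_code)
      then show ?thesis using that by (auto simp: prod_zero_iff)
    qed
    have "w i \<noteq> w j" if "i \<noteq> j" for i j
      using pos[of i j] pos[of j i] that by (cases "i < j") auto
    moreover have "(\<Sum>i<n. \<Sum>j<i. ln (1 / cmod (w i - w j))) \<le> M' * (real n)\<^sup>2" for n
    proof -
      have "(\<Sum>j<i. ln (1 / cmod (w i - w j))) \<le> M' * real n" if i: "i < n" for i
      proof (cases "i = 0")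
        case False
        have "(\<Sum>j<i. ln (1 / cmod (w i - w j))) = - ln (\<Prod>j<i. cmod (w i - w j))"
          using pos by (subst ln_prod) (auto simp: ln_div sum_negf intro!: sum.cong)
        also have "\<dots> \<le> M' * real i"
          using big[of i] False by (simp add: ln_ge_iff less_imp_le order_less_le_trans[OF exp_gt_zero] flip: minus_le_iff)
            (smt (verit) exp_gt_zero ln_exp ln_less_cancel_iff)
        also have "\<dots> \<le> M' * real n" using i by (intro mult_left_mono) (auto simp: M'_def)
        finally show ?thesis .
      qed (auto simp: M'_def)
      then have "(\<Sum>i<n. \<Sum>j<i. ln (1 / cmod (w i - w j))) \<le> (\<Sum>i<n. M' * real n)"
        by (intro sum_mono) auto
      then show ?thesis by (simp add: power2_eq_square mult_ac)
    qed
    ultimately have False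
      by (intro no_finite_energy[where K = K and w = w and M = M'] K(1,2) H1K w) (auto simp: M'_def)
    then show ?thesis ..
  qed
qed

text \<open>Around \<open>z\<close> a ball is chosen in which \<open>H1\<close> vanishes at most at
  \<open>z\<close>. The compact sets \<open>K j\<close> omit a disc about \<open>z\<close>, so large
  potentials exist on each of them, while \<open>z\<close> itself receives its own pole.\<close>

lemma polar_complement: "polar_set (ball 0 1 - F ` D)"
  unfolding polar_set_def
proof
  fix z assume z: "z \<in> ball 0 1 - F ` D"
  define P where "P = ball 0 1 - F ` D"
  have Fp: "F p \<in> ball 0 1" "H1 (F p) \<noteq> 0" using F_disc p H1_image by auto
  obtain \<delta> where \<delta>: "0 < \<delta>" "ball z \<delta> \<subseteq> ball 0 1" and nz: "\<And>\<xi>. \<xi> \<in> ball z \<delta> - {z} \<Longrightarrow> H1 \<xi> \<noteq> 0"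
  proof (cases "H1 z = 0")
    case True
    show thesis
      by (rule isolated_zeros[OF hol_H1 open_ball connected_ball _ True Fp]) (use z that in auto)
  next
    case False
    have "open (ball 0 1 \<inter> H1 -` (-{0}))"
      by (intro continuous_open_preimage holomorphic_on_imp_continuous_on hol_H1) auto
    moreover have "z \<in> ball 0 1 \<inter> H1 -` (-{0})" using False z by auto
    ultimately obtain e where "0 < e" "ball z e \<subseteq> ball 0 1 \<inter> H1 -` (-{0})"
      using open_contains_ball by meson
    then show thesis by (intro that[of e]) auto
  qed
  define \<epsilon> where "\<epsilon> = \<delta> / 2"
  have \<epsilon>: "0 < \<epsilon>" "cball z \<epsilon> \<subseteq> ball z \<delta>" using \<delta> by (auto simp: \<epsilon>_def)
  define C where "C = cball z \<epsilon> \<inter> - F ` D"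
  have cC: "compact C" unfolding C_def using open_image by (intro compact_Int_closed) auto
  have CP: "C \<subseteq> P" using \<epsilon>(2) \<delta>(2) by (auto simp: C_def P_def)
  define K where "K j = C - ball z (\<epsilon> / real (Suc j))" for j
  have cK: "compact (K j)" for j unfolding K_def using cC by (rule compact_diff) auto
  have "z \<in> closure (F ` D)" using image_dense z by blast
  then have "z \<in> ball z \<epsilon> \<inter> closure (F ` D)" using \<epsilon>(1) by simp
  then have "ball z \<epsilon> \<inter> F ` D \<noteq> {}" using open_Int_closure_eq_empty[OF open_ball, of z \<epsilon> "F ` D"] by blast
  \<comment> \<open>Density of the image provides a point outside \<open>C\<close>, where the
    potential will be finite.\<close>
  then obtain b where b: "b \<in> ball z \<epsilon>" "b \<in> F ` D" by blast
  have "\<exists>u. subharmonic_on u (ball z \<epsilon>) \<and> (\<exists>w\<in>ball z \<epsilon>. u w \<noteq> -\<infinity>) \<and> P \<inter> ball z \<epsilon> \<subseteq> {w. u w = -\<infinity>}"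
  proof (rule polar_neighbourhood[of \<epsilon> C z b P K])
    show "P \<inter> ball z \<epsilon> \<subseteq> insert z (\<Union>j. K j)"
    proof
      fix x assume x: "x \<in> P \<inter> ball z \<epsilon>"
      show "x \<in> insert z (\<Union>j. K j)"
      proof (cases "x = z")
        case False
        then have "0 < dist z x / \<epsilon>" using \<epsilon> by simp
        then obtain j where "1 / real (Suc j) < dist z x / \<epsilon>" using nat_approx_posE by blast
        then have "\<epsilon> / real (Suc j) < dist z x" using \<epsilon> by (simp add: field_simps)
        then have "x \<in> K j" using x by (auto simp: K_def C_def P_def)
        then show ?thesis by blast
      qed simp
    qed
    show "incseq K"
    proof (rule incseq_SucI)
      fix j
      have "\<epsilon> / real (Suc (Suc j)) \<le> \<epsilon> / real (Suc j)" using \<epsilon> by (intro divide_left_mono) auto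
      then show "K j \<subseteq> K (Suc j)" by (auto simp: K_def)
    qed
    fix j M
    show "\<exists>n w. 0 < n \<and> (\<forall>i<n. w i \<in> C) \<and> (\<forall>\<zeta>\<in>K j. ennreal (real n * M) \<le> (\<Sum>i<n. log_pot (9 * \<epsilon>) (\<zeta> - w i)))"
    proof (cases "K j = {}")
      case True
      then show ?thesis using z \<epsilon> by (intro exI[of _ 1] exI[of _ "\<lambda>_. z"]) (auto simp: C_def)
    next
      case False
      have KC: "K j \<subseteq> C" by (auto simp: K_def)
      have "\<exists>n w. 0 < n \<and> (\<forall>i<n. w i \<in> K j) \<and> (\<forall>\<zeta>\<in>K j. ennreal (real n * M) \<le> (\<Sum>i<n. log_pot (9 * \<epsilon>) (\<zeta> - w i)))"
      proof (rule small_potentials[OF cK _ False])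
        show "K j \<subseteq> ball 0 1 - F ` D" using KC CP by (auto simp: P_def)
        show "H1 \<xi> \<noteq> 0" if "\<xi> \<in> K j" for \<xi>
        proof (rule nz)
          have "\<xi> \<noteq> z" using that \<epsilon> by (auto simp: K_def)
          moreover have "\<xi> \<in> ball z \<delta>" using that \<epsilon>(2) by (auto simp: K_def C_def)
          ultimately show "\<xi> \<in> ball z \<delta> - {z}" by blast
        qed
        show "cmod (x - y) \<le> 9 * \<epsilon>" if "x \<in> K j" "y \<in> K j" for x y
        proof -
          have "dist z x \<le> \<epsilon>" "dist z y \<le> \<epsilon>" using that by (auto simp: K_def C_def)
          then show ?thesis using dist_triangle[of x y z] \<epsilon> by (simp add: dist_norm norm_minus_commute)
        qed
      qed (use \<epsilon> in auto)
      then show ?thesis using KC by blast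
    qed
  qed (use \<epsilon> b z cC in \<open>auto simp: C_def intro: compact_imp_closed\<close>)
  then show "\<exists>U u. open U \<and> connected U \<and> z \<in> U \<and> subharmonic_on u U \<and> (\<exists>w\<in>U. u w \<noteq> - \<infinity>) \<and>
       (ball 0 1 - F ` D) \<inter> U \<subseteq> {w. u w = - \<infinity>}"
    using \<epsilon>(1) unfolding P_def by (intro exI[of _ "ball z \<epsilon>"]) auto
qed

end

lemma conclusion:
  "\<exists>P. P \<subseteq> ball 0 1 \<and> closedin (top_of_set (ball 0 1)) P \<and> polar_set P \<and> biholomorphic D (ball 0 1 - P)"
proof -
  obtain H1 where "H1 holomorphic_on ball 0 1" "\<And>w. w \<in> D \<Longrightarrow> deriv F w = ker w p * H1 (F w)"
    by (rule factor_through_disc[OF p hol_F F_disc ker_form dF_A]) (auto intro: that)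
  then have polar: "polar_set (ball 0 1 - F ` D)" by (rule polar_complement)
  have eq: "ball 0 1 - (ball 0 1 - F ` D) = F ` D" using F_disc by blast
  obtain g where g: "g holomorphic_on F ` D" "\<And>z. z \<in> D \<Longrightarrow> deriv F z * deriv g (F z) = 1" "\<And>z. z \<in> D \<Longrightarrow> g (F z) = z"
    using holomorphic_has_inverse[OF hol_F open_D inj_F] by metis
  have "homeomorphism D (F ` D) F g"
    by (rule homeomorphismI) (use g cont_F in \<open>auto intro: holomorphic_on_imp_continuous_on\<close>)
  then have "biholomorphic D (ball 0 1 - (ball 0 1 - F ` D))"
    unfolding biholomorphic_def eq using hol_F g(1) by blast
  moreover have "closedin (top_of_set (ball 0 1)) (ball 0 1 - F ` D)"
    using open_image F_disc by (intro closedin_diff) (auto simp: openin_open_eq)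
  ultimately show ?thesis using polar by blast
qed

end

theorem theorem1p6:
  fixes D :: "complex set"
  assumes "open D" and "connected D" and "D \<noteq> {}"
    and "has_bergman_metric D"
    and "open (D \<union> irregular_boundary_points D)"
    and "\<forall>z\<in>D. bergman_curvature D z = - 2"
  shows "\<exists>P. P \<subseteq> ball 0 1 \<and> closedin (top_of_set (ball 0 1)) P \<and> polar_set P \<and>
             biholomorphic D (ball 0 1 - P)"
proof -
  interpret liouville_domain D
    using assms by unfold_locales auto
  obtain p where p: "p \<in> D" using assms(3) by blast
  obtain F where F: "F holomorphic_on D" "inj_on F D" "F ` D \<subseteq> ball 0 1"
    "\<And>z. z \<in> D \<Longrightarrow> deriv F z \<noteq> 0"
    "\<And>z w. z \<in> D \<Longrightarrow> w \<in> D \<Longrightarrow> ker z w * ker p p * (1 - F z * cnj (F w))\<^sup>2 = ker z p * ker p w"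
    by (rule developing_map[OF p], rule that)
  interpret developed_domain D p F
    using p F by unfold_locales auto
  show ?thesis by (rule conclusion)
qed

end
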